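(* There is an algebraic principal $\operatorname{PGL}_2(\mathbb C)$-bundle $$\operatorname{PGL}_2(\mathbb C)\longrightarrow R_3\longrightarrow \mathbb P^4\setminus D$$ (for the action of $\operatorname{PGL}_2(\mathbb C)$ on $R_3$ by postcomposition), where, in homogeneous coordinates $[X:Y:Z:V:W]$ on $\mathbb P^4$, $$D=\left\{XZW-XV^2-Y^2W+2YVZ-Z^3=0\right\}\subset\mathbb P^4 .$$ Moreover, $D$ is irreducible.
   Context: $R_3$ denotes the complex manifold of degree-three holomorphic self-maps of $\mathbb P^1$ over $\mathbb C$: its points are pairs $[p:q]$ of binary cubic forms without a common zero, modulo simultaneous nonzero scaling, so that $R_3$ is the Zariski-open subset of $\mathbb P^7$ where the resultant of $p,q$ is nonzero. *)

theory Defs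
  imports "HOL-Analysis.Analysis" "HOL-Algebra.Group_Action"
begin

section \<open>Spaces with functions\<close>

text \<open>
  Complex varieties are treated as topological spaces with a sheaf of complex-valued functions.
  The set \<open>regular X U\<close> is meaningful for \<open>U\<close> open in \<open>X\<close>; its members are total functions of
  which only the values on \<open>U\<close> matter.
\<close>

record 'a fspace =
  zar :: "'a topology"
  regular :: "'a set \<Rightarrow> ('a \<Rightarrow> complex) set"

abbreviation points :: "'a fspace \<Rightarrow> 'a set" where
  "points X \<equiv> topspace (zar X)"

definition morphism :: "'a fspace \<Rightarrow> 'b fspace \<Rightarrow> ('a \<Rightarrow> 'b) \<Rightarrow> bool" where
  "morphism X Y \<phi> \<longleftrightarrow>
     continuous_map (zar X) (zar Y) \<phi> \<and>
     (\<forall>U f. openin (zar Y) U \<longrightarrow> f \<in> regular Y U \<longrightarrow>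
        f \<circ> \<phi> \<in> regular X {x \<in> points X. \<phi> x \<in> U})"

definition isomorphism :: "'a fspace \<Rightarrow> 'b fspace \<Rightarrow> ('a \<Rightarrow> 'b) \<Rightarrow> bool" where
  "isomorphism X Y \<phi> \<longleftrightarrow>
     morphism X Y \<phi> \<and>
     (\<exists>\<psi>. morphism Y X \<psi> \<and> (\<forall>x \<in> points X. \<psi> (\<phi> x) = x) \<and> (\<forall>y \<in> points Y. \<phi> (\<psi> y) = y))"

text \<open>
  The structure induced on a subset \<open>A\<close>: the regular functions are those that locally extend to
  regular functions on the ambient space. For \<open>A\<close> open this is the open subspace, and for \<open>A\<close>
  locally closed in a variety it is the reduced subvariety.
\<close>

definition subspace_on :: "'a fspace \<Rightarrow> 'a set \<Rightarrow> 'a fspace" where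
  "subspace_on X A =
     \<lparr>zar = subtopology (zar X) A,
      regular = (\<lambda>U. {f. \<forall>x\<in>U. \<exists>W g. openin (zar X) W \<and> x \<in> W \<and> g \<in> regular X W \<and>
                                    (\<forall>z \<in> W \<inter> U. f z = g z)})\<rparr>"

text \<open>
  The product of varieties (not the product topology): the functions
  \<open>\<Sum>i. a\<^sub>i(x) b\<^sub>i(y)\<close> on products of open sets are regular, their nonvanishing loci form a basis of
  the topology, and every regular function is locally a quotient of two such functions.
\<close>

definition tensor_functions ::
    "'a fspace \<Rightarrow> 'b fspace \<Rightarrow> 'a set \<Rightarrow> 'b set \<Rightarrow> ('a \<times> 'b \<Rightarrow> complex) set" where
  "tensor_functions X Y U V =
     {F. \<exists>(n::nat) a b. (\<forall>i<n. a i \<in> regular X U \<and> b i \<in> regular Y V) \<and>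
                        F = (\<lambda>(x, y). \<Sum>i<n. a i x * b i y)}"

definition product_zar :: "'a fspace \<Rightarrow> 'b fspace \<Rightarrow> ('a \<times> 'b) topology" where
  "product_zar X Y = topology_generated_by
     {{z \<in> U \<times> V. F z \<noteq> 0} | U V F.
        openin (zar X) U \<and> openin (zar Y) V \<and> F \<in> tensor_functions X Y U V}"

definition product_space :: "'a fspace \<Rightarrow> 'b fspace \<Rightarrow> ('a \<times> 'b) fspace" where
  "product_space X Y =
     \<lparr>zar = product_zar X Y,
      regular = (\<lambda>W. {f. \<forall>p\<in>W. \<exists>N U V F H.
         openin (product_zar X Y) N \<and> p \<in> N \<and> N \<subseteq> W \<and>
         openin (zar X) U \<and> openin (zar Y) V \<and> N \<subseteq> U \<times> V \<and>
         F \<in> tensor_functions X Y U V \<and> H \<in> tensor_functions X Y U V \<and>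
         (\<forall>z\<in>N. H z \<noteq> 0 \<and> f z = F z / H z)})\<rparr>"

definition irreducible_set :: "'a topology \<Rightarrow> 'a set \<Rightarrow> bool" where
  "irreducible_set T S \<longleftrightarrow>
     S \<subseteq> topspace T \<and> S \<noteq> {} \<and>
     (\<forall>A B. closedin T A \<longrightarrow> closedin T B \<longrightarrow> S \<subseteq> A \<union> B \<longrightarrow> S \<subseteq> A \<or> S \<subseteq> B)"

section \<open>Algebraic groups and principal bundles\<close>

definition algebraic_group :: "'g monoid \<Rightarrow> 'g fspace \<Rightarrow> bool" where
  "algebraic_group G VG \<longleftrightarrow>
     group G \<and> carrier G = points VG \<and>
     morphism (product_space VG VG) VG (\<lambda>(g, h). g \<otimes>\<^bsub>G\<^esub> h) \<and>
     morphism VG VG (\<lambda>g. inv\<^bsub>G\<^esub> g)"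

text \<open>
  A (left) principal bundle, locally trivial in the Zariski topology of the base. Surjectivity of
  \<open>\<pi>\<close>, freeness of the action and the fact that the fibres are the orbits follow from the
  equivariant local trivialisations.
\<close>

definition algebraic_principal_bundle ::
    "'g monoid \<Rightarrow> 'g fspace \<Rightarrow> ('g \<Rightarrow> 'x \<Rightarrow> 'x) \<Rightarrow> 'x fspace \<Rightarrow> 'y fspace \<Rightarrow> ('x \<Rightarrow> 'y) \<Rightarrow> bool" where
  "algebraic_principal_bundle G VG act X Y \<pi> \<longleftrightarrow>
     algebraic_group G VG \<and>
     group_action G (points X) act \<and>
     morphism (product_space VG X) X (\<lambda>(g, x). act g x) \<and>
     morphism X Y \<pi> \<and>
     (\<forall>y \<in> points Y. \<exists>V \<phi>.
        openin (zar Y) V \<and> y \<in> V \<and>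
        isomorphism (product_space VG (subspace_on Y V))
                    (subspace_on X {x \<in> points X. \<pi> x \<in> V}) \<phi> \<and>
        (\<forall>g \<in> carrier G. \<forall>v \<in> V. \<pi> (\<phi> (g, v)) = v) \<and>
        (\<forall>g \<in> carrier G. \<forall>h \<in> carrier G. \<forall>v \<in> V. \<phi> (h \<otimes>\<^bsub>G\<^esub> g, v) = act h (\<phi> (g, v))))"

section \<open>Projective space\<close>

definition proportional :: "complex^'n \<Rightarrow> complex^'n \<Rightarrow> bool" where
  "proportional v w \<longleftrightarrow> v \<noteq> 0 \<and> (\<exists>c. c \<noteq> 0 \<and> w = c *s v)"

text \<open>
  \<open>'n proj\<close> is the projective space of \<open>complex^'n\<close>, of dimension \<open>CARD('n) - 1\<close>. The function
  \<open>rep_proj\<close> chooses a nonzero representative; \<open>abs_proj v\<close> is the class of \<open>v\<close> for \<open>v \<noteq> 0\<close>.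
\<close>

quotient_type 'n proj = "complex^'n" / partial: proportional
proof (rule part_equivpI)
  show "\<exists>v :: complex^'n. proportional v v"
    by (rule exI[of _ "1"]) (auto simp: proportional_def vec_eq_iff intro!: exI[of _ 1])
  show "symp (proportional :: complex^'n \<Rightarrow> _)"
  proof (rule sympI)
    fix v w :: "complex^'n"
    assume "proportional v w"
    then obtain c where "v \<noteq> 0" "c \<noteq> 0" "w = c *s v"
      by (auto simp: proportional_def)
    then show "proportional w v"
      by (auto simp: proportional_def vector_smult_assoc intro!: exI[of _ "inverse c"])
  qed
  show "transp (proportional :: complex^'n \<Rightarrow> _)"
  proof (rule transpI)
    fix u v w :: "complex^'n"
    assume "proportional u v" "proportional v w"
    then obtain c d where "u \<noteq> 0" "c \<noteq> 0" "d \<noteq> 0" "v = c *s u" "w = d *s v"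
      by (auto simp: proportional_def)
    then show "proportional u w"
      by (auto simp: proportional_def vector_smult_assoc intro!: exI[of _ "d * c"])
  qed
qed

definition homogeneous :: "nat \<Rightarrow> (complex^'n \<Rightarrow> complex) set" where
  "homogeneous d =
     {f. \<exists>c :: ('n \<Rightarrow> nat) \<Rightarrow> complex.
           f = (\<lambda>v. \<Sum>\<alpha> | (\<Sum>i\<in>UNIV. \<alpha> i) = d. c \<alpha> * (\<Prod>i\<in>UNIV. (v $ i) ^ \<alpha> i))}"

definition proj_zar :: "('n::finite) proj topology" where
  "proj_zar = topology_generated_by {{x. f (rep_proj x) \<noteq> 0} | f d. f \<in> homogeneous d}"

definition projective_space :: "('n::finite) proj fspace" where
  "projective_space =
     \<lparr>zar = proj_zar,
      regular = (\<lambda>U. {f. \<forall>x\<in>U. \<exists>W d. \<exists>g \<in> homogeneous d. \<exists>h \<in> homogeneous d.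
         openin proj_zar W \<and> x \<in> W \<and> W \<subseteq> U \<and>
         (\<forall>z\<in>W. h (rep_proj z) \<noteq> 0 \<and> f z = g (rep_proj z) / h (rep_proj z))})\<rparr>"

section \<open>\<open>PGL\<^sub>2\<close> and the space of rational maps of degree three\<close>

definition to_matrix :: "complex^('r \<times> 'c) \<Rightarrow> complex^'c^'r" where
  "to_matrix v = (\<chi> i j. v $ (i, j))"

definition of_matrix :: "complex^'c^'r \<Rightarrow> complex^('r \<times> 'c)" where
  "of_matrix A = (\<chi> k. A $ fst k $ snd k)"

text \<open>The product of classes of matrices; meaningful whenever the matrix product is nonzero.\<close>

definition proj_mult ::
    "('r::finite \<times> 'k::finite) proj \<Rightarrow> ('k \<times> 'c::finite) proj \<Rightarrow> ('r \<times> 'c) proj" where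
  "proj_mult g x = abs_proj (of_matrix (to_matrix (rep_proj g) ** to_matrix (rep_proj x)))"

definition PGL2_points :: "(2 \<times> 2) proj set" where
  "PGL2_points = {g. det (to_matrix (rep_proj g)) \<noteq> 0}"

definition PGL2 :: "(2 \<times> 2) proj monoid" where
  "PGL2 = \<lparr>carrier = PGL2_points, mult = proj_mult, one = abs_proj (of_matrix (mat 1))\<rparr>"

definition PGL2_variety :: "(2 \<times> 2) proj fspace" where
  "PGL2_variety = subspace_on projective_space PGL2_points"

definition cubic_form :: "complex^4 \<Rightarrow> complex \<Rightarrow> complex \<Rightarrow> complex" where
  "cubic_form c s t = c $ 1 * s^3 + c $ 2 * s^2 * t + c $ 3 * s * t^2 + c $ 4 * t^3"

text \<open>
  A pair \<open>(p, q)\<close> of binary cubic forms is the \<open>2 \<times> 4\<close> matrix with rows the coefficients of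
  \<open>p\<close> and \<open>q\<close>, so that postcomposition with a Moebius transformation, which sends \<open>[p : q]\<close> to
  \<open>[a p + b q : c p + d q]\<close>, is multiplication by the matrix of the transformation.
\<close>

definition R3_points :: "(2 \<times> 4) proj set" where
  "R3_points = {x. \<not> (\<exists>s t. (s, t) \<noteq> (0, 0) \<and>
                        cubic_form (to_matrix (rep_proj x) $ 1) s t = 0 \<and>
                        cubic_form (to_matrix (rep_proj x) $ 2) s t = 0)}"

definition R3 :: "(2 \<times> 4) proj fspace" where
  "R3 = subspace_on projective_space R3_points"

definition postcomposition :: "(2 \<times> 2) proj \<Rightarrow> (2 \<times> 4) proj \<Rightarrow> (2 \<times> 4) proj" where
  "postcomposition g = restrict (proj_mult g) R3_points"

definition D_form :: "complex^5 \<Rightarrow> complex" where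
  "D_form v = (let X = v $ 1; Y = v $ 2; Z = v $ 3; V = v $ 4; W = v $ 5
               in X * Z * W - X * V^2 - Y^2 * W + 2 * Y * V * Z - Z^3)"

definition D :: "5 proj set" where
  "D = {x. D_form (rep_proj x) = 0}"

end

theory Submission
  imports Defs "HOL-Computational_Algebra.Fundamental_Theorem_Algebra"
begin

text \<open>
  A pair of binary cubic forms without common zero is a \<open>2 \<times> 4\<close> matrix \<open>M\<close>, and
  postcomposition is multiplication from the left, so that the orbit of \<open>M\<close> is determined by the
  plane spanned by its rows, that is, by the minors \<open>P i j\<close> of \<open>M\<close> up to scaling. The
  Bezout matrix of the two forms is symmetric of size \<open>3 \<times> 3\<close>, its six entries are
  independent linear forms in the six minors, and its determinant is the resultant, up to sign
  (\<open>common_zero_iff_bezoutian_det\<close>). Under the passage to the adjugate the Pluecker relation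
  becomes linear: it says that the adjugate is a Hankel matrix, with rows \<open>X Y Z\<close>,
  \<open>Y Z V\<close>, \<open>Z V W\<close>. The form defining \<open>D\<close> is the determinant of this Hankel
  matrix. Since a symmetric \<open>3 \<times> 3\<close> matrix is recovered from its adjugate up to a power of
  its determinant (\<open>kernel_minor_hankel\<close>, \<open>hankel_kernel_minor\<close>), sending \<open>M\<close> to
  the adjugate of its Bezout matrix identifies the orbits in \<open>R\<^sub>3\<close> with the points outside
  \<open>D\<close>.

  The plane belonging to a point \<open>[X : Y : Z : V : W]\<close> is the kernel of the matrix with rows
  \<open>X Y Z V\<close> and \<open>Y Z V W\<close>, so its minors are quadratic in the coordinates. Where the minor
  of the columns \<open>i\<close>, \<open>j\<close> does not vanish, these quadratic forms give a section of the
  quotient map, and the columns \<open>i\<close>, \<open>j\<close> of \<open>M\<close> give the inverse of the resulting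
  trivialisation (\<open>local_trivialization\<close>). All maps in question are given by polynomials in
  homogeneous coordinates; that such maps are morphisms, also on products and on subvarieties, is
  proved once for all spaces with a well-behaved sheaf of functions
  (\<open>morphism_bihomogeneous\<close>, \<open>morphism_Pair\<close>, \<open>morphism_into_subspace\<close>).

  The cone over \<open>D\<close> consists of the vectors whose Hankel matrix has a kernel, that is, of the
  sequences of length five that satisfy a linear recurrence of order two. It is the image of an affine
  space under a polynomial map (\<open>annihilated_vector_surj\<close>), and such an image is irreducible.
\<close>

section \<open>Spaces with functions\<close>

text \<open>
  The structural properties shared by all spaces that occur below: regular functions form a sheaf of
  algebras in which a nowhere vanishing function is invertible and has an open nonvanishing locus.
  These properties are all that morphisms into projective space and into products depend on, and they
  pass to subspaces and to products, so that no case distinction between the spaces is ever made.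
\<close>

locale space_with_functions =
  fixes X :: "'a fspace"
  assumes regular_const: "openin (zar X) U \<Longrightarrow> (\<lambda>_. c) \<in> regular X U"
    and regular_add: "openin (zar X) U \<Longrightarrow> f \<in> regular X U \<Longrightarrow> g \<in> regular X U
          \<Longrightarrow> (\<lambda>x. f x + g x) \<in> regular X U"
    and regular_mult: "openin (zar X) U \<Longrightarrow> f \<in> regular X U \<Longrightarrow> g \<in> regular X U
          \<Longrightarrow> (\<lambda>x. f x * g x) \<in> regular X U"
    and regular_inverse: "openin (zar X) U \<Longrightarrow> f \<in> regular X U \<Longrightarrow> (\<And>x. x \<in> U \<Longrightarrow> f x \<noteq> 0)
          \<Longrightarrow> (\<lambda>x. inverse (f x)) \<in> regular X U"
    and regular_restrict: "openin (zar X) U \<Longrightarrow> openin (zar X) W \<Longrightarrow> W \<subseteq> U \<Longrightarrow> f \<in> regular X U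
          \<Longrightarrow> f \<in> regular X W"
    and regular_local_subset: "openin (zar X) U
          \<Longrightarrow> (\<And>x. x \<in> U \<Longrightarrow> \<exists>W g. openin (zar X) W \<and> x \<in> W \<and> W \<subseteq> U \<and> g \<in> regular X W \<and>
                                (\<forall>z\<in>W. f z = g z))
          \<Longrightarrow> f \<in> regular X U"
    and openin_nonvanishing: "openin (zar X) U \<Longrightarrow> f \<in> regular X U
          \<Longrightarrow> openin (zar X) {x \<in> U. f x \<noteq> 0}"
begin

text \<open>
  The neighbourhoods witnessing local regularity may leave \<open>U\<close>, since they can be
  intersected with it.
\<close>

lemma regular_local:
  assumes U: "openin (zar X) U"
    and "\<And>x. x \<in> U \<Longrightarrow> \<exists>W g. openin (zar X) W \<and> x \<in> W \<and> g \<in> regular X W \<and>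
                             (\<forall>z \<in> W \<inter> U. f z = g z)"
  shows "f \<in> regular X U"
proof (rule regular_local_subset[OF U])
  fix x assume "x \<in> U"
  then obtain W g where W: "openin (zar X) W" "x \<in> W" "g \<in> regular X W" "\<forall>z \<in> W \<inter> U. f z = g z"
    using assms(2) by blast
  have "g \<in> regular X (W \<inter> U)"
    by (rule regular_restrict[OF W(1)]) (use U W in auto)
  then show "\<exists>W g. openin (zar X) W \<and> x \<in> W \<and> W \<subseteq> U \<and> g \<in> regular X W \<and> (\<forall>z\<in>W. f z = g z)"
    using W U \<open>x \<in> U\<close> by (intro exI[of _ "W \<inter> U"] exI[of _ g]) auto
qed

lemma regular_cong:
  assumes "openin (zar X) U" "g \<in> regular X U" "\<And>x. x \<in> U \<Longrightarrow> f x = g x"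
  shows "f \<in> regular X U"
  using assms by (intro regular_local[OF assms(1)]) blast

lemma regular_sum:
  assumes "openin (zar X) U" "\<And>i. i \<in> I \<Longrightarrow> f i \<in> regular X U"
  shows "(\<lambda>x. \<Sum>i\<in>I. f i x) \<in> regular X U"
  using assms(2) by (induction I rule: infinite_finite_induct) (auto intro: regular_const regular_add assms(1))

lemma regular_divide:
  assumes "openin (zar X) U" "f \<in> regular X U" "g \<in> regular X U" "\<And>x. x \<in> U \<Longrightarrow> g x \<noteq> 0"
  shows "(\<lambda>x. f x / g x) \<in> regular X U"
  unfolding divide_inverse using assms by (intro regular_mult regular_inverse) auto

end

lemma morphism_continuous: "morphism X Y \<phi> \<Longrightarrow> continuous_map (zar X) (zar Y) \<phi>"
  by (simp add: morphism_def)

lemma morphism_points: "morphism X Y \<phi> \<Longrightarrow> x \<in> points X \<Longrightarrow> \<phi> x \<in> points Y"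
  by (auto simp: morphism_def continuous_map_def)

lemma openin_morphism_preimage:
  "morphism X Y \<phi> \<Longrightarrow> openin (zar Y) U \<Longrightarrow> openin (zar X) {x \<in> points X. \<phi> x \<in> U}"
  by (rule openin_continuous_map_preimage[OF morphism_continuous])

lemma morphism_comp:
  assumes "morphism X Y \<phi>" "morphism Y Z \<psi>"
  shows "morphism X Z (\<psi> \<circ> \<phi>)"
  unfolding morphism_def
proof (intro conjI allI impI)
  show "continuous_map (zar X) (zar Z) (\<psi> \<circ> \<phi>)"
    using assms by (auto simp: morphism_def intro: continuous_map_compose)
  fix U f assume U: "openin (zar Z) U" "f \<in> regular Z U"
  let ?V = "{y \<in> points Y. \<psi> y \<in> U}"
  have "openin (zar Y) ?V" "f \<circ> \<psi> \<in> regular Y ?V"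
    using assms(2) U openin_morphism_preimage by (auto simp: morphism_def)
  then have "f \<circ> \<psi> \<circ> \<phi> \<in> regular X {x \<in> points X. \<phi> x \<in> ?V}"
    using assms(1) by (auto simp: morphism_def)
  moreover have "{x \<in> points X. \<phi> x \<in> ?V} = {x \<in> points X. (\<psi> \<circ> \<phi>) x \<in> U}"
    using morphism_points[OF assms(1)] by auto
  ultimately show "f \<circ> (\<psi> \<circ> \<phi>) \<in> regular X {x \<in> points X. (\<psi> \<circ> \<phi>) x \<in> U}"
    by (simp add: comp_assoc)
qed

lemma (in space_with_functions) morphism_cong:
  assumes \<psi>: "morphism X Y \<psi>" and eq: "\<And>x. x \<in> points X \<Longrightarrow> \<phi> x = \<psi> x"
  shows "morphism X Y \<phi>"
  unfolding morphism_def
proof (intro conjI allI impI)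
  show "continuous_map (zar X) (zar Y) \<phi>"
    using morphism_continuous[OF \<psi>] eq by (auto intro: continuous_map_eq)
  fix U f assume U: "openin (zar Y) U" "f \<in> regular Y U"
  have pre: "{x \<in> points X. \<phi> x \<in> U} = {x \<in> points X. \<psi> x \<in> U}"
    using eq by auto
  show "f \<circ> \<phi> \<in> regular X {x \<in> points X. \<phi> x \<in> U}"
    unfolding pre
    by (rule regular_cong[of _ "f \<circ> \<psi>", OF openin_morphism_preimage[OF \<psi> U(1)]])
      (use U \<psi> eq in \<open>auto simp: morphism_def\<close>)
qed

lemma zar_subspace_on [simp]: "zar (subspace_on X A) = subtopology (zar X) A"
  by (simp add: subspace_on_def)

lemma regular_subspace_onE:
  assumes "f \<in> regular (subspace_on X A) U" "x \<in> U"
  obtains W g where "openin (zar X) W" "x \<in> W" "g \<in> regular X W" "\<forall>z \<in> W \<inter> U. f z = g z"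
  using assms unfolding subspace_on_def by fastforce

lemma regular_subspace_onI:
  assumes "\<And>x. x \<in> U \<Longrightarrow> \<exists>W g. openin (zar X) W \<and> x \<in> W \<and> g \<in> regular X W \<and>
                              (\<forall>z \<in> W \<inter> U. f z = g z)"
  shows "f \<in> regular (subspace_on X A) U"
  using assms unfolding subspace_on_def by simp

context space_with_functions
begin

text \<open>
  Every operation is carried out on local extensions to the ambient space; two extensions given on
  different open sets are first restricted to the intersection.
\<close>

lemma space_with_functions_subspace_on: "space_with_functions (subspace_on X A)"
proof (unfold_locales, unfold zar_subspace_on)
  let ?T = "subtopology (zar X) A" and ?R = "regular (subspace_on X A)"
  fix U assume U: "openin ?T U"
  have U_sub: "U \<subseteq> points X"
    using U openin_subset by fastforce
  have common: "\<exists>W g1 g2. openin (zar X) W \<and> x \<in> W \<and> g1 \<in> regular X W \<and> g2 \<in> regular X W \<and>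
      (\<forall>z \<in> W \<inter> U. f1 z = g1 z \<and> f2 z = g2 z)"
    if f: "f1 \<in> ?R U" "f2 \<in> ?R U" and x: "x \<in> U" for f1 f2 x
  proof -
    obtain W1 g1 where 1: "openin (zar X) W1" "x \<in> W1" "g1 \<in> regular X W1" "\<forall>z \<in> W1 \<inter> U. f1 z = g1 z"
      using f(1) x by (rule regular_subspace_onE)
    obtain W2 g2 where 2: "openin (zar X) W2" "x \<in> W2" "g2 \<in> regular X W2" "\<forall>z \<in> W2 \<inter> U. f2 z = g2 z"
      using f(2) x by (rule regular_subspace_onE)
    have W: "openin (zar X) (W1 \<inter> W2)"
      using 1 2 by auto
    have "g1 \<in> regular X (W1 \<inter> W2)" "g2 \<in> regular X (W1 \<inter> W2)"
      using regular_restrict[OF 1(1) W _ 1(3)] regular_restrict[OF 2(1) W _ 2(3)] by auto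
    then show ?thesis
      using 1 2 W by (intro exI[of _ "W1 \<inter> W2"] exI[of _ g1] exI[of _ g2]) auto
  qed
  show "(\<lambda>_. c) \<in> ?R U" for c
    using U_sub by (intro regular_subspace_onI exI[of _ "points X"] exI[of _ "\<lambda>_. c"])
      (auto intro: regular_const)
  show "(\<lambda>x. f x + g x) \<in> ?R U" if "f \<in> ?R U" "g \<in> ?R U" for f g
  proof (rule regular_subspace_onI)
    fix x assume "x \<in> U"
    from common[OF that this] obtain W f' g' where
      "openin (zar X) W" "x \<in> W" "f' \<in> regular X W" "g' \<in> regular X W"
      "\<forall>z \<in> W \<inter> U. f z = f' z \<and> g z = g' z" by blast
    then show "\<exists>W h. openin (zar X) W \<and> x \<in> W \<and> h \<in> regular X W \<and> (\<forall>z\<in>W \<inter> U. f z + g z = h z)"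
      by (intro exI[of _ W] exI[of _ "\<lambda>x. f' x + g' x"]) (auto intro: regular_add)
  qed
  show "(\<lambda>x. f x * g x) \<in> ?R U" if "f \<in> ?R U" "g \<in> ?R U" for f g
  proof (rule regular_subspace_onI)
    fix x assume "x \<in> U"
    from common[OF that this] obtain W f' g' where
      "openin (zar X) W" "x \<in> W" "f' \<in> regular X W" "g' \<in> regular X W"
      "\<forall>z \<in> W \<inter> U. f z = f' z \<and> g z = g' z" by blast
    then show "\<exists>W h. openin (zar X) W \<and> x \<in> W \<and> h \<in> regular X W \<and> (\<forall>z\<in>W \<inter> U. f z * g z = h z)"
      by (intro exI[of _ W] exI[of _ "\<lambda>x. f' x * g' x"]) (auto intro: regular_mult)
  qed
  show "(\<lambda>x. inverse (f x)) \<in> ?R U" if f: "f \<in> ?R U" and nz: "\<And>x. x \<in> U \<Longrightarrow> f x \<noteq> 0" for f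
  proof (rule regular_subspace_onI)
    fix x assume x: "x \<in> U"
    obtain W g where W: "openin (zar X) W" "x \<in> W" "g \<in> regular X W" "\<forall>z \<in> W \<inter> U. f z = g z"
      using f x by (rule regular_subspace_onE)
    let ?W = "{z \<in> W. g z \<noteq> 0}"
    have open_W: "openin (zar X) ?W"
      by (rule openin_nonvanishing[OF W(1,3)])
    then have "(\<lambda>z. inverse (g z)) \<in> regular X ?W"
      by (intro regular_inverse regular_restrict[OF W(1) open_W _ W(3)]) auto
    then show "\<exists>W h. openin (zar X) W \<and> x \<in> W \<and> h \<in> regular X W \<and> (\<forall>z\<in>W \<inter> U. inverse (f z) = h z)"
      using W nz[OF x] x open_W by (intro exI[of _ ?W] exI[of _ "\<lambda>z. inverse (g z)"]) auto
  qed
  show "f \<in> ?R W" if "W \<subseteq> U" "f \<in> ?R U" for f W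
  proof (rule regular_subspace_onI)
    fix x assume "x \<in> W"
    with that have "x \<in> U" by auto
    with that(2) obtain V g where "openin (zar X) V" "x \<in> V" "g \<in> regular X V" "\<forall>z \<in> V \<inter> U. f z = g z"
      by (rule regular_subspace_onE)
    then show "\<exists>V g. openin (zar X) V \<and> x \<in> V \<and> g \<in> regular X V \<and> (\<forall>z\<in>V \<inter> W. f z = g z)"
      using that(1) by (intro exI[of _ V] exI[of _ g]) auto
  qed
  show "f \<in> ?R U"
    if loc: "\<And>x. x \<in> U \<Longrightarrow> \<exists>W g. openin ?T W \<and> x \<in> W \<and> W \<subseteq> U \<and> g \<in> ?R W \<and> (\<forall>z\<in>W. f z = g z)" for f
  proof (rule regular_subspace_onI)
    fix x assume "x \<in> U"
    from loc[OF this] obtain W g where W: "openin ?T W" "x \<in> W" "W \<subseteq> U" "g \<in> ?R W" "\<forall>z\<in>W. f z = g z"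
      by blast
    obtain V h where V: "openin (zar X) V" "x \<in> V" "h \<in> regular X V" "\<forall>z \<in> V \<inter> W. g z = h z"
      using W(4,2) by (rule regular_subspace_onE)
    obtain W' where W': "openin (zar X) W'" "W = W' \<inter> A"
      using W(1) by (auto simp: openin_subtopology)
    have VW: "openin (zar X) (V \<inter> W')"
      using V W' by auto
    have "h \<in> regular X (V \<inter> W')"
      using regular_restrict[OF V(1) VW _ V(3)] by auto
    moreover have "U \<subseteq> A"
      using U by (auto simp: openin_subtopology)
    ultimately show "\<exists>V h. openin (zar X) V \<and> x \<in> V \<and> h \<in> regular X V \<and> (\<forall>z\<in>V \<inter> U. f z = h z)"
      using W V W' VW by (intro exI[of _ "V \<inter> W'"] exI[of _ h]) auto
  qed
  show "openin ?T {x \<in> U. f x \<noteq> 0}" if f: "f \<in> ?R U" for f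
  proof (subst openin_subopen, intro ballI)
    fix x assume x: "x \<in> {x \<in> U. f x \<noteq> 0}"
    then obtain W g where W: "openin (zar X) W" "x \<in> W" "g \<in> regular X W" "\<forall>z \<in> W \<inter> U. f z = g z"
      using f by (auto elim: regular_subspace_onE)
    have "openin ?T (U \<inter> ({z \<in> W. g z \<noteq> 0} \<inter> A))"
      by (intro openin_Int U openin_subtopology_Int openin_nonvanishing W)
    then show "\<exists>V. openin ?T V \<and> x \<in> V \<and> V \<subseteq> {x \<in> U. f x \<noteq> 0}"
      using x W U openin_subset[OF U] by (intro exI[of _ "U \<inter> ({z \<in> W. g z \<noteq> 0} \<inter> A)"]) auto
  qed
qed

lemma morphism_inclusion: "morphism (subspace_on X A) X (\<lambda>x. x)"
  unfolding morphism_def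
proof (intro conjI allI impI)
  show "continuous_map (zar (subspace_on X A)) (zar X) (\<lambda>x. x)"
    by (simp add: continuous_map_from_subtopology)
  fix U f assume "openin (zar X) U" "f \<in> regular X U"
  then show "f \<circ> (\<lambda>x. x) \<in> regular (subspace_on X A) {x \<in> points (subspace_on X A). x \<in> U}"
    by (intro regular_subspace_onI) auto
qed

lemma morphism_restrict:
  assumes "morphism X Y \<phi>"
  shows "morphism (subspace_on X A) Y \<phi>"
  using morphism_comp[OF morphism_inclusion assms, of A] by (simp add: comp_def)

text \<open>
  A regular function on the subspace locally extends to the ambient space, where it can be pulled
  back; regularity being local, the pullbacks glue.
\<close>

lemma morphism_into_subspace:
  assumes \<phi>: "morphism X Y \<phi>" and into: "\<And>x. x \<in> points X \<Longrightarrow> \<phi> x \<in> B"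
  shows "morphism X (subspace_on Y B) \<phi>"
  unfolding morphism_def
proof (intro conjI allI impI)
  show cont: "continuous_map (zar X) (zar (subspace_on Y B)) \<phi>"
    using morphism_continuous[OF \<phi>] into by (auto simp: continuous_map_in_subtopology)
  fix U f assume U: "openin (zar (subspace_on Y B)) U" and f: "f \<in> regular (subspace_on Y B) U"
  let ?U = "{x \<in> points X. \<phi> x \<in> U}"
  show "f \<circ> \<phi> \<in> regular X ?U"
  proof (rule regular_local)
    show "openin (zar X) ?U"
      using cont U by (rule openin_continuous_map_preimage)
    fix x assume "x \<in> ?U"
    then have x: "x \<in> points X" "\<phi> x \<in> U" by auto
    obtain W g where W: "openin (zar Y) W" "\<phi> x \<in> W" "g \<in> regular Y W" "\<forall>z \<in> W \<inter> U. f z = g z"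
      using f x(2) by (rule regular_subspace_onE)
    then show "\<exists>W g. openin (zar X) W \<and> x \<in> W \<and> g \<in> regular X W \<and> (\<forall>z\<in>W \<inter> ?U. (f \<circ> \<phi>) z = g z)"
      using \<phi> x by (intro exI[of _ "{x \<in> points X. \<phi> x \<in> W}"] exI[of _ "g \<circ> \<phi>"])
        (auto simp: openin_morphism_preimage, auto simp: morphism_def)
  qed
qed

end

section \<open>Products\<close>

lemma zar_product_space [simp]: "zar (product_space X Y) = product_zar X Y"
  by (simp add: product_space_def)

lemma openin_product_zar_basic:
  assumes "openin (zar X) U" "openin (zar Y) V" "F \<in> tensor_functions X Y U V"
  shows "openin (product_zar X Y) {z \<in> U \<times> V. F z \<noteq> 0}"
  unfolding product_zar_def using assms by (intro topology_generated_by_Basis) blast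

lemma regular_product_spaceE:
  assumes "f \<in> regular (product_space X Y) W" "p \<in> W"
  obtains N U V F H where
    "openin (product_zar X Y) N" "p \<in> N" "N \<subseteq> W" "openin (zar X) U" "openin (zar Y) V" "N \<subseteq> U \<times> V"
    "F \<in> tensor_functions X Y U V" "H \<in> tensor_functions X Y U V"
    "\<forall>z\<in>N. H z \<noteq> 0 \<and> f z = F z / H z"
proof -
  have "\<exists>N U V F H. openin (product_zar X Y) N \<and> p \<in> N \<and> N \<subseteq> W \<and>
         openin (zar X) U \<and> openin (zar Y) V \<and> N \<subseteq> U \<times> V \<and>
         F \<in> tensor_functions X Y U V \<and> H \<in> tensor_functions X Y U V \<and>
         (\<forall>z\<in>N. H z \<noteq> 0 \<and> f z = F z / H z)"
    using assms unfolding product_space_def by simp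
  then show thesis
    by (elim exE conjE) (rule that)
qed

lemma regular_product_spaceI:
  assumes "\<And>p. p \<in> W \<Longrightarrow> \<exists>N U V F H.
         openin (product_zar X Y) N \<and> p \<in> N \<and> N \<subseteq> W \<and>
         openin (zar X) U \<and> openin (zar Y) V \<and> N \<subseteq> U \<times> V \<and>
         F \<in> tensor_functions X Y U V \<and> H \<in> tensor_functions X Y U V \<and>
         (\<forall>z\<in>N. H z \<noteq> 0 \<and> f z = F z / H z)"
  shows "f \<in> regular (product_space X Y) W"
  using assms unfolding product_space_def by simp

lemma fraction_nearI:
  assumes "openin (product_zar X Y) N" "p \<in> N" "N \<subseteq> W" "openin (zar X) U" "openin (zar Y) V" "N \<subseteq> U \<times> V"
    and "F \<in> tensor_functions X Y U V" "H \<in> tensor_functions X Y U V"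
    and "\<And>z. z \<in> N \<Longrightarrow> H z \<noteq> 0 \<and> f z = F z / H z"
  shows "\<exists>N U V F H.
         openin (product_zar X Y) N \<and> p \<in> N \<and> N \<subseteq> W \<and>
         openin (zar X) U \<and> openin (zar Y) V \<and> N \<subseteq> U \<times> V \<and>
         F \<in> tensor_functions X Y U V \<and> H \<in> tensor_functions X Y U V \<and>
         (\<forall>z\<in>N. H z \<noteq> 0 \<and> f z = F z / H z)"
  by (rule exI[of _ N], rule exI[of _ U], rule exI[of _ V], rule exI[of _ F], rule exI[of _ H])
    (use assms in simp)

text \<open>
  The basic source of regular functions on a product: a fraction of tensor functions that is valid on
  a whole open set is regular there.
\<close>

lemma regular_fraction:
  assumes "openin (product_zar X Y) N" "openin (zar X) U" "openin (zar Y) V" "N \<subseteq> U \<times> V"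
    and "F \<in> tensor_functions X Y U V" "H \<in> tensor_functions X Y U V"
    and "\<And>z. z \<in> N \<Longrightarrow> H z \<noteq> 0 \<and> f z = F z / H z"
  shows "f \<in> regular (product_space X Y) N"
  by (rule regular_product_spaceI, rule fraction_nearI[OF assms(1) _ subset_refl assms(2-7)])

lemma tensor_functions_pure:
  assumes "a \<in> regular X U" "b \<in> regular Y V"
  shows "(\<lambda>(x, y). a x * b y) \<in> tensor_functions X Y U V"
  unfolding tensor_functions_def using assms
  by (intro CollectI exI[of _ "1::nat"] exI[of _ "\<lambda>_. a"] exI[of _ "\<lambda>_. b"]) auto

lemma tensor_functions_add:
  assumes "F \<in> tensor_functions X Y U V" "G \<in> tensor_functions X Y U V"
  shows "(\<lambda>z. F z + G z) \<in> tensor_functions X Y U V"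
proof -
  obtain n a b where F: "\<forall>i<n. a i \<in> regular X U \<and> b i \<in> regular Y V"
    "F = (\<lambda>(x, y). \<Sum>i<(n::nat). a i x * b i y)"
    using assms(1) unfolding tensor_functions_def by blast
  obtain m c d where G: "\<forall>i<m. c i \<in> regular X U \<and> d i \<in> regular Y V"
    "G = (\<lambda>(x, y). \<Sum>i<(m::nat). c i x * d i y)"
    using assms(2) unfolding tensor_functions_def by blast
  let ?a = "\<lambda>i. if i < n then a i else c (i - n)" and ?b = "\<lambda>i. if i < n then b i else d (i - n)"
  have "(\<Sum>i<n + m. ?a i x * ?b i y) = (\<Sum>i<n. a i x * b i y) + (\<Sum>i<m. c i x * d i y)" for x y
  proof -
    have "(\<Sum>i<n + m. ?a i x * ?b i y) = (\<Sum>i<n. ?a i x * ?b i y) + (\<Sum>i=n..<n + m. ?a i x * ?b i y)"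
      by (simp only: sum.atLeastLessThan_concat[OF le0 le_add1] lessThan_atLeast0)
    also have "(\<Sum>i=n..<n + m. ?a i x * ?b i y) = (\<Sum>i<m. c i x * d i y)"
      by (rule sum.reindex_bij_witness[of _ "\<lambda>i. i + n" "\<lambda>i. i - n"]) auto
    finally show ?thesis by simp
  qed
  then show ?thesis
    unfolding tensor_functions_def F(2) G(2) using F(1) G(1)
    by (intro CollectI exI[of _ "n + m"] exI[of _ ?a] exI[of _ ?b]) (auto simp: fun_eq_iff)
qed

context
  fixes X :: "'a fspace" and Y :: "'b fspace"
  assumes X: "space_with_functions X" and Y: "space_with_functions Y"
begin

interpretation X: space_with_functions X by (rule X)
interpretation Y: space_with_functions Y by (rule Y)

lemma tensor_functions_const:
  assumes "openin (zar X) U" "openin (zar Y) V"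
  shows "(\<lambda>_. c) \<in> tensor_functions X Y U V"
proof -
  have "(\<lambda>(x, y). c * 1) \<in> tensor_functions X Y U V"
    by (rule tensor_functions_pure) (use assms in \<open>auto intro: X.regular_const Y.regular_const\<close>)
  then show ?thesis by (simp add: case_prod_beta')
qed

text \<open>
  A product of two sums of pure tensors is a double sum of pure tensors, hence a tensor function by
  closure under addition.
\<close>

lemma tensor_functions_mult:
  assumes U: "openin (zar X) U" and V: "openin (zar Y) V"
    and F: "F \<in> tensor_functions X Y U V" and G: "G \<in> tensor_functions X Y U V"
  shows "(\<lambda>z. F z * G z) \<in> tensor_functions X Y U V"
proof -
  have sums: "(\<lambda>z. \<Sum>i\<in>I. H i z) \<in> tensor_functions X Y U V"
    if "\<And>i. i \<in> I \<Longrightarrow> H i \<in> tensor_functions X Y U V" for I :: "nat set" and H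
    using that by (induction I rule: infinite_finite_induct)
      (auto intro: tensor_functions_const[OF U V] tensor_functions_add)
  obtain n a b where F: "\<forall>i<n. a i \<in> regular X U \<and> b i \<in> regular Y V"
    "F = (\<lambda>(x, y). \<Sum>i<(n::nat). a i x * b i y)"
    using F unfolding tensor_functions_def by blast
  obtain m c d where G: "\<forall>i<m. c i \<in> regular X U \<and> d i \<in> regular Y V"
    "G = (\<lambda>(x, y). \<Sum>i<(m::nat). c i x * d i y)"
    using G unfolding tensor_functions_def by blast
  have eq: "(\<lambda>z. F z * G z) = (\<lambda>z. \<Sum>i<n. \<Sum>j<m. (\<lambda>(x, y). (a i x * c j x) * (b i y * d j y)) z)"
    unfolding F(2) G(2) by (auto simp: fun_eq_iff sum_product mult_ac)
  show ?thesis
    unfolding eq using F(1) G(1)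
    by (intro sums tensor_functions_pure X.regular_mult Y.regular_mult U V) auto
qed

lemma tensor_functions_restrict:
  assumes "openin (zar X) U" "openin (zar X) U'" "U' \<subseteq> U"
    and "openin (zar Y) V" "openin (zar Y) V'" "V' \<subseteq> V" "F \<in> tensor_functions X Y U V"
  shows "F \<in> tensor_functions X Y U' V'"
  using assms(7) X.regular_restrict[OF assms(1-3)] Y.regular_restrict[OF assms(4-6)]
  unfolding tensor_functions_def by blast

lemma openin_product_zar_Times:
  assumes "openin (zar X) U" "openin (zar Y) V"
  shows "openin (product_zar X Y) (U \<times> V)"
  using openin_product_zar_basic[OF assms tensor_functions_const[OF assms, of 1]] by simp

lemma topspace_product_zar [simp]: "topspace (product_zar X Y) = points X \<times> points Y"
proof
  show "topspace (product_zar X Y) \<subseteq> points X \<times> points Y"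
    unfolding product_zar_def by (auto dest: openin_subset)
  show "points X \<times> points Y \<subseteq> topspace (product_zar X Y)"
    by (intro openin_subset openin_product_zar_Times) auto
qed

text \<open>
  Locally a regular function is a fraction of tensor functions, so that the usual rules for fractions
  apply once two functions are written over a common pair \<open>U\<close>, \<open>V\<close> of open sets.
\<close>

lemma space_with_functions_product_space: "space_with_functions (product_space X Y)"
proof (unfold_locales, unfold zar_product_space)
  let ?T = "product_zar X Y" and ?R = "regular (product_space X Y)"
  have common: "\<exists>N U V F1 H1 F2 H2. openin ?T N \<and> p \<in> N \<and> N \<subseteq> W \<and>
         openin (zar X) U \<and> openin (zar Y) V \<and> N \<subseteq> U \<times> V \<and>
         F1 \<in> tensor_functions X Y U V \<and> H1 \<in> tensor_functions X Y U V \<and>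
         F2 \<in> tensor_functions X Y U V \<and> H2 \<in> tensor_functions X Y U V \<and>
         (\<forall>z\<in>N. H1 z \<noteq> 0 \<and> f1 z = F1 z / H1 z \<and> H2 z \<noteq> 0 \<and> f2 z = F2 z / H2 z)"
    if f: "f1 \<in> ?R W" "f2 \<in> ?R W" and p: "p \<in> W" for f1 f2 W p
  proof -
    obtain N1 U1 V1 F1 H1 where 1: "openin ?T N1" "p \<in> N1" "N1 \<subseteq> W" "openin (zar X) U1" "openin (zar Y) V1"
      "N1 \<subseteq> U1 \<times> V1" "F1 \<in> tensor_functions X Y U1 V1" "H1 \<in> tensor_functions X Y U1 V1"
      "\<forall>z\<in>N1. H1 z \<noteq> 0 \<and> f1 z = F1 z / H1 z"
      using f(1) p by (rule regular_product_spaceE)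
    obtain N2 U2 V2 F2 H2 where 2: "openin ?T N2" "p \<in> N2" "N2 \<subseteq> W" "openin (zar X) U2" "openin (zar Y) V2"
      "N2 \<subseteq> U2 \<times> V2" "F2 \<in> tensor_functions X Y U2 V2" "H2 \<in> tensor_functions X Y U2 V2"
      "\<forall>z\<in>N2. H2 z \<noteq> 0 \<and> f2 z = F2 z / H2 z"
      using f(2) p by (rule regular_product_spaceE)
    have res1: "G \<in> tensor_functions X Y (U1 \<inter> U2) (V1 \<inter> V2)" if "G \<in> tensor_functions X Y U1 V1" for G
      by (rule tensor_functions_restrict[OF 1(4) _ _ 1(5) _ _ that]) (use 1 2 in auto)
    have res2: "G \<in> tensor_functions X Y (U1 \<inter> U2) (V1 \<inter> V2)" if "G \<in> tensor_functions X Y U2 V2" for G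
      by (rule tensor_functions_restrict[OF 2(4) _ _ 2(5) _ _ that]) (use 1 2 in auto)
    have N: "openin ?T (N1 \<inter> N2)" "p \<in> N1 \<inter> N2" "N1 \<inter> N2 \<subseteq> W" "openin (zar X) (U1 \<inter> U2)"
      "openin (zar Y) (V1 \<inter> V2)" "N1 \<inter> N2 \<subseteq> (U1 \<inter> U2) \<times> (V1 \<inter> V2)"
      using 1(1-6) 2(1-6) by auto
    have "\<forall>z\<in>N1 \<inter> N2. H1 z \<noteq> 0 \<and> f1 z = F1 z / H1 z \<and> H2 z \<noteq> 0 \<and> f2 z = F2 z / H2 z"
      using 1(9) 2(9) by simp
    then show ?thesis
      using N res1[OF 1(7)] res1[OF 1(8)] res2[OF 2(7)] res2[OF 2(8)]
      by (intro exI[of _ "N1 \<inter> N2"] exI[of _ "U1 \<inter> U2"] exI[of _ "V1 \<inter> V2"]) (intro exI conjI)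
  qed
  fix W assume W: "openin ?T W"
  have W_sub: "W \<subseteq> points X \<times> points Y"
    using openin_subset[OF W] by simp
  show "(\<lambda>_. c) \<in> ?R W" for c
    using W_sub
    by (intro regular_fraction[where F = "\<lambda>_. c" and H = "\<lambda>_. 1", OF W openin_topspace openin_topspace]
        tensor_functions_const) auto
  show "(\<lambda>x. f x + g x) \<in> ?R W" if fg: "f \<in> ?R W" "g \<in> ?R W" for f g
  proof (rule regular_product_spaceI)
    fix p assume "p \<in> W"
    from common[OF fg this] obtain N U V F1 H1 F2 H2 where *: "openin ?T N" "p \<in> N" "N \<subseteq> W"
         "openin (zar X) U" "openin (zar Y) V" "N \<subseteq> U \<times> V"
         "F1 \<in> tensor_functions X Y U V" "H1 \<in> tensor_functions X Y U V"
         "F2 \<in> tensor_functions X Y U V" "H2 \<in> tensor_functions X Y U V"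
         "\<forall>z\<in>N. H1 z \<noteq> 0 \<and> f z = F1 z / H1 z \<and> H2 z \<noteq> 0 \<and> g z = F2 z / H2 z"
      by blast
    have "(\<lambda>z. F1 z * H2 z + F2 z * H1 z) \<in> tensor_functions X Y U V"
      "(\<lambda>z. H1 z * H2 z) \<in> tensor_functions X Y U V"
      using * by (auto intro!: tensor_functions_add tensor_functions_mult)
    moreover have "H1 z * H2 z \<noteq> 0 \<and> f z + g z = (F1 z * H2 z + F2 z * H1 z) / (H1 z * H2 z)"
      if "z \<in> N" for z
      using *(11) that by (auto simp: add_frac_eq)
    ultimately show "\<exists>N U V F H.
         openin ?T N \<and> p \<in> N \<and> N \<subseteq> W \<and>
         openin (zar X) U \<and> openin (zar Y) V \<and> N \<subseteq> U \<times> V \<and>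
         F \<in> tensor_functions X Y U V \<and> H \<in> tensor_functions X Y U V \<and>
         (\<forall>z\<in>N. H z \<noteq> 0 \<and> f z + g z = F z / H z)"
      by (rule fraction_nearI[OF *(1-6)])
  qed
  show "(\<lambda>x. f x * g x) \<in> ?R W" if fg: "f \<in> ?R W" "g \<in> ?R W" for f g
  proof (rule regular_product_spaceI)
    fix p assume "p \<in> W"
    from common[OF fg this] obtain N U V F1 H1 F2 H2 where *: "openin ?T N" "p \<in> N" "N \<subseteq> W"
         "openin (zar X) U" "openin (zar Y) V" "N \<subseteq> U \<times> V"
         "F1 \<in> tensor_functions X Y U V" "H1 \<in> tensor_functions X Y U V"
         "F2 \<in> tensor_functions X Y U V" "H2 \<in> tensor_functions X Y U V"
         "\<forall>z\<in>N. H1 z \<noteq> 0 \<and> f z = F1 z / H1 z \<and> H2 z \<noteq> 0 \<and> g z = F2 z / H2 z"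
      by blast
    have "(\<lambda>z. F1 z * F2 z) \<in> tensor_functions X Y U V"
      "(\<lambda>z. H1 z * H2 z) \<in> tensor_functions X Y U V"
      using * by (auto intro!: tensor_functions_add tensor_functions_mult)
    moreover have "H1 z * H2 z \<noteq> 0 \<and> f z * g z = (F1 z * F2 z) / (H1 z * H2 z)" if "z \<in> N" for z
      using *(11) that by auto
    ultimately show "\<exists>N U V F H.
         openin ?T N \<and> p \<in> N \<and> N \<subseteq> W \<and>
         openin (zar X) U \<and> openin (zar Y) V \<and> N \<subseteq> U \<times> V \<and>
         F \<in> tensor_functions X Y U V \<and> H \<in> tensor_functions X Y U V \<and>
         (\<forall>z\<in>N. H z \<noteq> 0 \<and> f z * g z = F z / H z)"
      by (rule fraction_nearI[OF *(1-6)])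
  qed
  show "(\<lambda>x. inverse (f x)) \<in> ?R W" if f: "f \<in> ?R W" and nz: "\<And>x. x \<in> W \<Longrightarrow> f x \<noteq> 0" for f
  proof (rule regular_product_spaceI)
    fix p assume "p \<in> W"
    with f obtain N U V F H where *: "openin ?T N" "p \<in> N" "N \<subseteq> W"
         "openin (zar X) U" "openin (zar Y) V" "N \<subseteq> U \<times> V"
         "F \<in> tensor_functions X Y U V" "H \<in> tensor_functions X Y U V"
         "\<forall>z\<in>N. H z \<noteq> 0 \<and> f z = F z / H z"
      by (rule regular_product_spaceE)
    have "F z \<noteq> 0 \<and> inverse (f z) = H z / F z" if "z \<in> N" for z
      using bspec[OF *(9) that] nz[of z] *(3) that by auto
    then show "\<exists>N U V F H.
         openin ?T N \<and> p \<in> N \<and> N \<subseteq> W \<and>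
         openin (zar X) U \<and> openin (zar Y) V \<and> N \<subseteq> U \<times> V \<and>
         F \<in> tensor_functions X Y U V \<and> H \<in> tensor_functions X Y U V \<and>
         (\<forall>z\<in>N. H z \<noteq> 0 \<and> inverse (f z) = F z / H z)"
      by (rule fraction_nearI[OF *(1-6) *(8) *(7)])
  qed
  show "f \<in> ?R W'" if W': "openin ?T W'" "W' \<subseteq> W" and f: "f \<in> ?R W" for f W'
  proof (rule regular_product_spaceI)
    fix p assume p: "p \<in> W'"
    with W' have "p \<in> W" by auto
    with f obtain N U V F H where *: "openin ?T N" "p \<in> N" "N \<subseteq> W"
         "openin (zar X) U" "openin (zar Y) V" "N \<subseteq> U \<times> V"
         "F \<in> tensor_functions X Y U V" "H \<in> tensor_functions X Y U V"
         "\<forall>z\<in>N. H z \<noteq> 0 \<and> f z = F z / H z"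
      by (rule regular_product_spaceE)
    have "openin ?T (N \<inter> W')" "p \<in> N \<inter> W'" "N \<inter> W' \<subseteq> W'" "N \<inter> W' \<subseteq> U \<times> V"
      using * W' p by auto
    then show "\<exists>N U V F H.
         openin ?T N \<and> p \<in> N \<and> N \<subseteq> W' \<and>
         openin (zar X) U \<and> openin (zar Y) V \<and> N \<subseteq> U \<times> V \<and>
         F \<in> tensor_functions X Y U V \<and> H \<in> tensor_functions X Y U V \<and>
         (\<forall>z\<in>N. H z \<noteq> 0 \<and> f z = F z / H z)"
      by (rule fraction_nearI[OF _ _ _ *(4,5) _ *(7,8)]) (use *(9) in auto)
  qed
  show "f \<in> ?R W"
    if loc: "\<And>x. x \<in> W \<Longrightarrow> \<exists>N g. openin ?T N \<and> x \<in> N \<and> N \<subseteq> W \<and> g \<in> ?R N \<and> (\<forall>z\<in>N. f z = g z)" for f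
  proof (rule regular_product_spaceI)
    fix p assume "p \<in> W"
    from loc[OF this] obtain N' g where N': "N' \<subseteq> W" "p \<in> N'" "g \<in> ?R N'" "\<forall>z\<in>N'. f z = g z"
      by blast
    from N'(3,2) obtain N U V F H where *: "openin ?T N" "p \<in> N" "N \<subseteq> N'"
         "openin (zar X) U" "openin (zar Y) V" "N \<subseteq> U \<times> V"
         "F \<in> tensor_functions X Y U V" "H \<in> tensor_functions X Y U V"
         "\<forall>z\<in>N. H z \<noteq> 0 \<and> g z = F z / H z"
      by (rule regular_product_spaceE)
    have "H z \<noteq> 0 \<and> f z = F z / H z" if "z \<in> N" for z
      using *(3) bspec[OF *(9) that] N'(4) that by auto
    then show "\<exists>N U V F H.
         openin ?T N \<and> p \<in> N \<and> N \<subseteq> W \<and>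
         openin (zar X) U \<and> openin (zar Y) V \<and> N \<subseteq> U \<times> V \<and>
         F \<in> tensor_functions X Y U V \<and> H \<in> tensor_functions X Y U V \<and>
         (\<forall>z\<in>N. H z \<noteq> 0 \<and> f z = F z / H z)"
      by (rule fraction_nearI[OF *(1,2) subset_trans[OF *(3) N'(1)] *(4-8)])
  qed
  show "openin ?T {x \<in> W. f x \<noteq> 0}" if f: "f \<in> ?R W" for f
  proof (subst openin_subopen, intro ballI)
    fix p assume p: "p \<in> {x \<in> W. f x \<noteq> 0}"
    then have "p \<in> W" by simp
    with f obtain N U V F H where *: "openin ?T N" "p \<in> N" "N \<subseteq> W"
         "openin (zar X) U" "openin (zar Y) V" "N \<subseteq> U \<times> V"
         "F \<in> tensor_functions X Y U V" "H \<in> tensor_functions X Y U V"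
         "\<forall>z\<in>N. H z \<noteq> 0 \<and> f z = F z / H z"
      by (rule regular_product_spaceE)
    let ?N = "N \<inter> {z \<in> U \<times> V. F z \<noteq> 0}"
    have "openin ?T ?N"
      using * by (intro openin_Int openin_product_zar_basic)
    moreover have "p \<in> ?N" "?N \<subseteq> {x \<in> W. f x \<noteq> 0}"
      using p *(2,3,6) *(9) by auto
    ultimately show "\<exists>V. openin ?T V \<and> p \<in> V \<and> V \<subseteq> {x \<in> W. f x \<noteq> 0}"
      by blast
  qed
qed

lemma regular_product_space_tensor:
  assumes "openin (zar X) U" "openin (zar Y) V" "F \<in> tensor_functions X Y U V"
  shows "F \<in> regular (product_space X Y) (U \<times> V)"
  by (rule regular_fraction[OF openin_product_zar_Times[OF assms(1,2)] assms(1,2) subset_refl assms(3)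
        tensor_functions_const[OF assms(1,2), of 1]]) simp

lemma morphism_fst: "morphism (product_space X Y) X fst"
  unfolding morphism_def zar_product_space
proof (intro conjI allI impI)
  have pre: "{x \<in> topspace (product_zar X Y). fst x \<in> U} = U \<times> points Y" if "openin (zar X) U" for U
    using openin_subset[OF that] by auto
  show "continuous_map (product_zar X Y) (zar X) fst"
    unfolding continuous_map_def pre[symmetric] topspace_product_zar
    using pre by (auto simp: openin_product_zar_Times)
  fix U f assume U: "openin (zar X) U" and f: "f \<in> regular X U"
  have "(\<lambda>_. 1) \<in> regular Y (points Y)"
    by (simp add: Y.regular_const)
  from regular_product_space_tensor[OF U openin_topspace tensor_functions_pure[OF f this]]
  show "f \<circ> fst \<in> regular (product_space X Y) {x \<in> topspace (product_zar X Y). fst x \<in> U}"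
    unfolding pre[OF U] by (simp add: comp_def case_prod_beta')
qed

lemma morphism_snd: "morphism (product_space X Y) Y snd"
  unfolding morphism_def zar_product_space
proof (intro conjI allI impI)
  have pre: "{x \<in> topspace (product_zar X Y). snd x \<in> V} = points X \<times> V" if "openin (zar Y) V" for V
    using openin_subset[OF that] by auto
  show "continuous_map (product_zar X Y) (zar Y) snd"
    unfolding continuous_map_def pre[symmetric] topspace_product_zar
    using pre by (auto simp: openin_product_zar_Times)
  fix V f assume V: "openin (zar Y) V" and f: "f \<in> regular Y V"
  have "(\<lambda>_. 1) \<in> regular X (points X)"
    by (simp add: X.regular_const)
  from regular_product_space_tensor[OF openin_topspace V tensor_functions_pure[OF this f]]
  show "f \<circ> snd \<in> regular (product_space X Y) {x \<in> topspace (product_zar X Y). snd x \<in> V}"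
    unfolding pre[OF V] by (simp add: comp_def case_prod_beta')
qed

text \<open>
  The universal property of the product. A tensor function pulls back to a sum of products of
  regular functions; hence the basic open sets, which are nonvanishing loci of tensor functions, have
  open preimages, and fractions of tensor functions pull back to fractions of regular functions.
\<close>

lemma morphism_Pair:
  assumes Z: "space_with_functions Z" and \<phi>: "morphism Z X \<phi>" and \<psi>: "morphism Z Y \<psi>"
  shows "morphism Z (product_space X Y) (\<lambda>z. (\<phi> z, \<psi> z))"
proof -
  interpret Z: space_with_functions Z by (rule Z)
  let ?h = "\<lambda>z. (\<phi> z, \<psi> z)"
  have pre_eq: "{z \<in> points Z. ?h z \<in> U \<times> V} = {z \<in> points Z. \<phi> z \<in> U} \<inter> {z \<in> points Z. \<psi> z \<in> V}" for U V
    by auto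
  have open_pre: "openin (zar Z) {z \<in> points Z. ?h z \<in> U \<times> V}"
    if "openin (zar X) U" "openin (zar Y) V" for U V
    unfolding pre_eq
    by (rule openin_Int[OF openin_morphism_preimage[OF \<phi> that(1)] openin_morphism_preimage[OF \<psi> that(2)]])
  have tensor: "F \<circ> ?h \<in> regular Z {z \<in> points Z. ?h z \<in> U \<times> V}"
    if U: "openin (zar X) U" and V: "openin (zar Y) V" and F: "F \<in> tensor_functions X Y U V" for U V F
  proof -
    obtain n a b where F: "\<forall>i<n. a i \<in> regular X U \<and> b i \<in> regular Y V"
      "F = (\<lambda>(x, y). \<Sum>i<(n::nat). a i x * b i y)"
      using F unfolding tensor_functions_def by blast
    have a: "a i \<circ> \<phi> \<in> regular Z {z \<in> points Z. ?h z \<in> U \<times> V}" if "i < n" for i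
      by (rule Z.regular_restrict[OF openin_morphism_preimage[OF \<phi> U] open_pre[OF U V]])
        (use F(1) U \<phi> that in \<open>auto simp: morphism_def\<close>)
    have b: "b i \<circ> \<psi> \<in> regular Z {z \<in> points Z. ?h z \<in> U \<times> V}" if "i < n" for i
      by (rule Z.regular_restrict[OF openin_morphism_preimage[OF \<psi> V] open_pre[OF U V]])
        (use F(1) V \<psi> that in \<open>auto simp: morphism_def\<close>)
    have "(\<lambda>z. \<Sum>i<n. (a i \<circ> \<phi>) z * (b i \<circ> \<psi>) z) \<in> regular Z {z \<in> points Z. ?h z \<in> U \<times> V}"
      by (rule Z.regular_sum[OF open_pre[OF U V]], rule Z.regular_mult[OF open_pre[OF U V]]) (use a b in \<open>simp_all add: comp_def\<close>)
    then show ?thesis by (simp add: F(2) comp_def)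
  qed
  have cont: "continuous_map (zar Z) (product_zar X Y) ?h"
    unfolding product_zar_def
  proof (rule continuous_on_generated_topo)
    fix B assume "B \<in> {{z \<in> U \<times> V. F z \<noteq> 0} | U V F.
        openin (zar X) U \<and> openin (zar Y) V \<and> F \<in> tensor_functions X Y U V}"
    then obtain U V F where B: "B = {z \<in> U \<times> V. F z \<noteq> 0}" and UV: "openin (zar X) U" "openin (zar Y) V"
      "F \<in> tensor_functions X Y U V" by blast
    have "?h -` B \<inter> points Z = {z \<in> {z \<in> points Z. ?h z \<in> U \<times> V}. (F \<circ> ?h) z \<noteq> 0}"
      by (auto simp: B)
    then show "openin (zar Z) (?h -` B \<inter> points Z)"
      using Z.openin_nonvanishing[OF open_pre tensor, OF UV(1,2) UV] by simp
  next
    have "?h ` points Z \<subseteq> topspace (product_zar X Y)"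
      using morphism_points[OF \<phi>] morphism_points[OF \<psi>] by auto
    then show "?h ` points Z \<subseteq> \<Union> {{z \<in> U \<times> V. F z \<noteq> 0} | U V F.
        openin (zar X) U \<and> openin (zar Y) V \<and> F \<in> tensor_functions X Y U V}"
      by (simp only: product_zar_def topology_generated_by_topspace)
  qed
  show ?thesis
    unfolding morphism_def
  proof (intro conjI allI impI)
    show "continuous_map (zar Z) (zar (product_space X Y)) ?h"
      using cont by simp
    fix W f assume W: "openin (zar (product_space X Y)) W" and f: "f \<in> regular (product_space X Y) W"
    let ?W = "{z \<in> points Z. ?h z \<in> W}"
    show "f \<circ> ?h \<in> regular Z ?W"
    proof (rule Z.regular_local)
      show "openin (zar Z) ?W"
        using cont W by (intro openin_continuous_map_preimage) auto
      fix z assume "z \<in> ?W"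
      then have z: "z \<in> points Z" "?h z \<in> W" by auto
      obtain N U V F H where *: "openin (product_zar X Y) N" "?h z \<in> N" "N \<subseteq> W"
         "openin (zar X) U" "openin (zar Y) V" "N \<subseteq> U \<times> V"
         "F \<in> tensor_functions X Y U V" "H \<in> tensor_functions X Y U V"
         "\<forall>z\<in>N. H z \<noteq> 0 \<and> f z = F z / H z"
        using f z(2) by (rule regular_product_spaceE)
      let ?N = "{z \<in> points Z. ?h z \<in> N}"
      have N: "openin (zar Z) ?N"
        using cont *(1) by (rule openin_continuous_map_preimage)
      have sub: "?N \<subseteq> {z \<in> points Z. ?h z \<in> U \<times> V}"
        using *(6) by auto
      have "F \<circ> ?h \<in> regular Z ?N" "H \<circ> ?h \<in> regular Z ?N"
        using tensor[OF *(4,5,7)] tensor[OF *(4,5,8)] Z.regular_restrict[OF open_pre[OF *(4,5)] N sub]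
        by auto
      then have "(\<lambda>z. (F \<circ> ?h) z / (H \<circ> ?h) z) \<in> regular Z ?N"
        using *(9) by (intro Z.regular_divide[OF N]) (simp_all add: comp_def)
      then show "\<exists>N g. openin (zar Z) N \<and> z \<in> N \<and> g \<in> regular Z N \<and> (\<forall>y\<in>N \<inter> ?W. (f \<circ> ?h) y = g y)"
        using N z *(2,9) by (intro exI[of _ ?N] exI[of _ "\<lambda>z. (F \<circ> ?h) z / (H \<circ> ?h) z"]) auto
    qed
  qed
qed

end

section \<open>Projective space\<close>

lemma abs_rep_proj [simp]: "abs_proj (rep_proj x) = x"
  by (rule Quotient3_abs_rep[OF Quotient3_proj])

lemma rep_proj_nonzero [simp]: "rep_proj x \<noteq> 0"
  using Quotient3_rep_reflp[OF Quotient3_proj, of x] by (simp add: proportional_def)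

lemma abs_proj_scale:
  assumes "c \<noteq> 0" "v \<noteq> 0"
  shows "abs_proj (c *s v) = abs_proj v"
proof -
  have "proportional v (c *s v)"
    using assms by (auto simp: proportional_def)
  then show ?thesis
    by (metis Quotient3_rel[OF Quotient3_proj])
qed

lemma rep_abs_proj:
  assumes "v \<noteq> 0"
  obtains c where "c \<noteq> 0" "rep_proj (abs_proj v) = c *s v"
proof -
  have "proportional v v"
    using assms by (auto simp: proportional_def intro!: exI[of _ 1])
  then have "proportional v (rep_proj (abs_proj v))"
    by (rule rep_abs_rsp[OF Quotient3_proj])
  then show thesis
    using that by (auto simp: proportional_def)
qed

abbreviation monomial_value :: "('n \<Rightarrow> nat) \<Rightarrow> complex^'n \<Rightarrow> complex" where
  "monomial_value \<alpha> v \<equiv> \<Prod>i\<in>UNIV. (v $ i) ^ \<alpha> i"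

lemma homogeneousE:
  assumes "f \<in> homogeneous d"
  obtains c where "f = (\<lambda>v. \<Sum>\<alpha> | (\<Sum>i\<in>UNIV. \<alpha> i) = d. c \<alpha> * monomial_value \<alpha> v)"
  using assms unfolding homogeneous_def by blast

lemma homogeneousI:
  assumes "\<And>v. f v = (\<Sum>\<alpha> | (\<Sum>i\<in>UNIV. \<alpha> i) = d. c \<alpha> * monomial_value \<alpha> v)"
  shows "f \<in> homogeneous d"
  unfolding homogeneous_def using assms by (intro CollectI exI[of _ c]) (simp add: fun_eq_iff)

lemma finite_exponents: "finite {\<alpha> :: 'n::finite \<Rightarrow> nat. (\<Sum>i\<in>UNIV. \<alpha> i) = d}"
proof (rule finite_subset)
  show "{\<alpha> :: 'n \<Rightarrow> nat. (\<Sum>i\<in>UNIV. \<alpha> i) = d} \<subseteq> PiE UNIV (\<lambda>_. {..d})"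
    by (auto intro: member_le_sum)
  show "finite (PiE UNIV (\<lambda>_ :: 'n. {..d}))"
    by (intro finite_PiE) auto
qed

lemma homogeneous_scale:
  assumes "f \<in> homogeneous d"
  shows "f (c *s v) = c ^ d * f v"
proof -
  have "monomial_value \<alpha> (c *s v) = c ^ (\<Sum>i\<in>UNIV. \<alpha> i) * monomial_value \<alpha> v" for \<alpha>
    by (simp add: power_mult_distrib prod.distrib power_sum)
  then show ?thesis
    using assms by (elim homogeneousE) (simp add: sum_distrib_left mult_ac)
qed

lemma homogeneous_add:
  assumes "f \<in> homogeneous d" "g \<in> homogeneous d"
  shows "(\<lambda>v. f v + g v) \<in> homogeneous d"
proof -
  obtain a b where "f = (\<lambda>v. \<Sum>\<alpha> | (\<Sum>i\<in>UNIV. \<alpha> i) = d. a \<alpha> * monomial_value \<alpha> v)"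
    "g = (\<lambda>v. \<Sum>\<alpha> | (\<Sum>i\<in>UNIV. \<alpha> i) = d. b \<alpha> * monomial_value \<alpha> v)"
    using assms by (elim homogeneousE)
  then show ?thesis
    by (intro homogeneousI[where c = "\<lambda>\<alpha>. a \<alpha> + b \<alpha>"]) (simp add: ring_distribs sum.distrib)
qed

text \<open>
  The coefficients of a product are the convolution of the coefficients of the factors.
\<close>

lemma homogeneous_mult:
  fixes f g :: "complex^'n \<Rightarrow> complex"
  assumes "f \<in> homogeneous d" "g \<in> homogeneous e"
  shows "(\<lambda>v. f v * g v) \<in> homogeneous (d + e)"
proof -
  let ?A = "\<lambda>d. {\<alpha> :: 'n \<Rightarrow> nat. (\<Sum>i\<in>UNIV. \<alpha> i) = d}"
  obtain a b where f: "f = (\<lambda>v. \<Sum>\<alpha>\<in>?A d. a \<alpha> * monomial_value \<alpha> v)"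
    and g: "g = (\<lambda>v. \<Sum>\<alpha>\<in>?A e. b \<alpha> * monomial_value \<alpha> v)"
    using assms by (elim homogeneousE)
  let ?add = "\<lambda>(\<alpha>, \<beta>). (\<lambda>i. \<alpha> i + \<beta> i :: nat)"
  let ?c = "\<lambda>\<gamma>. \<Sum>p | p \<in> ?A d \<times> ?A e \<and> ?add p = \<gamma>. a (fst p) * b (snd p)"
  show ?thesis
  proof (rule homogeneousI[where c = ?c])
    fix v
    have "f v * g v = (\<Sum>p\<in>?A d \<times> ?A e. a (fst p) * b (snd p) * monomial_value (?add p) v)"
      unfolding f g sum_product sum.cartesian_product
      by (intro sum.cong) (auto simp: power_add prod.distrib mult_ac)
    also have "\<dots> = (\<Sum>\<gamma>\<in>?A (d + e). \<Sum>p | p \<in> ?A d \<times> ?A e \<and> ?add p = \<gamma>.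
        a (fst p) * b (snd p) * monomial_value (?add p) v)"
      by (rule sum.group[symmetric]) (auto simp: finite_exponents sum.distrib)
    also have "\<dots> = (\<Sum>\<gamma>\<in>?A (d + e). ?c \<gamma> * monomial_value \<gamma> v)"
      by (intro sum.cong refl) (auto simp: sum_distrib_right intro!: sum.cong)
    finally show "f v * g v = (\<Sum>\<gamma>\<in>?A (d + e). ?c \<gamma> * monomial_value \<gamma> v)" .
  qed
qed

lemma homogeneous_const: "(\<lambda>_. c) \<in> homogeneous 0"
proof (rule homogeneousI[where c = "\<lambda>_. c"])
  have "{\<alpha> :: 'a \<Rightarrow> nat. (\<Sum>i\<in>UNIV. \<alpha> i) = 0} = {\<lambda>_. 0}"
    by auto
  then show "c = (\<Sum>\<alpha> | (\<Sum>i\<in>UNIV. \<alpha> i) = 0. c * monomial_value \<alpha> v)" for v :: "complex^'a"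
    by simp
qed

lemma homogeneous_coordinate: "(\<lambda>v. v $ j) \<in> homogeneous 1"
proof (rule homogeneousI)
  fix v :: "complex^'a"
  let ?e = "\<lambda>i. if i = j then 1 else 0 :: nat"
  have "monomial_value ?e v = v $ j"
  proof -
    have "monomial_value ?e v = (\<Prod>i\<in>UNIV. if i = j then v $ i else 1)"
      by (intro prod.cong) auto
    then show ?thesis by simp
  qed
  moreover have "?e \<in> {\<alpha>. (\<Sum>i\<in>UNIV. \<alpha> i) = 1}"
    by simp
  ultimately show "v $ j = (\<Sum>\<alpha> | (\<Sum>i\<in>UNIV. \<alpha> i) = 1. (if \<alpha> = ?e then 1 else 0) * monomial_value \<alpha> v)"
    using finite_exponents[where 'n = 'a]
    by (simp add: if_distrib[of "\<lambda>x. x * _"] cong: if_cong)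
qed

text \<open>
  A homogeneous form is built from constants and coordinates by sums and products. This is used twice:
  for the class of regular functions, and for the class of polynomials in one parameter.
\<close>

lemma homogeneous_closure:
  fixes f :: "complex^'n \<Rightarrow> complex" and R :: "('z \<Rightarrow> complex) \<Rightarrow> bool"
  assumes f: "f \<in> homogeneous d"
    and const: "\<And>c. R (\<lambda>_. c)"
    and add: "\<And>g h. R g \<Longrightarrow> R h \<Longrightarrow> R (\<lambda>z. g z + h z)"
    and mult: "\<And>g h. R g \<Longrightarrow> R h \<Longrightarrow> R (\<lambda>z. g z * h z)"
    and coord: "\<And>i. R (\<lambda>z. v z $ i)"
  shows "R (\<lambda>z. f (v z))"
proof -
  have sums: "R (\<lambda>z. \<Sum>i\<in>I. g i z)" if "\<And>i. R (g i)" for I :: "('n \<Rightarrow> nat) set" and g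
    by (induction I rule: infinite_finite_induct) (simp_all add: const add that)
  have prods: "R (\<lambda>z. \<Prod>i\<in>I. g i z)" if "\<And>i. R (g i)" for I :: "'n set" and g
    by (induction I rule: infinite_finite_induct) (simp_all add: const mult that)
  have powers: "R (\<lambda>z. g z ^ n)" if "R g" for g n
    by (induction n) (simp_all add: const mult that)
  obtain c where f_eq: "f = (\<lambda>v. \<Sum>\<alpha> | (\<Sum>i\<in>UNIV. \<alpha> i) = d. c \<alpha> * monomial_value \<alpha> v)"
    using f by (rule homogeneousE)
  show ?thesis
    unfolding f_eq by (rule sums, rule mult[OF const], rule prods, rule powers, rule coord)
qed

lemma zar_projective_space [simp]: "zar projective_space = proj_zar"
  by (simp add: projective_space_def)

lemma openin_proj_nonvanishing: "f \<in> homogeneous d \<Longrightarrow> openin proj_zar {x. f (rep_proj x) \<noteq> 0}"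
  unfolding proj_zar_def by (intro topology_generated_by_Basis) blast

lemma topspace_proj_zar [simp]: "topspace proj_zar = UNIV"
  using openin_subset[OF openin_proj_nonvanishing[OF homogeneous_const, of 1]] by auto

lemma proj_fraction_nearI:
  assumes "openin proj_zar W" "x \<in> W" "W \<subseteq> U" "g \<in> homogeneous d" "h \<in> homogeneous d"
    and "\<And>z. z \<in> W \<Longrightarrow> h (rep_proj z) \<noteq> 0 \<and> f z = g (rep_proj z) / h (rep_proj z)"
  shows "\<exists>W d. \<exists>g \<in> homogeneous d. \<exists>h \<in> homogeneous d. openin proj_zar W \<and> x \<in> W \<and> W \<subseteq> U \<and>
         (\<forall>z\<in>W. h (rep_proj z) \<noteq> 0 \<and> f z = g (rep_proj z) / h (rep_proj z))"
  by (rule exI[of _ W], rule exI[of _ d], rule bexI[of _ g], rule bexI[of _ h]) (use assms in simp_all)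

lemma regular_projectiveI:
  assumes "\<And>x. x \<in> U \<Longrightarrow> \<exists>W d. \<exists>g \<in> homogeneous d. \<exists>h \<in> homogeneous d. openin proj_zar W \<and> x \<in> W \<and> W \<subseteq> U \<and>
         (\<forall>z\<in>W. h (rep_proj z) \<noteq> 0 \<and> f z = g (rep_proj z) / h (rep_proj z))"
  shows "f \<in> regular projective_space U"
  using assms unfolding projective_space_def by simp

lemma regular_projectiveE:
  assumes "f \<in> regular projective_space U" "x \<in> U"
  obtains W d g h where "openin proj_zar W" "x \<in> W" "W \<subseteq> U" "g \<in> homogeneous d" "h \<in> homogeneous d"
    "\<forall>z\<in>W. h (rep_proj z) \<noteq> 0 \<and> f z = g (rep_proj z) / h (rep_proj z)"
proof -
  have "\<exists>W d. \<exists>g \<in> homogeneous d. \<exists>h \<in> homogeneous d. openin proj_zar W \<and> x \<in> W \<and> W \<subseteq> U \<and>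
         (\<forall>z\<in>W. h (rep_proj z) \<noteq> 0 \<and> f z = g (rep_proj z) / h (rep_proj z))"
    using assms unfolding projective_space_def by simp
  then show thesis
    by (elim exE bexE conjE) (rule that)
qed

lemma regular_projective_fraction:
  assumes "openin proj_zar U" "g \<in> homogeneous d" "h \<in> homogeneous d"
    and "\<And>z. z \<in> U \<Longrightarrow> h (rep_proj z) \<noteq> 0"
  shows "(\<lambda>z. g (rep_proj z) / h (rep_proj z)) \<in> regular projective_space U"
  by (rule regular_projectiveI, rule proj_fraction_nearI[OF assms(1) _ subset_refl assms(2,3)])
    (use assms(4) in auto)

text \<open>
  A sum of fractions \<open>g\<^sub>1 / h\<^sub>1 + g\<^sub>2 / h\<^sub>2\<close> of forms
  of equal degrees has numerator and denominator homogeneous of the sum of the two degrees.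
\<close>

lemma space_with_functions_projective_space:
  "space_with_functions (projective_space :: 'n::finite proj fspace)"
proof (unfold_locales, unfold zar_projective_space)
  let ?R = "regular (projective_space :: 'n proj fspace)"
  fix U :: "'n proj set" assume U: "openin proj_zar U"
  show "(\<lambda>_. c) \<in> ?R U" for c
    using regular_projective_fraction[OF U homogeneous_const[of c] homogeneous_const[of 1]] by simp
  show "(\<lambda>x. f x + g x) \<in> ?R U" if fg: "f \<in> ?R U" "g \<in> ?R U" for f g
  proof (rule regular_projectiveI)
    fix x assume x: "x \<in> U"
    obtain W1 d1 g1 h1 where 1: "openin proj_zar W1" "x \<in> W1" "W1 \<subseteq> U" "g1 \<in> homogeneous d1"
      "h1 \<in> homogeneous d1" "\<forall>z\<in>W1. h1 (rep_proj z) \<noteq> 0 \<and> f z = g1 (rep_proj z) / h1 (rep_proj z)"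
      using fg(1) x by (rule regular_projectiveE)
    obtain W2 d2 g2 h2 where 2: "openin proj_zar W2" "x \<in> W2" "W2 \<subseteq> U" "g2 \<in> homogeneous d2"
      "h2 \<in> homogeneous d2" "\<forall>z\<in>W2. h2 (rep_proj z) \<noteq> 0 \<and> g z = g2 (rep_proj z) / h2 (rep_proj z)"
      using fg(2) x by (rule regular_projectiveE)
    have W: "openin proj_zar (W1 \<inter> W2)" "x \<in> W1 \<inter> W2" "W1 \<inter> W2 \<subseteq> U"
      using 1(1-3) 2(1-3) by auto
    have num: "(\<lambda>v. g1 v * h2 v + h1 v * g2 v) \<in> homogeneous (d1 + d2)"
      by (intro homogeneous_add homogeneous_mult 1 2)
    show "\<exists>W d. \<exists>a \<in> homogeneous d. \<exists>b \<in> homogeneous d. openin proj_zar W \<and> x \<in> W \<and> W \<subseteq> U \<and>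
         (\<forall>z\<in>W. b (rep_proj z) \<noteq> 0 \<and> f z + g z = a (rep_proj z) / b (rep_proj z))"
      by (rule proj_fraction_nearI[OF W num homogeneous_mult[OF 1(5) 2(5)]])
        (use 1(6) 2(6) in \<open>auto simp: add_frac_eq mult_ac\<close>)
  qed
  show "(\<lambda>x. f x * g x) \<in> ?R U" if fg: "f \<in> ?R U" "g \<in> ?R U" for f g
  proof (rule regular_projectiveI)
    fix x assume x: "x \<in> U"
    obtain W1 d1 g1 h1 where 1: "openin proj_zar W1" "x \<in> W1" "W1 \<subseteq> U" "g1 \<in> homogeneous d1"
      "h1 \<in> homogeneous d1" "\<forall>z\<in>W1. h1 (rep_proj z) \<noteq> 0 \<and> f z = g1 (rep_proj z) / h1 (rep_proj z)"
      using fg(1) x by (rule regular_projectiveE)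
    obtain W2 d2 g2 h2 where 2: "openin proj_zar W2" "x \<in> W2" "W2 \<subseteq> U" "g2 \<in> homogeneous d2"
      "h2 \<in> homogeneous d2" "\<forall>z\<in>W2. h2 (rep_proj z) \<noteq> 0 \<and> g z = g2 (rep_proj z) / h2 (rep_proj z)"
      using fg(2) x by (rule regular_projectiveE)
    have W: "openin proj_zar (W1 \<inter> W2)" "x \<in> W1 \<inter> W2" "W1 \<inter> W2 \<subseteq> U"
      using 1(1-3) 2(1-3) by auto
    show "\<exists>W d. \<exists>a \<in> homogeneous d. \<exists>b \<in> homogeneous d. openin proj_zar W \<and> x \<in> W \<and> W \<subseteq> U \<and>
         (\<forall>z\<in>W. b (rep_proj z) \<noteq> 0 \<and> f z * g z = a (rep_proj z) / b (rep_proj z))"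
      by (rule proj_fraction_nearI[OF W homogeneous_mult[OF 1(4) 2(4)] homogeneous_mult[OF 1(5) 2(5)]])
        (use 1(6) 2(6) in auto)
  qed
  show "(\<lambda>x. inverse (f x)) \<in> ?R U" if f: "f \<in> ?R U" and nz: "\<And>x. x \<in> U \<Longrightarrow> f x \<noteq> 0" for f
  proof (rule regular_projectiveI)
    fix x assume x: "x \<in> U"
    obtain W d g h where *: "openin proj_zar W" "x \<in> W" "W \<subseteq> U" "g \<in> homogeneous d"
      "h \<in> homogeneous d" "\<forall>z\<in>W. h (rep_proj z) \<noteq> 0 \<and> f z = g (rep_proj z) / h (rep_proj z)"
      using f x by (rule regular_projectiveE)
    have "g (rep_proj z) \<noteq> 0 \<and> inverse (f z) = h (rep_proj z) / g (rep_proj z)" if "z \<in> W" for z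
      using bspec[OF *(6) that] nz[of z] *(3) that by auto
    then show "\<exists>W d. \<exists>a \<in> homogeneous d. \<exists>b \<in> homogeneous d. openin proj_zar W \<and> x \<in> W \<and> W \<subseteq> U \<and>
         (\<forall>z\<in>W. b (rep_proj z) \<noteq> 0 \<and> inverse (f z) = a (rep_proj z) / b (rep_proj z))"
      by (rule proj_fraction_nearI[OF *(1-3) *(5,4)])
  qed
  show "f \<in> ?R W'" if W': "openin proj_zar W'" "W' \<subseteq> U" and f: "f \<in> ?R U" for f W'
  proof (rule regular_projectiveI)
    fix x assume x: "x \<in> W'"
    with W' have "x \<in> U" by auto
    with f obtain W d g h where *: "openin proj_zar W" "x \<in> W" "W \<subseteq> U" "g \<in> homogeneous d"
      "h \<in> homogeneous d" "\<forall>z\<in>W. h (rep_proj z) \<noteq> 0 \<and> f z = g (rep_proj z) / h (rep_proj z)"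
      by (rule regular_projectiveE)
    have W: "openin proj_zar (W \<inter> W')" "x \<in> W \<inter> W'" "W \<inter> W' \<subseteq> W'"
      using * W' x by auto
    show "\<exists>W d. \<exists>a \<in> homogeneous d. \<exists>b \<in> homogeneous d. openin proj_zar W \<and> x \<in> W \<and> W \<subseteq> W' \<and>
         (\<forall>z\<in>W. b (rep_proj z) \<noteq> 0 \<and> f z = a (rep_proj z) / b (rep_proj z))"
      by (rule proj_fraction_nearI[OF W *(4,5)]) (use *(6) in auto)
  qed
  show "f \<in> ?R U"
    if loc: "\<And>x. x \<in> U \<Longrightarrow> \<exists>W g. openin proj_zar W \<and> x \<in> W \<and> W \<subseteq> U \<and> g \<in> ?R W \<and> (\<forall>z\<in>W. f z = g z)" for f
  proof (rule regular_projectiveI)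
    fix x assume "x \<in> U"
    from loc[OF this] obtain V k where V: "V \<subseteq> U" "x \<in> V" "k \<in> ?R V" "\<forall>z\<in>V. f z = k z"
      by blast
    from V(3,2) obtain W d g h where *: "openin proj_zar W" "x \<in> W" "W \<subseteq> V" "g \<in> homogeneous d"
      "h \<in> homogeneous d" "\<forall>z\<in>W. h (rep_proj z) \<noteq> 0 \<and> k z = g (rep_proj z) / h (rep_proj z)"
      by (rule regular_projectiveE)
    show "\<exists>W d. \<exists>a \<in> homogeneous d. \<exists>b \<in> homogeneous d. openin proj_zar W \<and> x \<in> W \<and> W \<subseteq> U \<and>
         (\<forall>z\<in>W. b (rep_proj z) \<noteq> 0 \<and> f z = a (rep_proj z) / b (rep_proj z))"
      by (rule proj_fraction_nearI[OF *(1,2) subset_trans[OF *(3) V(1)] *(4,5)]) (use *(3,6) V(4) in auto)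
  qed
  show "openin proj_zar {x \<in> U. f x \<noteq> 0}" if f: "f \<in> ?R U" for f
  proof (subst openin_subopen, intro ballI)
    fix x assume x: "x \<in> {x \<in> U. f x \<noteq> 0}"
    then have "x \<in> U" by simp
    with f obtain W d g h where *: "openin proj_zar W" "x \<in> W" "W \<subseteq> U" "g \<in> homogeneous d"
      "h \<in> homogeneous d" "\<forall>z\<in>W. h (rep_proj z) \<noteq> 0 \<and> f z = g (rep_proj z) / h (rep_proj z)"
      by (rule regular_projectiveE)
    let ?W = "W \<inter> {x. g (rep_proj x) \<noteq> 0}"
    have "openin proj_zar ?W"
      using * by (intro openin_Int openin_proj_nonvanishing)
    moreover have "x \<in> ?W" "?W \<subseteq> {x \<in> U. f x \<noteq> 0}"
      using x *(2,3,6) by auto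
    ultimately show "\<exists>V. openin proj_zar V \<and> x \<in> V \<and> V \<subseteq> {x \<in> U. f x \<noteq> 0}"
      by blast
  qed
qed

section \<open>Morphisms in homogeneous coordinates\<close>

context space_with_functions
begin

lemma regular_homogeneous:
  assumes U: "openin (zar X) U" and F: "\<And>i. F i \<in> regular X U" and g: "g \<in> homogeneous d"
  shows "(\<lambda>z. g (\<chi> i. F i z)) \<in> regular X U"
  by (rule homogeneous_closure[where R = "\<lambda>f. f \<in> regular X U", OF g])
    (simp_all add: regular_const[OF U] regular_add[OF U] regular_mult[OF U] F)

text \<open>
  A map into projective space is a morphism as soon as it is given locally by a vector of regular
  functions without common zero: a fraction of two forms of the same degree does not see the choice of
  the representative, so that it can be evaluated on that vector.
\<close>

lemma morphism_to_projective_spaceI: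
  fixes \<psi> :: "'a \<Rightarrow> 'n::finite proj"
  assumes lift: "\<And>x. x \<in> points X \<Longrightarrow> \<exists>U F. openin (zar X) U \<and> x \<in> U \<and> (\<forall>i. F i \<in> regular X U) \<and>
      (\<forall>z\<in>U. (\<chi> i. F i z) \<noteq> 0 \<and> \<psi> z = abs_proj (\<chi> i. F i z))"
  shows "morphism X projective_space \<psi>"
proof -
  have open_pre: "openin (zar X) {x \<in> points X. f (rep_proj (\<psi> x)) \<noteq> 0}" if f: "f \<in> homogeneous d" for f d
  proof (subst openin_subopen, intro ballI)
    fix x assume x: "x \<in> {x \<in> points X. f (rep_proj (\<psi> x)) \<noteq> 0}"
    then have "x \<in> points X" by simp
    from lift[OF this] obtain U F where U: "openin (zar X) U" "x \<in> U" "\<forall>i. F i \<in> regular X U"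
      "\<forall>z\<in>U. (\<chi> i. F i z) \<noteq> 0 \<and> \<psi> z = abs_proj (\<chi> i. F i z)" by blast
    have iff: "f (rep_proj (\<psi> z)) \<noteq> 0 \<longleftrightarrow> f (\<chi> i. F i z) \<noteq> 0" if zU: "z \<in> U" for z
    proof -
      obtain c where "c \<noteq> 0" "rep_proj (\<psi> z) = c *s (\<chi> i. F i z)"
        using bspec[OF U(4) zU] rep_abs_proj[of "\<chi> i. F i z"] by metis
      then show ?thesis by (simp add: homogeneous_scale[OF f])
    qed
    have "openin (zar X) {z \<in> U. f (\<chi> i. F i z) \<noteq> 0}"
      using U by (intro openin_nonvanishing[OF U(1)] regular_homogeneous[OF U(1) _ f]) auto
    moreover have "x \<in> {z \<in> U. f (\<chi> i. F i z) \<noteq> 0}"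
      using x U(2) iff by simp
    moreover have "{z \<in> U. f (\<chi> i. F i z) \<noteq> 0} \<subseteq> {x \<in> points X. f (rep_proj (\<psi> x)) \<noteq> 0}"
      using iff openin_subset[OF U(1)] by auto
    ultimately show "\<exists>V. openin (zar X) V \<and> x \<in> V \<and> V \<subseteq> {x \<in> points X. f (rep_proj (\<psi> x)) \<noteq> 0}"
      by blast
  qed
  have cont: "continuous_map (zar X) proj_zar \<psi>"
    unfolding proj_zar_def
  proof (rule continuous_on_generated_topo)
    fix B :: "'n proj set" assume "B \<in> {{x. f (rep_proj x) \<noteq> 0} | f d. f \<in> homogeneous d}"
    then obtain f d where B: "B = {x. f (rep_proj x) \<noteq> 0}" and f: "f \<in> homogeneous d" by blast
    have "\<psi> -` B \<inter> points X = {x \<in> points X. f (rep_proj (\<psi> x)) \<noteq> 0}"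
      unfolding B by blast
    then show "openin (zar X) (\<psi> -` B \<inter> points X)"
      using open_pre[OF f] by simp
  next
    show "\<psi> ` points X \<subseteq> \<Union> {{x. f (rep_proj x) \<noteq> 0} | f d. f \<in> homogeneous d}"
      unfolding topology_generated_by_topspace[symmetric] proj_zar_def[symmetric] by simp
  qed
  show ?thesis
    unfolding morphism_def zar_projective_space
  proof (intro conjI allI impI cont)
    fix V f assume V: "openin (proj_zar :: 'n proj topology) V" and f: "f \<in> regular projective_space V"
    let ?V = "{x \<in> points X. \<psi> x \<in> V}"
    show "f \<circ> \<psi> \<in> regular X ?V"
    proof (rule regular_local)
      show "openin (zar X) ?V"
        by (rule openin_continuous_map_preimage[OF cont V])
      fix x assume "x \<in> ?V"
      then have x: "x \<in> points X" "\<psi> x \<in> V" by auto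
      obtain W d g h where *: "openin proj_zar W" "\<psi> x \<in> W" "W \<subseteq> V" "g \<in> homogeneous d"
        "h \<in> homogeneous d" "\<forall>z\<in>W. h (rep_proj z) \<noteq> 0 \<and> f z = g (rep_proj z) / h (rep_proj z)"
        using f x(2) by (rule regular_projectiveE)
      from lift[OF x(1)] obtain U F where U: "openin (zar X) U" "x \<in> U" "\<forall>i. F i \<in> regular X U"
        "\<forall>z\<in>U. (\<chi> i. F i z) \<noteq> 0 \<and> \<psi> z = abs_proj (\<chi> i. F i z)" by blast
      let ?U = "U \<inter> {x \<in> points X. \<psi> x \<in> W}"
      have open_U: "openin (zar X) ?U"
        by (rule openin_Int[OF U(1) openin_continuous_map_preimage[OF cont *(1)]])
      have F: "F i \<in> regular X ?U" for i
        by (rule regular_restrict[OF U(1) open_U]) (use U(3) in auto)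
      have eq: "h (\<chi> i. F i z) \<noteq> 0 \<and> f (\<psi> z) = g (\<chi> i. F i z) / h (\<chi> i. F i z)" if z: "z \<in> ?U" for z
      proof -
        have "z \<in> U"
          using z by simp
        from bspec[OF U(4) this] obtain c where c: "c \<noteq> 0" "rep_proj (\<psi> z) = c *s (\<chi> i. F i z)"
          using rep_abs_proj[of "\<chi> i. F i z"] by metis
        have "h (rep_proj (\<psi> z)) \<noteq> 0" "f (\<psi> z) = g (rep_proj (\<psi> z)) / h (rep_proj (\<psi> z))"
          using *(6) z by auto
        then show ?thesis
          using c by (simp add: homogeneous_scale[OF *(4)] homogeneous_scale[OF *(5)])
      qed
      have quotient: "(\<lambda>z. g (\<chi> i. F i z) / h (\<chi> i. F i z)) \<in> regular X ?U"
        by (rule regular_divide[OF open_U regular_homogeneous[OF open_U F *(4)] regular_homogeneous[OF open_U F *(5)]])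
          (rule conjunct1[OF eq])
      show "\<exists>N k. openin (zar X) N \<and> x \<in> N \<and> k \<in> regular X N \<and> (\<forall>z\<in>N \<inter> ?V. (f \<circ> \<psi>) z = k z)"
        by (rule exI[of _ ?U], rule exI[of _ "\<lambda>z. g (\<chi> i. F i z) / h (\<chi> i. F i z)"])
          (use quotient open_U U(2) *(2) x(1) eq in simp)
    qed
  qed
qed

text \<open>
  Conversely, where the \<open>k\<close>-th homogeneous coordinate is nonzero, dividing by it turns the
  homogeneous coordinates of a morphism into regular functions.
\<close>

lemma morphism_to_projective_spaceE:
  assumes \<psi>: "morphism X projective_space \<psi>" and x: "x \<in> points X"
  obtains U F where "openin (zar X) U" "x \<in> U" "\<forall>i. F i \<in> regular X U"
    "\<forall>z\<in>U. \<exists>c. c \<noteq> 0 \<and> (\<chi> i. F i z) = c *s rep_proj (\<psi> z)"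
proof -
  obtain k where k: "rep_proj (\<psi> x) $ k \<noteq> 0"
    using rep_proj_nonzero[of "\<psi> x"] by (auto simp: vec_eq_iff simp del: rep_proj_nonzero)
  let ?V = "{y. rep_proj y $ k \<noteq> 0}" and ?U = "{z \<in> points X. rep_proj (\<psi> z) $ k \<noteq> 0}"
  have V: "openin proj_zar ?V"
    by (rule openin_proj_nonvanishing[OF homogeneous_coordinate])
  have "openin (zar X) {z \<in> points X. \<psi> z \<in> ?V}"
    using V by (intro openin_morphism_preimage[OF \<psi>]) simp
  then have U: "openin (zar X) ?U"
    by simp
  have "(\<lambda>y. rep_proj y $ i / rep_proj y $ k) \<in> regular projective_space ?V" for i
    by (rule regular_projective_fraction[OF V homogeneous_coordinate homogeneous_coordinate]) simp
  then have "(\<lambda>y. rep_proj y $ i / rep_proj y $ k) \<circ> \<psi> \<in> regular X {z \<in> points X. \<psi> z \<in> ?V}" for i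
    using \<psi> V unfolding morphism_def zar_projective_space by blast
  then have F: "\<forall>i. (\<lambda>z. rep_proj (\<psi> z) $ i / rep_proj (\<psi> z) $ k) \<in> regular X ?U"
    by (simp add: comp_def)
  have "(\<chi> i. rep_proj (\<psi> z) $ i / rep_proj (\<psi> z) $ k) = inverse (rep_proj (\<psi> z) $ k) *s rep_proj (\<psi> z)" for z
    by (simp add: vec_eq_iff divide_inverse mult.commute)
  then show thesis
    using x k by (intro that[OF U _ F]) (auto intro!: exI[of _ "inverse (rep_proj (\<psi> _) $ k)"])
qed

end

text \<open>
  Polynomial functions of a pair of vectors, generated as an algebra by the coordinates of both. Only
  the existence of such an expression matters, never its coefficients.
\<close>

inductive bipolynomial :: "(complex^'m \<Rightarrow> complex^'n \<Rightarrow> complex) \<Rightarrow> bool" where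
  bipolynomial_fst: "bipolynomial (\<lambda>u v. u $ i)"
| bipolynomial_snd: "bipolynomial (\<lambda>u v. v $ j)"
| bipolynomial_const: "bipolynomial (\<lambda>u v. c)"
| bipolynomial_add: "bipolynomial p \<Longrightarrow> bipolynomial q \<Longrightarrow> bipolynomial (\<lambda>u v. p u v + q u v)"
| bipolynomial_mult: "bipolynomial p \<Longrightarrow> bipolynomial q \<Longrightarrow> bipolynomial (\<lambda>u v. p u v * q u v)"

lemma bipolynomial_minus: "bipolynomial p \<Longrightarrow> bipolynomial (\<lambda>u v. - p u v)"
  using bipolynomial_mult[OF bipolynomial_const[of "-1"]] by simp

lemma bipolynomial_diff: "bipolynomial p \<Longrightarrow> bipolynomial q \<Longrightarrow> bipolynomial (\<lambda>u v. p u v - q u v)"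
  using bipolynomial_add[OF _ bipolynomial_minus] by simp

lemma bipolynomial_power: "bipolynomial p \<Longrightarrow> bipolynomial (\<lambda>u v. p u v ^ n)"
  by (induction n) (simp_all add: bipolynomial_const bipolynomial_mult)

lemma bipolynomial_sum: "(\<And>i. bipolynomial (p i)) \<Longrightarrow> bipolynomial (\<lambda>u v. \<Sum>i\<in>I. p i u v)"
  by (induction I rule: infinite_finite_induct) (simp_all add: bipolynomial_const bipolynomial_add)

lemmas bipolynomial_intros = bipolynomial.intros bipolynomial_minus bipolynomial_diff
  bipolynomial_power bipolynomial_sum

context space_with_functions
begin

lemma regular_bipolynomial:
  assumes U: "openin (zar X) U" and FG: "\<And>i. F i \<in> regular X U" "\<And>j. G j \<in> regular X U"
    and p: "bipolynomial p"
  shows "(\<lambda>z. p (\<chi> i. F i z) (\<chi> j. G j z)) \<in> regular X U"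
  using p by induction
    (simp_all add: FG regular_const[OF U] regular_add[OF U] regular_mult[OF U])

text \<open>
  Maps that are given by polynomials in homogeneous coordinates are morphisms. The scaling hypothesis
  makes the map well defined on classes; local lifts of \<open>\<phi>\<close> and \<open>\<psi>\<close> to vectors of
  regular functions yield a local lift of the composite.
\<close>

lemma morphism_bihomogeneous:
  fixes Q :: "complex^'m \<Rightarrow> complex^'n \<Rightarrow> complex^'k"
  assumes \<phi>: "morphism X projective_space \<phi>" and \<psi>: "morphism X projective_space \<psi>"
    and poly: "\<And>k. bipolynomial (\<lambda>u v. Q u v $ k)"
    and scale: "\<And>a b u v. a \<noteq> 0 \<Longrightarrow> b \<noteq> 0 \<Longrightarrow> \<exists>c. c \<noteq> 0 \<and> Q (a *s u) (b *s v) = c *s Q u v"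
    and nz: "\<And>z. z \<in> points X \<Longrightarrow> Q (rep_proj (\<phi> z)) (rep_proj (\<psi> z)) \<noteq> 0"
  shows "morphism X projective_space (\<lambda>z. abs_proj (Q (rep_proj (\<phi> z)) (rep_proj (\<psi> z))))"
proof (rule morphism_to_projective_spaceI)
  fix x assume x: "x \<in> points X"
  obtain U F where U: "openin (zar X) U" "x \<in> U" "\<forall>i. F i \<in> regular X U"
    "\<forall>z\<in>U. \<exists>c. c \<noteq> 0 \<and> (\<chi> i. F i z) = c *s rep_proj (\<phi> z)"
    by (rule morphism_to_projective_spaceE[OF \<phi> x])
  obtain V G where V: "openin (zar X) V" "x \<in> V" "\<forall>i. G i \<in> regular X V"
    "\<forall>z\<in>V. \<exists>c. c \<noteq> 0 \<and> (\<chi> i. G i z) = c *s rep_proj (\<psi> z)"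
    by (rule morphism_to_projective_spaceE[OF \<psi> x])
  let ?W = "U \<inter> V"
  have W: "openin (zar X) ?W"
    by (rule openin_Int[OF U(1) V(1)])
  have FG: "F i \<in> regular X ?W" "G j \<in> regular X ?W" for i j
    using regular_restrict[OF U(1) W _ spec[OF U(3)]] regular_restrict[OF V(1) W _ spec[OF V(3)]] by auto
  let ?H = "\<lambda>k z. Q (\<chi> i. F i z) (\<chi> j. G j z) $ k"
  have "?H k \<in> regular X ?W" for k
    by (rule regular_bipolynomial[OF W FG poly])
  moreover have "(\<chi> k. ?H k z) \<noteq> 0 \<and> abs_proj (Q (rep_proj (\<phi> z)) (rep_proj (\<psi> z))) = abs_proj (\<chi> k. ?H k z)"
    if z: "z \<in> ?W" for z
  proof -
    have zUV: "z \<in> U" "z \<in> V"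
      using z by auto
    obtain a where a: "a \<noteq> 0" "(\<chi> i. F i z) = a *s rep_proj (\<phi> z)"
      using bspec[OF U(4) zUV(1)] by (elim exE conjE)
    obtain b where b: "b \<noteq> 0" "(\<chi> i. G i z) = b *s rep_proj (\<psi> z)"
      using bspec[OF V(4) zUV(2)] by (elim exE conjE)
    obtain c where c: "c \<noteq> 0" "Q (\<chi> i. F i z) (\<chi> j. G j z) = c *s Q (rep_proj (\<phi> z)) (rep_proj (\<psi> z))"
      using scale[OF a(1) b(1), of "rep_proj (\<phi> z)" "rep_proj (\<psi> z)"] unfolding a(2) b(2) by (elim exE conjE)
    have "Q (rep_proj (\<phi> z)) (rep_proj (\<psi> z)) \<noteq> 0"
      using subsetD[OF openin_subset[OF W] z] by (rule nz)
    then show ?thesis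
      unfolding vec_lambda_eta c(2) using c(1) by (simp add: abs_proj_scale)
  qed
  ultimately show "\<exists>U F. openin (zar X) U \<and> x \<in> U \<and> (\<forall>i. F i \<in> regular X U) \<and>
      (\<forall>z\<in>U. (\<chi> i. F i z) \<noteq> 0 \<and> abs_proj (Q (rep_proj (\<phi> z)) (rep_proj (\<psi> z))) = abs_proj (\<chi> i. F i z))"
    using W U(2) V(2) by (intro exI[of _ ?W] exI[of _ ?H]) simp
qed

end

section \<open>Pluecker coordinates, Bezoutians and Hankel matrices\<close>

lemma exhaust_5:
  fixes x :: 5
  shows "x = 1 \<or> x = 2 \<or> x = 3 \<or> x = 4 \<or> x = 5"
proof (induct x)
  case (of_int z)
  then have "z = 0 \<or> z = 1 \<or> z = 2 \<or> z = 3 \<or> z = 4" by simp arith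
  then show ?case by auto
qed

lemma forall_5: "(\<forall>i::5. P i) \<longleftrightarrow> P 1 \<and> P 2 \<and> P 3 \<and> P 4 \<and> P 5"
  by (metis exhaust_5)

definition minor :: "complex^'n^2 \<Rightarrow> 'n \<Rightarrow> 'n \<Rightarrow> complex" where
  "minor M i j = M $ 1 $ i * M $ 2 $ j - M $ 1 $ j * M $ 2 $ i"

text \<open>
  A skew array satisfying the Pluecker relation, that is, a point of the cone over the Grassmannian
  of planes in \<open>4\<close>-space.
\<close>

definition decomposable :: "(4 \<Rightarrow> 4 \<Rightarrow> complex) \<Rightarrow> bool" where
  "decomposable P \<longleftrightarrow> (\<forall>i j. P j i = - P i j) \<and> P 1 2 * P 3 4 - P 1 3 * P 2 4 + P 1 4 * P 2 3 = 0"

text \<open>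
  The determinant of the Bezout matrix of two cubic forms,
  the symmetric \<open>3 \<times> 3\<close> matrix with upper rows \<open>(P 1 2, P 1 3, P 1 4)\<close>,
  \<open>(P 1 4 + P 2 3, P 2 4)\<close> and \<open>(P 3 4)\<close>, in terms of the minors \<open>P\<close> of their
  coefficient matrix.
\<close>

definition bezoutian_det :: "(4 \<Rightarrow> 4 \<Rightarrow> complex) \<Rightarrow> complex" where
  "bezoutian_det P = P 1 2 * (P 1 4 + P 2 3) * P 3 4 + 2 * P 1 3 * P 2 4 * P 1 4
     - P 1 2 * (P 2 4)^2 - (P 1 4 + P 2 3) * (P 1 4)^2 - P 3 4 * (P 1 3)^2"

text \<open>
  The adjugate of the Bezout matrix. For decomposable \<open>P\<close> the central and the corner entry of
  the adjugate agree, so that the adjugate is the Hankel matrix with rows \<open>X Y Z\<close>,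
  \<open>Y Z V\<close>, \<open>Z V W\<close>; the third coordinate is defined through the central entry.
\<close>

definition hankel :: "(4 \<Rightarrow> 4 \<Rightarrow> complex) \<Rightarrow> complex^5" where
  "hankel P = (\<chi> k. if k = 1 then (P 1 4 + P 2 3) * P 3 4 - (P 2 4)^2
     else if k = 2 then P 1 4 * P 2 4 - P 1 3 * P 3 4
     else if k = 3 then P 1 2 * P 3 4 - (P 1 4)^2
     else if k = 4 then P 1 3 * P 1 4 - P 1 2 * P 2 4
     else P 1 2 * (P 1 4 + P 2 3) - (P 1 3)^2)"

text \<open>
  The complementary signed \<open>2 \<times> 2\<close> minors of the matrix with rows \<open>X Y Z V\<close> and
  \<open>Y Z V W\<close>. They are the Pluecker coordinates of its kernel, and the six values form the
  adjugate of the Hankel matrix in the same way as the minors of a pencil form its Bezout matrix.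
\<close>

definition upper_minor :: "complex^5 \<Rightarrow> 4 \<Rightarrow> 4 \<Rightarrow> complex" where
  "upper_minor v i j =
     (if i = 1 \<and> j = 2 then v $ 3 * v $ 5 - (v $ 4)^2
      else if i = 1 \<and> j = 3 then v $ 3 * v $ 4 - v $ 2 * v $ 5
      else if i = 1 \<and> j = 4 then v $ 2 * v $ 4 - (v $ 3)^2
      else if i = 2 \<and> j = 3 then v $ 1 * v $ 5 - v $ 2 * v $ 4
      else if i = 2 \<and> j = 4 then v $ 2 * v $ 3 - v $ 1 * v $ 4
      else if i = 3 \<and> j = 4 then v $ 1 * v $ 3 - (v $ 2)^2
      else 0)"

definition kernel_minor :: "complex^5 \<Rightarrow> 4 \<Rightarrow> 4 \<Rightarrow> complex" where
  "kernel_minor v i j = upper_minor v i j - upper_minor v j i"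

text \<open>
  For \<open>P i j \<noteq> 0\<close>, two vectors spanning the plane with Pluecker coordinates \<open>P\<close>,
  chosen so that their \<open>i\<close>-th and \<open>j\<close>-th entries form \<open>P i j\<close> times the identity.
\<close>

definition plane_matrix :: "(4 \<Rightarrow> 4 \<Rightarrow> complex) \<Rightarrow> 4 \<Rightarrow> 4 \<Rightarrow> complex^4^2" where
  "plane_matrix P i j = (\<chi> a k. if a = 1 then P k j else P i k)"

definition columns2 :: "'n \<Rightarrow> 'n \<Rightarrow> complex^'n^2 \<Rightarrow> complex^2^2" where
  "columns2 i j M = (\<chi> a b. if b = 1 then M $ a $ i else M $ a $ j)"

lemma hankel_nth [simp]:
  "hankel P $ 1 = (P 1 4 + P 2 3) * P 3 4 - (P 2 4)^2"
  "hankel P $ 2 = P 1 4 * P 2 4 - P 1 3 * P 3 4"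
  "hankel P $ 3 = P 1 2 * P 3 4 - (P 1 4)^2"
  "hankel P $ 4 = P 1 3 * P 1 4 - P 1 2 * P 2 4"
  "hankel P $ 5 = P 1 2 * (P 1 4 + P 2 3) - (P 1 3)^2"
  by (simp_all add: hankel_def)

lemma kernel_minor_simps [simp]:
  "kernel_minor v 1 2 = v $ 3 * v $ 5 - (v $ 4)^2"
  "kernel_minor v 1 3 = v $ 3 * v $ 4 - v $ 2 * v $ 5"
  "kernel_minor v 1 4 = v $ 2 * v $ 4 - (v $ 3)^2"
  "kernel_minor v 2 3 = v $ 1 * v $ 5 - v $ 2 * v $ 4"
  "kernel_minor v 2 4 = v $ 2 * v $ 3 - v $ 1 * v $ 4"
  "kernel_minor v 3 4 = v $ 1 * v $ 3 - (v $ 2)^2"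
  by (simp_all add: kernel_minor_def upper_minor_def)

lemma kernel_minor_skew: "kernel_minor v j i = - kernel_minor v i j"
  by (simp add: kernel_minor_def)

lemma decomposable_skew: "decomposable P \<Longrightarrow> P j i = - P i j"
  unfolding decomposable_def by (rule spec, rule spec, rule conjunct1)

lemma decomposable_diag: "decomposable P \<Longrightarrow> P i i = 0"
  using decomposable_skew[of P i i] by (simp add: equal_neg_zero)

lemma decomposable_relation: "decomposable P \<Longrightarrow> P 1 2 * P 3 4 = P 1 3 * P 2 4 - P 1 4 * P 2 3"
  unfolding decomposable_def by (drule conjunct2) (simp add: algebra_simps)

lemma decomposable_minor: "decomposable (minor M)"
  by (auto simp: decomposable_def minor_def algebra_simps)

lemma decomposable_kernel_minor: "decomposable (kernel_minor v)"
  unfolding decomposable_def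
proof (intro conjI allI)
  show "kernel_minor v 1 2 * kernel_minor v 3 4 - kernel_minor v 1 3 * kernel_minor v 2 4
      + kernel_minor v 1 4 * kernel_minor v 2 3 = 0"
    by (simp add: power2_eq_square algebra_simps)
qed (rule kernel_minor_skew)

lemma D_form_alt: "D_form v = v $ 1 * v $ 3 * v $ 5 - v $ 1 * (v $ 4)^2 - (v $ 2)^2 * v $ 5
    + 2 * v $ 2 * v $ 4 * v $ 3 - (v $ 3)^3"
  by (simp add: D_form_def Let_def)

text \<open>
  For a symmetric \<open>3 \<times> 3\<close> matrix \<open>H\<close> the adjugate of the adjugate is
  \<open>det H\<close> times \<open>H\<close>. Here \<open>kernel_minor\<close> encodes the adjugate of a Hankel matrix.
\<close>

lemma hankel_kernel_minor: "hankel (kernel_minor v) = D_form v *s v"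
  by (simp add: vec_eq_iff forall_5 D_form_alt) (simp add: algebra_simps power2_eq_square power3_eq_cube)

text \<open>
  The determinant of the adjugate of a \<open>3 \<times> 3\<close> matrix is the square of the determinant.
\<close>

lemma bezoutian_det_kernel_minor: "bezoutian_det (kernel_minor v) = (D_form v)^2"
  by (simp add: D_form_alt bezoutian_det_def) (simp add: algebra_simps power2_eq_square power3_eq_cube)

lemma skew_eqI:
  fixes P Q :: "4 \<Rightarrow> 4 \<Rightarrow> complex"
  assumes "\<And>i j. P j i = - P i j" "\<And>i j. Q j i = - Q i j"
    and "P 1 2 = Q 1 2" "P 1 3 = Q 1 3" "P 1 4 = Q 1 4" "P 2 3 = Q 2 3" "P 2 4 = Q 2 4" "P 3 4 = Q 3 4"
  shows "P = Q"
proof -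
  have diag: "P i i = 0" "Q i i = 0" for i
    using assms(1)[of i i] assms(2)[of i i] by (simp_all add: eq_neg_iff_add_eq_0 flip: mult_2)
  have "\<forall>i j. P i j = Q i j"
    unfolding forall_4 using assms(3-8) diag
      assms(1)[of 1 2] assms(1)[of 1 3] assms(1)[of 1 4] assms(1)[of 2 3] assms(1)[of 2 4] assms(1)[of 3 4]
      assms(2)[of 1 2] assms(2)[of 1 3] assms(2)[of 1 4] assms(2)[of 2 3] assms(2)[of 2 4] assms(2)[of 3 4]
    by simp
  then show ?thesis by (simp add: fun_eq_iff)
qed

text \<open>
  The identity for the double adjugate again, now starting from a Bezout matrix. It needs the Pluecker
  relation, as only then the adjugate is a Hankel matrix.
\<close>

lemma kernel_minor_hankel:
  assumes P: "decomposable P"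
  shows "kernel_minor (hankel P) = (\<lambda>i j. bezoutian_det P * P i j)"
proof (rule skew_eqI)
  show "bezoutian_det P * P j i = - (bezoutian_det P * P i j)" for i j
    using decomposable_skew[OF P, of j i] by simp
  have rel: "P 1 2 * P 3 4 = P 1 3 * P 2 4 - P 1 4 * P 2 3"
    by (rule decomposable_relation[OF P])
  show "kernel_minor (hankel P) 1 2 = bezoutian_det P * P 1 2"
    "kernel_minor (hankel P) 1 3 = bezoutian_det P * P 1 3"
    "kernel_minor (hankel P) 1 4 = bezoutian_det P * P 1 4"
    "kernel_minor (hankel P) 2 3 = bezoutian_det P * P 2 3"
    "kernel_minor (hankel P) 2 4 = bezoutian_det P * P 2 4"
    "kernel_minor (hankel P) 3 4 = bezoutian_det P * P 3 4"
    unfolding kernel_minor_simps hankel_nth bezoutian_det_def using rel by algebra+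
qed (rule kernel_minor_skew)

text \<open>
  The determinant of the adjugate of a symmetric matrix with six independent entries. The asymmetry
  between \<open>r\<close> and \<open>u\<close> is what remains before the Pluecker relation identifies them.
\<close>

lemma det_adjugate_symmetric3:
  fixes a b c d e f :: complex
  defines "p \<equiv> d * f - e^2" and "q \<equiv> c * e - b * f" and "r \<equiv> b * e - c * d"
    and "u \<equiv> a * f - c^2" and "v \<equiv> b * c - a * e" and "w \<equiv> a * d - b^2"
  shows "p * u * w - p * v^2 - q^2 * w + 2 * q * v * r - r^2 * u
    = (a * d * f + 2 * b * e * c - a * e^2 - d * c^2 - f * b^2)^2"
  unfolding assms by (simp add: algebra_simps power2_eq_square)

lemma D_form_hankel:
  assumes P: "decomposable P"
  shows "D_form (hankel P) = (bezoutian_det P)^2"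
proof -
  \<comment> \<open>The third coordinate occurs both as central and as corner entry; the corner occurrences are
    rewritten by the Pluecker relation so that the identity for a general adjugate applies.\<close>
  have corner: "hankel P $ 3 = P 1 3 * P 2 4 - P 1 4 * (P 1 4 + P 2 3)"
    using decomposable_relation[OF P] by (simp add: algebra_simps power2_eq_square)
  let ?h = "hankel P" and ?Z = "P 1 3 * P 2 4 - P 1 4 * (P 1 4 + P 2 3)"
  have "D_form ?h = ?h $ 1 * ?h $ 3 * ?h $ 5 - ?h $ 1 * (?h $ 4)^2 - (?h $ 2)^2 * ?h $ 5
      + 2 * ?h $ 2 * ?h $ 4 * ?Z - ?Z^2 * ?h $ 3"
    unfolding D_form_alt corner[symmetric] by (simp only: power2_eq_square power3_eq_cube)
  also have "\<dots> = (bezoutian_det P)^2"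
    unfolding hankel_nth bezoutian_det_def by (rule det_adjugate_symmetric3)
  finally show ?thesis .
qed

text \<open>
  The six exchange relations are the three-term Pluecker relation or trivial, for each pair
  \<open>i\<close>, \<open>j\<close>.
\<close>

lemma minor_plane_matrix:
  assumes P: "decomposable P"
  shows "minor (plane_matrix P i j) = (\<lambda>k l. P i j * P k l)"
proof (rule skew_eqI)
  note skew = decomposable_skew[OF P] and diag = decomposable_diag[OF P]
  show "minor (plane_matrix P i j) l k = - minor (plane_matrix P i j) k l" for k l
    by (simp add: minor_def)
  show "P i j * P l k = - (P i j * P k l)" for k l
    using skew[of l k] by simp
  note skews = skew[of 2 1] skew[of 3 1] skew[of 4 1] skew[of 3 2] skew[of 4 2] skew[of 4 3]
  have rel: "P 1 2 * P 3 4 = P 1 3 * P 2 4 - P 1 4 * P 2 3"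
    by (rule decomposable_relation[OF P])
  have exchange: "\<forall>i j. P 1 j * P i 2 - P 2 j * P i 1 = P i j * P 1 2 \<and>
      P 1 j * P i 3 - P 3 j * P i 1 = P i j * P 1 3 \<and>
      P 1 j * P i 4 - P 4 j * P i 1 = P i j * P 1 4 \<and>
      P 2 j * P i 3 - P 3 j * P i 2 = P i j * P 2 3 \<and>
      P 2 j * P i 4 - P 4 j * P i 2 = P i j * P 2 4 \<and>
      P 3 j * P i 4 - P 4 j * P i 3 = P i j * P 3 4"
    unfolding forall_4 diag skews by (intro conjI; ((simp add: algebra_simps; fail) | use rel in algebra | use rel in \<open>simp add: algebra_simps\<close>))
  show "minor (plane_matrix P i j) 1 2 = P i j * P 1 2" "minor (plane_matrix P i j) 1 3 = P i j * P 1 3"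
    "minor (plane_matrix P i j) 1 4 = P i j * P 1 4" "minor (plane_matrix P i j) 2 3 = P i j * P 2 3"
    "minor (plane_matrix P i j) 2 4 = P i j * P 2 4" "minor (plane_matrix P i j) 3 4 = P i j * P 3 4"
    using exchange[rule_format, of j i] by (simp_all add: minor_def plane_matrix_def)
qed


lemma minor_matrix_mult: "minor (A ** M) i j = det A * minor M i j"
  for A :: "complex^2^2" and M :: "complex^'n^2"
  by (simp add: minor_def matrix_matrix_mult_def sum_2 det_2 algebra_simps)

lemma columns2_matrix_mult: "columns2 i j (A ** M) = A ** columns2 i j M"
  by (simp add: columns2_def matrix_matrix_mult_def vec_eq_iff)

lemma det_columns2: "det (columns2 i j M) = minor M i j"
  by (simp add: columns2_def det_2 minor_def)

definition scale_matrix :: "complex \<Rightarrow> complex^'n^'m \<Rightarrow> complex^'n^'m" where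
  "scale_matrix c M = (\<chi> i j. c * M $ i $ j)"

text \<open>
  A \<open>2 \<times> 4\<close> matrix is recovered from its \<open>i\<close>-th and \<open>j\<close>-th columns and its
  minors: this is Cramer's rule for expressing each column through those two.
\<close>

lemma columns2_mult_plane_matrix:
  "columns2 i j M ** plane_matrix (minor M) i j = scale_matrix (minor M i j) M"
  by (simp add: vec_eq_iff forall_2 columns2_def plane_matrix_def matrix_matrix_mult_def sum_2
      scale_matrix_def minor_def algebra_simps)

lemma columns2_plane_matrix:
  assumes "decomposable P"
  shows "columns2 i j (plane_matrix P i j) = scale_matrix (P i j) (mat 1)"
  using decomposable_diag[OF assms]
  by (simp add: vec_eq_iff forall_2 columns2_def plane_matrix_def scale_matrix_def mat_def)

lemma bezoutian_det_scale: "bezoutian_det (\<lambda>i j. c * P i j) = c ^ 3 * bezoutian_det P"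
  by (simp add: bezoutian_det_def algebra_simps power2_eq_square power3_eq_cube)

lemma hankel_scale: "hankel (\<lambda>i j. c * P i j) = c\<^sup>2 *s hankel P"
  by (simp add: vec_eq_iff forall_5 algebra_simps power2_eq_square)

lemma kernel_minor_scale: "kernel_minor (c *s v) = (\<lambda>i j. c\<^sup>2 * kernel_minor v i j)"
  by (auto simp: fun_eq_iff kernel_minor_def upper_minor_def algebra_simps power2_eq_square)

lemma plane_matrix_scale: "plane_matrix (\<lambda>i j. c * P i j) i j = scale_matrix c (plane_matrix P i j)"
  by (simp add: plane_matrix_def scale_matrix_def vec_eq_iff)

lemma minor_scale_matrix: "minor (scale_matrix c M) = (\<lambda>i j. c\<^sup>2 * minor M i j)"
  by (simp add: fun_eq_iff minor_def scale_matrix_def algebra_simps power2_eq_square)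

section \<open>The resultant of two cubic forms\<close>

text \<open>
  Division of a cubic form by the linear form vanishing at \<open>(s, t)\<close>; the quotient is the
  quadratic form with coefficients \<open>a\<close>, \<open>b\<close>, \<open>d\<close>.
\<close>

lemma cubic_form_linear_factor:
  assumes "(s, t) \<noteq> (0, 0)" "cubic_form c s t = 0"
  obtains a b d where "c $ 1 = t * a" "c $ 2 = t * b - s * a" "c $ 3 = t * d - s * b" "c $ 4 = - s * d"
proof (cases "t = 0")
  case True
  then have "s \<noteq> 0" "c $ 1 = 0"
    using assms by (auto simp: cubic_form_def)
  with True show thesis
    by (intro that[of "- c $ 2 / s" "- c $ 3 / s" "- c $ 4 / s"]) auto
next
  case False
  have "c $ 1 * s^3 + c $ 2 * s^2 * t + c $ 3 * s * t^2 + c $ 4 * t^3 = 0"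
    using assms by (simp add: cubic_form_def)
  then have "c $ 4 = - (c $ 1 * s^3 + c $ 2 * s^2 * t + c $ 3 * s * t^2) / t^3"
    using False by (simp add: field_simps eq_neg_iff_add_eq_0)
  with False show thesis
    by (intro that[of "c $ 1 / t" "(c $ 2 + s * (c $ 1 / t)) / t" "(c $ 3 + s * ((c $ 2 + s * (c $ 1 / t)) / t)) / t"])
      (simp_all add: field_simps power2_eq_square power3_eq_cube)
qed

lemma binary_form_zero:
  fixes c0 c1 c2 c3 :: complex
  shows "\<exists>s t. (s, t) \<noteq> (0, 0) \<and> c3 * s^3 + c2 * s^2 * t + c1 * s * t^2 + c0 * t^3 = 0"
proof (cases "c3 = 0")
  case True
  then show ?thesis by (intro exI[of _ 1] exI[of _ 0]) simp
next
  case False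
  then have "\<not> constant (poly [:c0, c1, c2, c3:])"
    by (simp add: constant_degree)
  then obtain z where "poly [:c0, c1, c2, c3:] z = 0"
    using fundamental_theorem_of_algebra by blast
  then show ?thesis
    by (intro exI[of _ z] exI[of _ 1]) (simp add: algebra_simps power2_eq_square power3_eq_cube)
qed

lemma binary_quadratic_factor:
  fixes a b c :: complex
  obtains s t u v where "a = t * v" "b = - t * u - s * v" "c = s * u"
proof (cases "a = 0")
  case True
  then show thesis by (intro that[where s = 1 and t = 0 and u = c and v = "- b"]) auto
next
  case False
  then have "\<not> constant (poly [:c, b, a:])"
    by (simp add: constant_degree)
  then obtain z where "poly [:c, b, a:] z = 0"
    using fundamental_theorem_of_algebra by blast
  then have "c = - (b * z + a * z * z)"
    by (simp add: algebra_simps eq_neg_iff_add_eq_0)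
  then show thesis
    by (intro that[where s = z and t = 1 and u = "- b - a * z" and v = a]) (auto simp: algebra_simps)
qed

text \<open>
  Every binary cubic form over the complex numbers is a product of three linear forms, the
  \<open>i\<close>-th of which vanishes at \<open>(s i, t i)\<close>.
\<close>

lemma cubic_form_factorization:
  fixes c :: "complex^4"
  obtains s t :: "3 \<Rightarrow> complex" where
    "c $ 1 = t 1 * t 2 * t 3"
    "c $ 2 = - (s 1 * t 2 * t 3 + t 1 * s 2 * t 3 + t 1 * t 2 * s 3)"
    "c $ 3 = s 1 * s 2 * t 3 + s 1 * t 2 * s 3 + t 1 * s 2 * s 3"
    "c $ 4 = - (s 1 * s 2 * s 3)"
proof -
  obtain s1 t1 where 1: "(s1, t1) \<noteq> (0, 0)" "cubic_form c s1 t1 = 0"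
    using binary_form_zero unfolding cubic_form_def by blast
  obtain a b d where 2: "c $ 1 = t1 * a" "c $ 2 = t1 * b - s1 * a" "c $ 3 = t1 * d - s1 * b" "c $ 4 = - s1 * d"
    using cubic_form_linear_factor[OF 1] .
  obtain s2 t2 s3 t3 where 3: "a = t2 * t3" "b = - t2 * s3 - s2 * t3" "d = s2 * s3"
    by (rule binary_quadratic_factor)
  show thesis
    by (rule that[where s = "\<lambda>i. if i = 1 then s1 else if i = 2 then s2 else s3"
          and t = "\<lambda>i. if i = 1 then t1 else if i = 2 then t2 else t3"])
      (simp_all add: 2 3 algebra_simps)
qed

text \<open>
  Up to sign, the Bezout determinant is the resultant, written as the product of the values of the
  second form at the zeros of the first.
\<close>

lemma bezoutian_det_eq_resultant:
  fixes M :: "complex^4^2"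
  assumes c: "M $ 1 $ 1 = t 1 * t 2 * t 3"
    "M $ 1 $ 2 = - (s 1 * t 2 * t 3 + t 1 * s 2 * t 3 + t 1 * t 2 * s 3)"
    "M $ 1 $ 3 = s 1 * s 2 * t 3 + s 1 * t 2 * s 3 + t 1 * s 2 * s 3"
    "M $ 1 $ 4 = - (s 1 * s 2 * s 3)"
  shows "bezoutian_det (minor M) = - (cubic_form (M $ 2) (s 1) (t 1) * cubic_form (M $ 2) (s 2) (t 2)
    * cubic_form (M $ 2) (s 3) (t (3::3)))"
  unfolding bezoutian_det_def minor_def cubic_form_def c by algebra

text \<open>
  If both forms are divisible by the same linear form, the Bezout matrix annihilates the vector of
  quadratic monomials in \<open>s\<close> and \<open>t\<close>; after division this is a polynomial identity.
\<close>

lemma bezoutian_det_common_zero: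
  fixes M :: "complex^4^2"
  assumes "(s, t) \<noteq> (0, 0)" "cubic_form (M $ 1) s t = 0" "cubic_form (M $ 2) s t = 0"
  shows "bezoutian_det (minor M) = 0"
proof -
  obtain a b d where p: "M $ 1 $ 1 = t * a" "M $ 1 $ 2 = t * b - s * a" "M $ 1 $ 3 = t * d - s * b" "M $ 1 $ 4 = - s * d"
    using cubic_form_linear_factor[OF assms(1,2)] .
  obtain a' b' d' where q: "M $ 2 $ 1 = t * a'" "M $ 2 $ 2 = t * b' - s * a'" "M $ 2 $ 3 = t * d' - s * b'" "M $ 2 $ 4 = - s * d'"
    using cubic_form_linear_factor[OF assms(1,3)] .
  show ?thesis
    unfolding bezoutian_det_def minor_def p q by algebra
qed

lemma common_zero_iff_bezoutian_det:
  fixes M :: "complex^4^2"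
  shows "(\<exists>s t. (s, t) \<noteq> (0, 0) \<and> cubic_form (M $ 1) s t = 0 \<and> cubic_form (M $ 2) s t = 0)
    \<longleftrightarrow> bezoutian_det (minor M) = 0"
proof
  assume "\<exists>s t. (s, t) \<noteq> (0, 0) \<and> cubic_form (M $ 1) s t = 0 \<and> cubic_form (M $ 2) s t = 0"
  then show "bezoutian_det (minor M) = 0"
    by (elim exE conjE) (rule bezoutian_det_common_zero)
next
  assume 0: "bezoutian_det (minor M) = 0"
  obtain s t :: "3 \<Rightarrow> complex" where c: "M $ 1 $ 1 = t 1 * t 2 * t 3"
    "M $ 1 $ 2 = - (s 1 * t 2 * t 3 + t 1 * s 2 * t 3 + t 1 * t 2 * s 3)"
    "M $ 1 $ 3 = s 1 * s 2 * t 3 + s 1 * t 2 * s 3 + t 1 * s 2 * s 3"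
    "M $ 1 $ 4 = - (s 1 * s 2 * s 3)"
    by (rule cubic_form_factorization)
  have "\<exists>i. cubic_form (M $ 2) (s i) (t i) = 0"
    using 0 bezoutian_det_eq_resultant[OF c] by auto
  then obtain i where i: "cubic_form (M $ 2) (s i) (t i) = 0" ..
  have p: "cubic_form (M $ 1) (s i) (t i) = 0"
    using exhaust_3[of i] by (elim disjE) (simp_all add: cubic_form_def c algebra_simps power2_eq_square power3_eq_cube)
  \<comment> \<open>If the \<open>i\<close>-th linear factor is identically zero, then so is the first form, and any zero of
    the second form is a common zero.\<close>
  show "\<exists>s t. (s, t) \<noteq> (0, 0) \<and> cubic_form (M $ 1) s t = 0 \<and> cubic_form (M $ 2) s t = 0"
  proof (cases "s i = 0 \<and> t i = 0")
    case False
    then show ?thesis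
      using i p by (intro exI[of _ "s i"] exI[of _ "t i"]) simp
  next
    case True
    then have "M $ 1 $ 1 = 0" "M $ 1 $ 2 = 0" "M $ 1 $ 3 = 0" "M $ 1 $ 4 = 0"
      using exhaust_3[of i] by (auto simp: c)
    then have p: "cubic_form (M $ 1) s t = 0" for s t
      by (simp add: cubic_form_def)
    show ?thesis
      using binary_form_zero[where ?c3.0 = "M $ 2 $ 1" and ?c2.0 = "M $ 2 $ 2" and ?c1.0 = "M $ 2 $ 3"
          and ?c0.0 = "M $ 2 $ 4"] p
      by (simp add: cubic_form_def)
  qed
qed

section \<open>Classes of matrices\<close>

lemma to_matrix_of_matrix [simp]: "to_matrix (of_matrix A) = A"
  by (simp add: to_matrix_def of_matrix_def vec_eq_iff)

lemma of_matrix_to_matrix [simp]: "of_matrix (to_matrix v) = v"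
  by (simp add: to_matrix_def of_matrix_def vec_eq_iff)

lemma to_matrix_nth [simp]: "to_matrix v $ i $ j = v $ (i, j)"
  by (simp add: to_matrix_def)

lemma of_matrix_nth [simp]: "of_matrix A $ k = A $ fst k $ snd k"
  by (simp add: of_matrix_def)

lemma of_matrix_eq_0_iff [simp]: "of_matrix A = 0 \<longleftrightarrow> A = 0"
  by (auto simp: vec_eq_iff)

lemma to_matrix_eq_0_iff [simp]: "to_matrix v = 0 \<longleftrightarrow> v = 0"
  by (auto simp: vec_eq_iff)

lemma to_matrix_scale: "to_matrix (c *s v) = scale_matrix c (to_matrix v)"
  by (simp add: vec_eq_iff scale_matrix_def)

lemma of_matrix_scale: "of_matrix (scale_matrix c A) = c *s of_matrix A"
  by (simp add: vec_eq_iff scale_matrix_def)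

lemma scale_matrix_mult: "scale_matrix c A ** scale_matrix d B = scale_matrix (c * d) (A ** B)"
  by (simp add: vec_eq_iff scale_matrix_def matrix_matrix_mult_def sum_distrib_left mult_ac)

lemma scale_matrix_eq_0_iff [simp]: "scale_matrix c A = 0 \<longleftrightarrow> c = 0 \<or> A = 0"
  by (auto simp: vec_eq_iff scale_matrix_def)

lemma det_scale_matrix: "det (scale_matrix c A) = c^2 * det A" for A :: "complex^2^2"
  by (simp add: det_2 scale_matrix_def algebra_simps power2_eq_square)

lemma columns2_scale_matrix: "columns2 i j (scale_matrix c M) = scale_matrix c (columns2 i j M)"
  by (simp add: vec_eq_iff columns2_def scale_matrix_def)

abbreviation matrix_class :: "complex^'c^'r \<Rightarrow> ('r::finite \<times> 'c::finite) proj" where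
  "matrix_class A \<equiv> abs_proj (of_matrix A)"

abbreviation rep_matrix :: "('r::finite \<times> 'c::finite) proj \<Rightarrow> complex^'c^'r" where
  "rep_matrix x \<equiv> to_matrix (rep_proj x)"

lemma rep_matrix_class:
  assumes "A \<noteq> 0"
  obtains c where "c \<noteq> 0" "rep_matrix (matrix_class A) = scale_matrix c A"
proof -
  have "of_matrix A \<noteq> 0"
    using assms by simp
  then obtain c where "c \<noteq> 0" "rep_proj (matrix_class A) = c *s of_matrix A"
    by (rule rep_abs_proj)
  then show thesis
    using that[of c] by (simp add: to_matrix_scale)
qed

lemma matrix_class_scale: "c \<noteq> 0 \<Longrightarrow> A \<noteq> 0 \<Longrightarrow> matrix_class (scale_matrix c A) = matrix_class A"
  by (simp add: of_matrix_scale abs_proj_scale)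

lemma proj_mult_matrix_class:
  assumes "A \<noteq> 0" "B \<noteq> 0" "A ** B \<noteq> 0"
  shows "proj_mult (matrix_class A) (matrix_class B) = matrix_class (A ** B)"
proof -
  obtain c where c: "c \<noteq> 0" "rep_matrix (matrix_class A) = scale_matrix c A"
    using rep_matrix_class[OF assms(1)] .
  obtain d where d: "d \<noteq> 0" "rep_matrix (matrix_class B) = scale_matrix d B"
    using rep_matrix_class[OF assms(2)] .
  show ?thesis
    unfolding proj_mult_def c(2) d(2) scale_matrix_mult
    using c(1) d(1) assms(3) by (simp add: matrix_class_scale)
qed

section \<open>The group and its action\<close>

lemma nonzero_of_det: "det A \<noteq> 0 \<Longrightarrow> A \<noteq> 0" for A :: "complex^2^2"
  by (auto simp: det_2)

lemma matrix_class_in_PGL2_points: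
  assumes "det A \<noteq> 0"
  shows "matrix_class A \<in> PGL2_points"
proof -
  obtain c where "c \<noteq> 0" "rep_matrix (matrix_class A) = scale_matrix c A"
    using rep_matrix_class[OF nonzero_of_det[OF assms]] .
  then show ?thesis
    using assms by (simp add: PGL2_points_def det_scale_matrix)
qed

lemma PGL2_pointsE:
  assumes "g \<in> PGL2_points"
  obtains A where "g = matrix_class A" "det A \<noteq> 0"
  using assms by (intro that[of "rep_matrix g"]) (simp_all add: PGL2_points_def)

text \<open>
  The two rows, read as cubic forms, have no common zero.
\<close>

definition regular_pencil :: "complex^4^2 \<Rightarrow> bool" where
  "regular_pencil M \<longleftrightarrow> bezoutian_det (minor M) \<noteq> 0"

lemma nonzero_of_regular_pencil: "regular_pencil M \<Longrightarrow> M \<noteq> 0"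
  by (auto simp: regular_pencil_def bezoutian_det_def minor_def)

lemma regular_pencil_scale: "c \<noteq> 0 \<Longrightarrow> regular_pencil (scale_matrix c M) \<longleftrightarrow> regular_pencil M"
  by (simp add: regular_pencil_def minor_scale_matrix bezoutian_det_scale)

lemma regular_pencil_mult: "det A \<noteq> 0 \<Longrightarrow> regular_pencil M \<Longrightarrow> regular_pencil (A ** M)"
proof -
  have "minor (A ** M) = (\<lambda>i j. det A * minor M i j)"
    by (simp add: fun_eq_iff minor_matrix_mult)
  then show "det A \<noteq> 0 \<Longrightarrow> regular_pencil M \<Longrightarrow> regular_pencil (A ** M)"
    by (simp add: regular_pencil_def bezoutian_det_scale)
qed

lemma R3_points_eq: "R3_points = {x. regular_pencil (rep_matrix x)}"
  unfolding R3_points_def regular_pencil_def common_zero_iff_bezoutian_det ..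

lemma matrix_class_in_R3_points:
  assumes "regular_pencil M"
  shows "matrix_class M \<in> R3_points"
proof -
  obtain c where "c \<noteq> 0" "rep_matrix (matrix_class M) = scale_matrix c M"
    using rep_matrix_class[OF nonzero_of_regular_pencil[OF assms]] .
  then show ?thesis
    using assms by (simp add: R3_points_eq regular_pencil_scale)
qed

lemma R3_pointsE:
  assumes "x \<in> R3_points"
  obtains M where "x = matrix_class M" "regular_pencil M"
  using assms by (intro that[of "rep_matrix x"]) (simp_all add: R3_points_eq)

lemma proj_mult_PGL2:
  fixes A B :: "complex^2^2"
  assumes "det A \<noteq> 0" "det B \<noteq> 0"
  shows "proj_mult (matrix_class A) (matrix_class B) = matrix_class (A ** B)"
  by (intro proj_mult_matrix_class nonzero_of_det) (simp_all add: det_mul assms)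

lemma proj_mult_R3:
  assumes "det A \<noteq> 0" "regular_pencil M"
  shows "proj_mult (matrix_class A) (matrix_class M) = matrix_class (A ** M)"
  by (intro proj_mult_matrix_class nonzero_of_det nonzero_of_regular_pencil regular_pencil_mult assms)

lemma proj_mult_PGL2_closed:
  assumes "g \<in> PGL2_points" "h \<in> PGL2_points"
  shows "proj_mult g h \<in> PGL2_points"
  using assms
  by (elim PGL2_pointsE) (simp add: proj_mult_PGL2 matrix_class_in_PGL2_points det_mul)

lemma proj_mult_R3_closed:
  assumes "g \<in> PGL2_points" "x \<in> R3_points"
  shows "proj_mult g x \<in> R3_points"
  using assms
  by (elim PGL2_pointsE R3_pointsE) (simp add: proj_mult_R3 matrix_class_in_R3_points regular_pencil_mult)

lemma proj_mult_assoc_R3: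
  assumes "g \<in> PGL2_points" "h \<in> PGL2_points" "x \<in> R3_points"
  shows "proj_mult (proj_mult g h) x = proj_mult g (proj_mult h x)"
proof -
  obtain A where A: "g = matrix_class A" "det A \<noteq> 0"
    using assms(1) by (rule PGL2_pointsE)
  obtain B where B: "h = matrix_class B" "det B \<noteq> 0"
    using assms(2) by (rule PGL2_pointsE)
  obtain M where M: "x = matrix_class M" "regular_pencil M"
    using assms(3) by (rule R3_pointsE)
  show ?thesis
    unfolding A(1) B(1) M(1) using A(2) B(2) M(2)
    by (simp add: proj_mult_R3 proj_mult_PGL2 regular_pencil_mult det_mul matrix_mul_assoc)
qed

lemma proj_mult_one_R3:
  assumes "x \<in> R3_points"
  shows "proj_mult (matrix_class (mat 1)) x = x"
proof -
  obtain M where M: "x = matrix_class M" "regular_pencil M"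
    using assms by (rule R3_pointsE)
  show ?thesis
    unfolding M(1) using proj_mult_R3[OF _ M(2), of "mat 1"] by simp
qed

definition adjugate2 :: "complex^2^2 \<Rightarrow> complex^2^2" where
  "adjugate2 A = (\<chi> i j. if i = 1 then (if j = 1 then A $ 2 $ 2 else - A $ 1 $ 2)
                         else (if j = 1 then - A $ 2 $ 1 else A $ 1 $ 1))"

lemma det_adjugate2: "det (adjugate2 A) = det A"
  by (simp add: det_2 adjugate2_def)

lemma adjugate2_mult: "adjugate2 A ** A = scale_matrix (det A) (mat 1)"
  by (simp add: vec_eq_iff forall_2 adjugate2_def matrix_matrix_mult_def sum_2 scale_matrix_def
      mat_def det_2 algebra_simps)

lemma adjugate2_scale: "adjugate2 (scale_matrix c A) = scale_matrix c (adjugate2 A)"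
  by (simp add: vec_eq_iff forall_2 adjugate2_def scale_matrix_def)

lemma adjugate2_inverse:
  assumes "det A \<noteq> 0"
  shows "proj_mult (matrix_class (adjugate2 A)) (matrix_class A) = matrix_class (mat 1)"
  using assms by (simp add: proj_mult_PGL2 det_adjugate2 adjugate2_mult matrix_class_scale
      nonzero_of_det[of "mat 1"])

lemma carrier_PGL2 [simp]: "carrier PGL2 = PGL2_points"
  and mult_PGL2 [simp]: "x \<otimes>\<^bsub>PGL2\<^esub> y = proj_mult x y"
  and one_PGL2 [simp]: "\<one>\<^bsub>PGL2\<^esub> = matrix_class (mat 1)"
  by (simp_all add: PGL2_def)

lemma group_PGL2: "group PGL2"
proof (rule groupI; simp only: carrier_PGL2 mult_PGL2 one_PGL2)
  show "proj_mult x y \<in> PGL2_points" if "x \<in> PGL2_points" "y \<in> PGL2_points" for x y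
    using that by (rule proj_mult_PGL2_closed)
  show "matrix_class (mat 1) \<in> PGL2_points"
    by (rule matrix_class_in_PGL2_points) simp
  show "proj_mult (proj_mult x y) z = proj_mult x (proj_mult y z)"
    if "x \<in> PGL2_points" "y \<in> PGL2_points" "z \<in> PGL2_points" for x y z
    using that by (elim PGL2_pointsE) (simp add: proj_mult_PGL2 det_mul matrix_mul_assoc)
  show "proj_mult (matrix_class (mat 1)) x = x" if "x \<in> PGL2_points" for x
    using that by (elim PGL2_pointsE) (simp add: proj_mult_PGL2)
  show "\<exists>y\<in>PGL2_points. proj_mult y x = matrix_class (mat 1)" if x: "x \<in> PGL2_points" for x
  proof -
    obtain A where A: "x = matrix_class A" "det A \<noteq> 0"
      using x by (rule PGL2_pointsE)
    show ?thesis
      unfolding A(1) using A(2)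
      by (intro bexI[of _ "matrix_class (adjugate2 A)"])
        (simp_all add: adjugate2_inverse matrix_class_in_PGL2_points det_adjugate2)
  qed
qed

text \<open>
  The adjugate, unlike the inverse, is a polynomial in the matrix, and has the same class.
\<close>

lemma inv_PGL2:
  assumes "g \<in> PGL2_points"
  shows "inv\<^bsub>PGL2\<^esub> g = matrix_class (adjugate2 (rep_matrix g))"
proof (rule group.inv_equality[OF group_PGL2])
  have det: "det (rep_matrix g) \<noteq> 0"
    using assms by (simp add: PGL2_points_def)
  show "matrix_class (adjugate2 (rep_matrix g)) \<otimes>\<^bsub>PGL2\<^esub> g = \<one>\<^bsub>PGL2\<^esub>"
    using adjugate2_inverse[OF det] by simp
  show "matrix_class (adjugate2 (rep_matrix g)) \<in> carrier PGL2"
    using det by (simp add: matrix_class_in_PGL2_points det_adjugate2)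
qed (use assms in simp)

lemma group_action_postcomposition: "group_action PGL2 R3_points postcomposition"
proof -
  interpret PGL2: group PGL2 by (rule group_PGL2)
  have bij: "postcomposition g \<in> Bij R3_points" if g: "g \<in> PGL2_points" for g
  proof -
    let ?h = "inv\<^bsub>PGL2\<^esub> g"
    have h: "?h \<in> PGL2_points"
      using PGL2.inv_closed[of g] g by simp
    have cancel: "proj_mult ?h (proj_mult g x) = x" "proj_mult g (proj_mult ?h x) = x"
      if x: "x \<in> R3_points" for x
      using proj_mult_assoc_R3[OF h g x] proj_mult_assoc_R3[OF g h x] proj_mult_one_R3[OF x]
        PGL2.l_inv[of g] PGL2.r_inv[of g] g by simp_all
    have "bij_betw (proj_mult g) R3_points R3_points"
      by (rule bij_betw_byWitness[where f' = "proj_mult ?h"])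
        (use cancel proj_mult_R3_closed[OF g] proj_mult_R3_closed[OF h] in auto)
    then show ?thesis
      by (auto simp: Bij_def postcomposition_def bij_betw_restrict_eq)
  qed
  have hom: "postcomposition \<in> hom PGL2 (BijGroup R3_points)"
  proof (rule homI)
    show "postcomposition g \<in> carrier (BijGroup R3_points)" if "g \<in> carrier PGL2" for g
      using that bij by (simp add: BijGroup_def)
    show "postcomposition (g \<otimes>\<^bsub>PGL2\<^esub> h) = postcomposition g \<otimes>\<^bsub>BijGroup R3_points\<^esub> postcomposition h"
      if "g \<in> carrier PGL2" "h \<in> carrier PGL2" for g h
    proof -
      have gh: "g \<in> PGL2_points" "h \<in> PGL2_points"
        using that by simp_all
      have "postcomposition (proj_mult g h) = compose R3_points (postcomposition g) (postcomposition h)"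
        by (rule ext)
          (simp add: postcomposition_def compose_def proj_mult_assoc_R3[OF gh] proj_mult_R3_closed[OF gh(2)])
      then show ?thesis
        using bij[OF gh(1)] bij[OF gh(2)] by (simp add: BijGroup_def)
    qed
  qed
  show ?thesis
    unfolding group_action_def group_hom_def group_hom_axioms_def
    by (intro conjI group_PGL2 group_BijGroup hom)
qed

section \<open>The quotient map and its local sections\<close>

text \<open>
  The quotient map \<open>R\<^sub>3 \<rightarrow> P\<^sup>4 - D\<close>: a pair of forms is sent to the adjugate of
  its Bezout matrix.
\<close>

definition hankel_map :: "(2 \<times> 4) proj \<Rightarrow> 5 proj" where
  "hankel_map x = abs_proj (hankel (minor (rep_matrix x)))"

text \<open>
  A pair of cubic forms spanning the kernel of the \<open>2 \<times> 4\<close> matrix with rows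
  \<open>X Y Z V\<close> and \<open>Y Z V W\<close>, normalised on the columns \<open>i\<close> and \<open>j\<close>.
\<close>

definition plane_section :: "4 \<Rightarrow> 4 \<Rightarrow> 5 proj \<Rightarrow> (2 \<times> 4) proj" where
  "plane_section i j y = matrix_class (plane_matrix (kernel_minor (rep_proj y)) i j)"

text \<open>
  The group component of the inverse of the local trivialisation: on the fibre over a point of the
  chart, the columns \<open>i\<close>, \<open>j\<close> measure the position relative to the section.
\<close>

definition frame :: "4 \<Rightarrow> 4 \<Rightarrow> (2 \<times> 4) proj \<Rightarrow> (2 \<times> 2) proj" where
  "frame i j x = matrix_class (columns2 i j (rep_matrix x))"

definition chart :: "4 \<Rightarrow> 4 \<Rightarrow> 5 proj set" where
  "chart i j = {y. y \<notin> D \<and> kernel_minor (rep_proj y) i j \<noteq> 0}"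

lemma D_form_scale: "D_form (c *s v) = c ^ 3 * D_form v"
  by (simp add: D_form_alt algebra_simps power2_eq_square power3_eq_cube)

lemma D_form_nonzero: "D_form v \<noteq> 0 \<Longrightarrow> v \<noteq> 0"
  by (auto simp: D_form_alt)

lemma D_form_rep_nonzero: "y \<notin> D \<Longrightarrow> D_form (rep_proj y) \<noteq> 0"
  by (simp add: D_def)

lemma D_form_hankel_minor: "regular_pencil M \<Longrightarrow> D_form (hankel (minor M)) \<noteq> 0"
  by (simp add: D_form_hankel[OF decomposable_minor] regular_pencil_def)

lemma abs_proj_notin_D:
  assumes "D_form v \<noteq> 0"
  shows "abs_proj v \<notin> D"
proof -
  obtain c where "c \<noteq> 0" "rep_proj (abs_proj v) = c *s v"
    using rep_abs_proj[OF D_form_nonzero[OF assms]] .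
  then show ?thesis
    using assms by (simp add: D_def D_form_scale)
qed

lemma hankel_map_class:
  assumes M: "regular_pencil M"
  shows "hankel_map (matrix_class M) = abs_proj (hankel (minor M))"
proof -
  obtain c where c: "c \<noteq> 0" "rep_matrix (matrix_class M) = scale_matrix c M"
    using rep_matrix_class[OF nonzero_of_regular_pencil[OF M]] .
  have "hankel (minor M) \<noteq> 0"
    by (rule D_form_nonzero[OF D_form_hankel_minor[OF M]])
  then show ?thesis
    unfolding hankel_map_def c(2) minor_scale_matrix hankel_scale using c(1) by (simp add: abs_proj_scale)
qed

lemma hankel_map_notin_D:
  assumes "x \<in> R3_points"
  shows "hankel_map x \<notin> D"
proof -
  obtain M where M: "x = matrix_class M" "regular_pencil M"
    using assms by (rule R3_pointsE)
  show ?thesis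
    unfolding M(1) hankel_map_class[OF M(2)] by (rule abs_proj_notin_D[OF D_form_hankel_minor[OF M(2)]])
qed

lemma hankel_map_proj_mult:
  assumes "g \<in> PGL2_points" "x \<in> R3_points"
  shows "hankel_map (proj_mult g x) = hankel_map x"
proof -
  obtain A where A: "g = matrix_class A" "det A \<noteq> 0"
    using assms(1) by (rule PGL2_pointsE)
  obtain M where M: "x = matrix_class M" "regular_pencil M"
    using assms(2) by (rule R3_pointsE)
  have minor: "minor (A ** M) = (\<lambda>i j. det A * minor M i j)"
    by (simp add: fun_eq_iff minor_matrix_mult)
  have "hankel (minor M) \<noteq> 0"
    by (rule D_form_nonzero[OF D_form_hankel_minor[OF M(2)]])
  then show ?thesis
    unfolding A(1) M(1) proj_mult_R3[OF A(2) M(2)] hankel_map_class[OF M(2)]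
      hankel_map_class[OF regular_pencil_mult[OF A(2) M(2)]] minor hankel_scale
    using A(2) by (simp add: abs_proj_scale)
qed

lemma regular_pencil_plane_matrix:
  assumes "D_form v \<noteq> 0" "kernel_minor v i j \<noteq> 0"
  shows "regular_pencil (plane_matrix (kernel_minor v) i j)"
  unfolding regular_pencil_def minor_plane_matrix[OF decomposable_kernel_minor] bezoutian_det_scale
    bezoutian_det_kernel_minor
  using assms by simp

lemma chartD:
  assumes "y \<in> chart i j"
  shows "D_form (rep_proj y) \<noteq> 0" "kernel_minor (rep_proj y) i j \<noteq> 0"
  using assms by (simp_all add: chart_def D_def)

lemma plane_section_in_R3_points:
  assumes "y \<in> chart i j"
  shows "plane_section i j y \<in> R3_points"
  unfolding plane_section_def
  by (rule matrix_class_in_R3_points[OF regular_pencil_plane_matrix[OF chartD[OF assms]]])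

text \<open>
  If all minors vanished, so would the Bezout determinant formed from them, which is the square of the
  nonzero determinant of the Hankel matrix.
\<close>

lemma chart_cover:
  assumes "y \<notin> D"
  obtains i j where "y \<in> chart i j"
proof -
  let ?P = "kernel_minor (rep_proj y)"
  have "bezoutian_det ?P \<noteq> 0"
    using D_form_rep_nonzero[OF assms] by (simp add: bezoutian_det_kernel_minor)
  have "\<exists>i j. ?P i j \<noteq> 0"
  proof (rule ccontr)
    assume "\<not> (\<exists>i j. ?P i j \<noteq> 0)"
    then have "?P = (\<lambda>i j. 0)"
      by (simp add: fun_eq_iff)
    then show False
      using \<open>bezoutian_det ?P \<noteq> 0\<close> by (simp add: bezoutian_det_def del: kernel_minor_simps)
  qed
  then show thesis
    using that assms by (auto simp: chart_def)
qed

lemma hankel_map_plane_section: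
  assumes "y \<in> chart i j"
  shows "hankel_map (plane_section i j y) = y"
proof -
  let ?v = "rep_proj y"
  note nz = chartD[OF assms]
  have "hankel_map (plane_section i j y) = abs_proj (((kernel_minor ?v i j)\<^sup>2 * D_form ?v) *s ?v)"
    unfolding plane_section_def hankel_map_class[OF regular_pencil_plane_matrix[OF nz]]
      minor_plane_matrix[OF decomposable_kernel_minor] hankel_scale hankel_kernel_minor
    by (simp add: vector_smult_assoc)
  also have "\<dots> = abs_proj ?v"
    using nz by (intro abs_proj_scale) simp_all
  finally show ?thesis by simp
qed

text \<open>
  The double adjugate returns the original Pluecker coordinates: the plane spanned by the two forms is
  determined by the value of the quotient map.
\<close>

lemma kernel_minor_hankel_map:
  assumes M: "regular_pencil M"
  obtains c where "c \<noteq> 0" "kernel_minor (rep_proj (hankel_map (matrix_class M))) = (\<lambda>i j. c * minor M i j)"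
proof -
  obtain c where c: "c \<noteq> 0" "rep_proj (abs_proj (hankel (minor M))) = c *s hankel (minor M)"
    using rep_abs_proj[OF D_form_nonzero[OF D_form_hankel_minor[OF M]]] .
  have "kernel_minor (rep_proj (hankel_map (matrix_class M)))
      = (\<lambda>i j. (c\<^sup>2 * bezoutian_det (minor M)) * minor M i j)"
    unfolding hankel_map_class[OF M] c(2) kernel_minor_scale kernel_minor_hankel[OF decomposable_minor]
    by (simp add: mult.assoc)
  then show thesis
    using that[of "c\<^sup>2 * bezoutian_det (minor M)"] c(1) M by (simp add: regular_pencil_def)
qed

lemma hankel_map_in_chart_iff:
  assumes M: "regular_pencil M"
  shows "hankel_map (matrix_class M) \<in> chart i j \<longleftrightarrow> minor M i j \<noteq> 0"
proof -
  obtain c where "c \<noteq> 0" "kernel_minor (rep_proj (hankel_map (matrix_class M))) = (\<lambda>i j. c * minor M i j)"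
    using kernel_minor_hankel_map[OF M] .
  then show ?thesis
    using hankel_map_notin_D[OF matrix_class_in_R3_points[OF M]] by (simp add: chart_def)
qed

lemma frame_class:
  assumes "minor M i j \<noteq> 0"
  shows "frame i j (matrix_class M) = matrix_class (columns2 i j M)"
proof -
  have det: "det (columns2 i j M) \<noteq> 0"
    using assms by (simp add: det_columns2)
  have "M \<noteq> 0"
    using assms by (auto simp: minor_def)
  then obtain c where c: "c \<noteq> 0" "rep_matrix (matrix_class M) = scale_matrix c M"
    by (rule rep_matrix_class)
  show ?thesis
    unfolding frame_def c(2) columns2_scale_matrix
    by (rule matrix_class_scale[OF c(1) nonzero_of_det[OF det]])
qed

lemma frame_in_PGL2_points:
  assumes "x \<in> R3_points" "hankel_map x \<in> chart i j"
  shows "frame i j x \<in> PGL2_points"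
proof -
  obtain M where M: "x = matrix_class M" "regular_pencil M"
    using assms(1) by (rule R3_pointsE)
  then have "minor M i j \<noteq> 0"
    using assms(2) hankel_map_in_chart_iff by simp
  then show ?thesis
    unfolding M(1) by (simp add: frame_class matrix_class_in_PGL2_points det_columns2)
qed

text \<open>
  The section over \<open>hankel_map x\<close> spans the same plane as \<open>x\<close>, and Cramer's rule expresses
  \<open>x\<close> through it.
\<close>

lemma frame_times_section:
  assumes "x \<in> R3_points" "hankel_map x \<in> chart i j"
  shows "proj_mult (frame i j x) (plane_section i j (hankel_map x)) = x"
proof -
  obtain M where M: "x = matrix_class M" "regular_pencil M"
    using assms(1) by (rule R3_pointsE)
  then have minor: "minor M i j \<noteq> 0"
    using assms(2) hankel_map_in_chart_iff by simp
  have det: "det (columns2 i j M) \<noteq> 0"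
    using minor by (simp add: det_columns2)
  obtain c where c: "c \<noteq> 0" "kernel_minor (rep_proj (hankel_map x)) = (\<lambda>i j. c * minor M i j)"
    using kernel_minor_hankel_map[OF M(2)] unfolding M(1) .
  have "regular_pencil (plane_matrix (kernel_minor (rep_proj (hankel_map x))) i j)"
    by (rule regular_pencil_plane_matrix[OF chartD[OF assms(2)]])
  then have pencil: "regular_pencil (plane_matrix (minor M) i j)"
    unfolding c(2) plane_matrix_scale regular_pencil_scale[OF c(1)] .
  have sec: "plane_section i j (hankel_map x) = matrix_class (plane_matrix (minor M) i j)"
    unfolding plane_section_def c(2) plane_matrix_scale
    by (rule matrix_class_scale[OF c(1) nonzero_of_regular_pencil[OF pencil]])
  show ?thesis
    unfolding sec unfolding M(1) frame_class[OF minor] proj_mult_R3[OF det pencil] columns2_mult_plane_matrix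
    by (rule matrix_class_scale[OF minor nonzero_of_regular_pencil[OF M(2)]])
qed

lemma frame_section_times:
  assumes g: "g \<in> PGL2_points" and y: "y \<in> chart i j"
  shows "frame i j (proj_mult g (plane_section i j y)) = g"
proof -
  obtain A where A: "g = matrix_class A" "det A \<noteq> 0"
    using g by (rule PGL2_pointsE)
  let ?P = "kernel_minor (rep_proj y)"
  let ?S = "plane_matrix ?P i j"
  note nz = chartD[OF y]
  have S: "regular_pencil ?S"
    by (rule regular_pencil_plane_matrix[OF nz])
  have "minor (A ** ?S) i j \<noteq> 0"
    using A(2) nz by (simp add: minor_matrix_mult minor_plane_matrix[OF decomposable_kernel_minor])
  then have "frame i j (proj_mult g (plane_section i j y)) = matrix_class (columns2 i j (A ** ?S))"
    unfolding A(1) plane_section_def proj_mult_R3[OF A(2) S] by (rule frame_class)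
  also have "columns2 i j (A ** ?S) = scale_matrix (?P i j) A"
  proof -
    have "columns2 i j (A ** ?S) = scale_matrix 1 A ** scale_matrix (?P i j) (mat 1)"
      unfolding columns2_matrix_mult columns2_plane_matrix[OF decomposable_kernel_minor]
      by (simp add: scale_matrix_def)
    then show ?thesis
      by (simp only: scale_matrix_mult matrix_mul_rid mult_1)
  qed
  also have "matrix_class (scale_matrix (?P i j) A) = g"
    unfolding A(1) using nz nonzero_of_det[OF A(2)] by (intro matrix_class_scale)
  finally show ?thesis .
qed

section \<open>Algebraicity of the maps involved\<close>

lemma bipolynomial_if:
  "bipolynomial p \<Longrightarrow> bipolynomial q \<Longrightarrow> bipolynomial (\<lambda>u v. if b then p u v else q u v)"
  by (cases b) simp_all

lemma bipolynomial_matrix_mult: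
  "bipolynomial (\<lambda>u v. of_matrix (to_matrix u ** to_matrix v) $ k)"
  unfolding of_matrix_nth matrix_matrix_mult_def vec_lambda_beta to_matrix_nth
  by (rule bipolynomial_sum, rule bipolynomial_mult; rule bipolynomial.intros)

lemma bipolynomial_upper_minor: "bipolynomial (\<lambda>u v. upper_minor u i j)"
  unfolding upper_minor_def by (intro bipolynomial_if bipolynomial_intros)

lemma bipolynomial_kernel_minor: "bipolynomial (\<lambda>u v. kernel_minor u i j)"
  unfolding kernel_minor_def by (intro bipolynomial_diff bipolynomial_upper_minor)

lemma bipolynomial_minor: "bipolynomial (\<lambda>u v. minor (to_matrix u) i j)"
  unfolding minor_def to_matrix_nth by (intro bipolynomial_intros)

lemma bipolynomial_hankel: "bipolynomial (\<lambda>u v. hankel (minor (to_matrix u)) $ k)"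
  unfolding hankel_def vec_lambda_beta
  by (intro bipolynomial_if bipolynomial_diff bipolynomial_add bipolynomial_mult bipolynomial_power
      bipolynomial_minor)

context space_with_functions
begin

lemma morphism_proj_mult:
  fixes \<phi> :: "'a \<Rightarrow> ('r::finite \<times> 'k::finite) proj" and \<psi> :: "'a \<Rightarrow> ('k \<times> 'c::finite) proj"
  assumes "morphism X projective_space \<phi>" "morphism X projective_space \<psi>"
    and nz: "\<And>z. z \<in> points X \<Longrightarrow> rep_matrix (\<phi> z) ** rep_matrix (\<psi> z) \<noteq> 0"
  shows "morphism X projective_space (\<lambda>z. proj_mult (\<phi> z) (\<psi> z))"
  unfolding proj_mult_def
proof (rule morphism_bihomogeneous[where Q = "\<lambda>u v. of_matrix (to_matrix u ** to_matrix v)", OF assms(1,2)])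
  show "bipolynomial (\<lambda>u v. of_matrix (to_matrix u ** to_matrix v) $ k)" for k :: "'r \<times> 'c"
    by (rule bipolynomial_matrix_mult)
  show "\<exists>c. c \<noteq> 0 \<and> of_matrix (to_matrix (a *s u) ** to_matrix (b *s v))
      = c *s of_matrix (to_matrix u ** to_matrix v)"
    if "a \<noteq> 0" "b \<noteq> 0" for a b and u :: "complex^('r \<times> 'k)" and v :: "complex^('k \<times> 'c)"
    using that unfolding to_matrix_scale scale_matrix_mult of_matrix_scale
    by (intro exI[of _ "a * b"]) simp
qed (simp add: nz)

lemma morphism_homogeneous:
  fixes \<phi> :: "'a \<Rightarrow> 'm::finite proj" and Q :: "complex^'m \<Rightarrow> complex^'k::finite"
  assumes \<phi>: "morphism X projective_space \<phi>"
    and poly: "\<And>k. bipolynomial (\<lambda>u v :: complex^'m. Q u $ k)"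
    and scale: "\<And>a u. Q (a *s u) = a ^ d *s Q u"
    and nz: "\<And>z. z \<in> points X \<Longrightarrow> Q (rep_proj (\<phi> z)) \<noteq> 0"
  shows "morphism X projective_space (\<lambda>z. abs_proj (Q (rep_proj (\<phi> z))))"
proof (rule morphism_bihomogeneous[where Q = "\<lambda>u v. Q u", OF \<phi> \<phi> poly _ nz])
  show "\<exists>c. c \<noteq> 0 \<and> Q (a *s u) = c *s Q u" if "a \<noteq> 0" for a u
    using that by (intro exI[of _ "a ^ d"]) (simp add: scale)
qed

end

interpretation projective_space: space_with_functions projective_space
  by (rule space_with_functions_projective_space)

lemma space_PGL2_variety: "space_with_functions PGL2_variety"
  unfolding PGL2_variety_def by (rule projective_space.space_with_functions_subspace_on)

lemma space_R3: "space_with_functions R3"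
  unfolding R3_def by (rule projective_space.space_with_functions_subspace_on)

lemma points_PGL2_variety [simp]: "points PGL2_variety = PGL2_points"
  by (simp add: PGL2_variety_def)

lemma points_R3 [simp]: "points R3 = R3_points"
  by (simp add: R3_def)

lemma morphism_into_ambient:
  assumes "space_with_functions X" "morphism Z (subspace_on X A) \<phi>"
  shows "morphism Z X \<phi>"
  using morphism_comp[OF assms(2) space_with_functions.morphism_inclusion[OF assms(1)]]
  by (simp add: comp_def)

lemma morphism_PGL2_variety_ambient:
  "morphism Z PGL2_variety \<phi> \<Longrightarrow> morphism Z projective_space \<phi>"
  unfolding PGL2_variety_def by (rule morphism_into_ambient[OF space_with_functions_projective_space])

lemma morphism_R3_ambient: "morphism Z R3 \<phi> \<Longrightarrow> morphism Z projective_space \<phi>"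
  unfolding R3_def by (rule morphism_into_ambient[OF space_with_functions_projective_space])

lemma morphism_id_ambient: "morphism (subspace_on projective_space A) projective_space (\<lambda>x. x)"
  by (rule projective_space.morphism_inclusion)

lemma rep_matrix_mult_nonzero:
  assumes "g \<in> PGL2_points" "x \<in> R3_points"
  shows "rep_matrix g ** rep_matrix x \<noteq> 0"
  using assms unfolding PGL2_points_def R3_points_eq
  by (intro nonzero_of_regular_pencil regular_pencil_mult) simp_all

lemma algebraic_group_PGL2: "algebraic_group PGL2 PGL2_variety"
  unfolding algebraic_group_def carrier_PGL2 points_PGL2_variety mult_PGL2
proof (intro conjI refl group_PGL2)
  interpret V: space_with_functions PGL2_variety by (rule space_PGL2_variety)
  let ?Z = "product_space PGL2_variety PGL2_variety"
  interpret Z: space_with_functions ?Z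
    by (rule space_with_functions_product_space[OF space_PGL2_variety space_PGL2_variety])
  have points_Z: "points ?Z = PGL2_points \<times> PGL2_points"
    by (simp add: topspace_product_zar[OF space_PGL2_variety space_PGL2_variety])
  have "morphism ?Z projective_space (\<lambda>z. proj_mult (fst z) (snd z))"
  proof (rule Z.morphism_proj_mult)
    show "morphism ?Z projective_space fst"
      by (rule morphism_PGL2_variety_ambient[OF morphism_fst[OF space_PGL2_variety space_PGL2_variety]])
    show "morphism ?Z projective_space snd"
      by (rule morphism_PGL2_variety_ambient[OF morphism_snd[OF space_PGL2_variety space_PGL2_variety]])
    fix z assume "z \<in> points ?Z"
    then have "det (rep_matrix (fst z) ** rep_matrix (snd z)) \<noteq> 0"
      unfolding points_Z by (auto simp: PGL2_points_def det_mul)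
    then show "rep_matrix (fst z) ** rep_matrix (snd z) \<noteq> 0"
      by (rule nonzero_of_det)
  qed
  then have "morphism ?Z (subspace_on projective_space PGL2_points) (\<lambda>z. proj_mult (fst z) (snd z))"
  proof (rule Z.morphism_into_subspace)
    show "proj_mult (fst z) (snd z) \<in> PGL2_points" if "z \<in> points ?Z" for z
      using that unfolding points_Z by (intro proj_mult_PGL2_closed) auto
  qed
  then have "morphism ?Z PGL2_variety (\<lambda>z. proj_mult (fst z) (snd z))"
    by (simp only: PGL2_variety_def)
  then show "morphism ?Z PGL2_variety (\<lambda>(g, h). proj_mult g h)"
    by (simp only: case_prod_beta')
  have "morphism PGL2_variety projective_space (\<lambda>g. matrix_class (adjugate2 (to_matrix (rep_proj g))))"
  proof (rule V.morphism_homogeneous[where d = 1])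
    show "morphism PGL2_variety projective_space (\<lambda>g. g)"
      unfolding PGL2_variety_def by (rule morphism_id_ambient)
    show "bipolynomial (\<lambda>u v :: complex^(2 \<times> 2). of_matrix (adjugate2 (to_matrix u)) $ k)" for k
      unfolding of_matrix_nth adjugate2_def vec_lambda_beta to_matrix_nth
      by (intro bipolynomial_if bipolynomial_intros)
    show "of_matrix (adjugate2 (to_matrix (a *s u))) = a ^ 1 *s of_matrix (adjugate2 (to_matrix u))" for a u
      by (simp add: to_matrix_scale adjugate2_scale of_matrix_scale)
    show "of_matrix (adjugate2 (rep_matrix g)) \<noteq> 0" if "g \<in> points PGL2_variety" for g
      using that nonzero_of_det[of "adjugate2 (rep_matrix g)"] by (simp add: det_adjugate2 PGL2_points_def)
  qed
  then have "morphism PGL2_variety projective_space (\<lambda>g. inv\<^bsub>PGL2\<^esub> g)"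
    by (rule V.morphism_cong) (simp add: inv_PGL2)
  then have "morphism PGL2_variety (subspace_on projective_space PGL2_points) (\<lambda>g. inv\<^bsub>PGL2\<^esub> g)"
    by (rule V.morphism_into_subspace) (use group.inv_closed[OF group_PGL2] in simp)
  then show "morphism PGL2_variety PGL2_variety (\<lambda>g. inv\<^bsub>PGL2\<^esub> g)"
    by (simp only: PGL2_variety_def)
qed

lemma morphism_postcomposition:
  "morphism (product_space PGL2_variety R3) R3 (\<lambda>(g, x). postcomposition g x)"
proof -
  let ?Z = "product_space PGL2_variety R3"
  interpret Z: space_with_functions ?Z
    by (rule space_with_functions_product_space[OF space_PGL2_variety space_R3])
  have points_Z: "points ?Z = PGL2_points \<times> R3_points"
    by (simp add: topspace_product_zar[OF space_PGL2_variety space_R3])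
  have "morphism ?Z projective_space (\<lambda>z. proj_mult (fst z) (snd z))"
  proof (rule Z.morphism_proj_mult)
    show "morphism ?Z projective_space fst"
      by (rule morphism_PGL2_variety_ambient[OF morphism_fst[OF space_PGL2_variety space_R3]])
    show "morphism ?Z projective_space snd"
      by (rule morphism_R3_ambient[OF morphism_snd[OF space_PGL2_variety space_R3]])
    show "rep_matrix (fst z) ** rep_matrix (snd z) \<noteq> 0" if "z \<in> points ?Z" for z
      using that unfolding points_Z by (intro rep_matrix_mult_nonzero) auto
  qed
  then have "morphism ?Z projective_space (\<lambda>(g, x). postcomposition g x)"
  proof (rule Z.morphism_cong)
    show "(\<lambda>(g, x). postcomposition g x) z = proj_mult (fst z) (snd z)" if "z \<in> points ?Z" for z
      using that unfolding points_Z by (auto simp: postcomposition_def)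
  qed
  then have "morphism ?Z (subspace_on projective_space R3_points) (\<lambda>(g, x). postcomposition g x)"
  proof (rule Z.morphism_into_subspace)
    show "(\<lambda>(g, x). postcomposition g x) z \<in> R3_points" if "z \<in> points ?Z" for z
      using that unfolding points_Z by (auto simp: postcomposition_def proj_mult_R3_closed)
  qed
  then show ?thesis
    by (simp only: R3_def)
qed

lemma morphism_hankel_map: "morphism R3 (subspace_on projective_space (- D)) hankel_map"
proof -
  interpret V: space_with_functions R3 by (rule space_R3)
  have "morphism R3 projective_space (\<lambda>x. abs_proj (hankel (minor (to_matrix (rep_proj x)))))"
  proof (rule V.morphism_homogeneous[where d = 4])
    show "morphism R3 projective_space (\<lambda>x. x)"
      unfolding R3_def by (rule morphism_id_ambient)
    show "bipolynomial (\<lambda>u v :: complex^(2 \<times> 4). hankel (minor (to_matrix u)) $ k)" for k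
      by (rule bipolynomial_hankel)
    show "hankel (minor (to_matrix (a *s u))) = a ^ 4 *s hankel (minor (to_matrix u))" for a u
      by (simp add: to_matrix_scale minor_scale_matrix hankel_scale)
    show "hankel (minor (rep_matrix x)) \<noteq> 0" if "x \<in> points R3" for x
      using that by (intro D_form_nonzero D_form_hankel_minor) (simp add: R3_points_eq)
  qed
  then have "morphism R3 projective_space hankel_map"
    unfolding hankel_map_def .
  then show ?thesis
    by (rule V.morphism_into_subspace) (simp add: hankel_map_notin_D)
qed

text \<open>
  The inverse of the trivialisation is \<open>x \<mapsto> (frame i j x, hankel_map x)\<close>; both maps are
  given by polynomials in homogeneous coordinates.
\<close>

lemma local_trivialization:
  fixes i j :: 4
  defines "Y \<equiv> subspace_on (subspace_on projective_space (- D)) (chart i j)"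
    and "X \<equiv> subspace_on R3 {x \<in> points R3. hankel_map x \<in> chart i j}"
  shows "isomorphism (product_space PGL2_variety Y) X (\<lambda>(g, y). proj_mult g (plane_section i j y))"
proof -
  have space_Y: "space_with_functions Y" and space_X: "space_with_functions X"
    unfolding Y_def X_def
    by (intro space_with_functions.space_with_functions_subspace_on space_R3
        space_with_functions_projective_space)+
  interpret X: space_with_functions X by (rule space_X)
  interpret Y: space_with_functions Y by (rule space_Y)
  let ?Z = "product_space PGL2_variety Y"
  interpret Z: space_with_functions ?Z
    by (rule space_with_functions_product_space[OF space_PGL2_variety space_Y])
  have points_Y: "points Y = chart i j"
    by (auto simp: Y_def chart_def)
  have points_X: "points X = {x \<in> R3_points. hankel_map x \<in> chart i j}"
    by (auto simp: X_def)
  have points_Z: "points ?Z = PGL2_points \<times> chart i j"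
    by (simp add: topspace_product_zar[OF space_PGL2_variety space_Y] points_Y)
  let ?\<phi> = "\<lambda>(g, y). proj_mult g (plane_section i j y)" and ?\<psi> = "\<lambda>x. (frame i j x, hankel_map x)"
  have into_X: "?\<phi> z \<in> points X" if z: "z \<in> points ?Z" for z
  proof -
    have "fst z \<in> PGL2_points" "snd z \<in> chart i j"
      using z unfolding points_Z by auto
    then show ?thesis
      by (simp add: points_X case_prod_beta' proj_mult_R3_closed hankel_map_proj_mult
          plane_section_in_R3_points hankel_map_plane_section)
  qed
  have \<phi>: "morphism ?Z X ?\<phi>"
  proof -
    have "morphism ?Z Y snd"
      by (rule morphism_snd[OF space_PGL2_variety space_Y])
    then have "morphism ?Z (subspace_on (subspace_on projective_space (- D)) (chart i j)) snd"
      by (simp only: Y_def)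
    then have "morphism ?Z (subspace_on projective_space (- D)) snd"
      by (rule morphism_into_ambient[OF projective_space.space_with_functions_subspace_on])
    then have snd: "morphism ?Z projective_space snd"
      by (rule morphism_into_ambient[OF space_with_functions_projective_space])
    have "morphism ?Z projective_space (\<lambda>z. matrix_class (plane_matrix (kernel_minor (rep_proj (snd z))) i j))"
    proof (rule Z.morphism_homogeneous[where d = 2, OF snd])
      show "bipolynomial (\<lambda>u v :: complex^5. of_matrix (plane_matrix (kernel_minor u) i j) $ k)" for k
        unfolding of_matrix_nth plane_matrix_def vec_lambda_beta
        by (intro bipolynomial_if bipolynomial_kernel_minor)
      show "of_matrix (plane_matrix (kernel_minor (a *s u)) i j)
          = a\<^sup>2 *s of_matrix (plane_matrix (kernel_minor u) i j)" for a u
        by (simp add: kernel_minor_scale plane_matrix_scale of_matrix_scale)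
      show "of_matrix (plane_matrix (kernel_minor (rep_proj (snd z))) i j) \<noteq> 0" if "z \<in> points ?Z" for z
      proof -
        have "snd z \<in> chart i j"
          using that unfolding points_Z by auto
        from nonzero_of_regular_pencil[OF regular_pencil_plane_matrix[OF chartD[OF this]]]
        show ?thesis by simp
      qed
    qed
    then have sec: "morphism ?Z projective_space (\<lambda>z. plane_section i j (snd z))"
      unfolding plane_section_def .
    have "morphism ?Z projective_space (\<lambda>z. proj_mult (fst z) (plane_section i j (snd z)))"
    proof (rule Z.morphism_proj_mult[OF _ sec])
      show "morphism ?Z projective_space fst"
        by (rule morphism_PGL2_variety_ambient[OF morphism_fst[OF space_PGL2_variety space_Y]])
      show "rep_matrix (fst z) ** rep_matrix (plane_section i j (snd z)) \<noteq> 0" if "z \<in> points ?Z" for z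
        using that unfolding points_Z by (intro rep_matrix_mult_nonzero plane_section_in_R3_points) auto
    qed
    then have "morphism ?Z projective_space ?\<phi>"
      by (simp add: case_prod_beta')
    then have "morphism ?Z R3 ?\<phi>"
      unfolding R3_def by (rule Z.morphism_into_subspace) (use into_X points_X in simp)
    then show ?thesis
      unfolding X_def by (rule Z.morphism_into_subspace) (use into_X points_X in simp)
  qed
  have \<psi>: "morphism X ?Z ?\<psi>"
  proof (rule morphism_Pair[OF space_PGL2_variety space_Y space_X])
    have id_R3: "morphism X R3 (\<lambda>x. x)"
      unfolding X_def by (rule space_with_functions.morphism_inclusion[OF space_R3])
    have "morphism X projective_space (\<lambda>x. matrix_class (columns2 i j (to_matrix (rep_proj x))))"
    proof (rule X.morphism_homogeneous[where d = 1, OF morphism_R3_ambient[OF id_R3]])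
      show "bipolynomial (\<lambda>u v :: complex^(2 \<times> 4). of_matrix (columns2 i j (to_matrix u)) $ k)" for k
        unfolding of_matrix_nth columns2_def vec_lambda_beta to_matrix_nth
        by (intro bipolynomial_if bipolynomial_intros)
      show "of_matrix (columns2 i j (to_matrix (a *s u))) = a ^ 1 *s of_matrix (columns2 i j (to_matrix u))" for a u
        by (simp add: to_matrix_scale columns2_scale_matrix of_matrix_scale)
      show "of_matrix (columns2 i j (rep_matrix x)) \<noteq> 0" if "x \<in> points X" for x
      proof -
        have x: "regular_pencil (rep_matrix x)" "hankel_map (matrix_class (rep_matrix x)) \<in> chart i j"
          using that by (simp_all add: points_X R3_points_eq)
        then have "det (columns2 i j (rep_matrix x)) \<noteq> 0"
          by (simp only: hankel_map_in_chart_iff[OF x(1)] det_columns2 not_False_eq_True)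
        then show ?thesis
          using nonzero_of_det by simp
      qed
    qed
    then have "morphism X projective_space (frame i j)"
      unfolding frame_def .
    then show "morphism X PGL2_variety (frame i j)"
      unfolding PGL2_variety_def
      by (rule X.morphism_into_subspace) (simp add: points_X frame_in_PGL2_points)
    have "morphism X (subspace_on projective_space (- D)) hankel_map"
      unfolding X_def by (rule space_with_functions.morphism_restrict[OF space_R3 morphism_hankel_map])
    then show "morphism X Y hankel_map"
      unfolding Y_def by (rule X.morphism_into_subspace) (simp add: points_X)
  qed
  have left_inverse: "\<forall>z \<in> points ?Z. ?\<psi> (?\<phi> z) = z"
  proof
    fix z assume z: "z \<in> points ?Z"
    have "fst z \<in> PGL2_points" "snd z \<in> chart i j"
      using z unfolding points_Z by auto
    then show "?\<psi> (?\<phi> z) = z"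
      by (simp add: case_prod_beta' frame_section_times hankel_map_proj_mult
          plane_section_in_R3_points hankel_map_plane_section)
  qed
  have right_inverse: "\<forall>x \<in> points X. ?\<phi> (?\<psi> x) = x"
    by (simp add: points_X frame_times_section)
  show ?thesis
    unfolding isomorphism_def
    by (intro conjI exI[of _ ?\<psi>]) (rule \<phi> \<psi> left_inverse right_inverse)+
qed

lemma homogeneous_kernel_minor: "(\<lambda>v. kernel_minor v i j) \<in> homogeneous 2"
proof -
  have quadric: "(\<lambda>v. v $ a * v $ b) \<in> homogeneous 2" for a b :: 5
    using homogeneous_mult[OF homogeneous_coordinate homogeneous_coordinate, of a b] by (simp add: numeral_2_eq_2)
  have scaled: "(\<lambda>v. c * f v) \<in> homogeneous 2" if "f \<in> homogeneous 2" for c and f :: "complex^5 \<Rightarrow> complex"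
    using homogeneous_mult[OF homogeneous_const that, of c] by (simp only: add_0)
  have diff: "(\<lambda>v. f v - g v) \<in> homogeneous 2" if "f \<in> homogeneous 2" "g \<in> homogeneous 2"
    for f g :: "complex^5 \<Rightarrow> complex"
    using homogeneous_add[OF that(1) scaled[OF that(2), of "-1"]] by simp
  have zero: "(\<lambda>v. 0) \<in> (homogeneous 2 :: (complex^5 \<Rightarrow> complex) set)"
    using scaled[OF quadric, of 0] by simp
  have cond: "(\<lambda>v. if b then f v else g v) \<in> homogeneous 2" if "f \<in> homogeneous 2" "g \<in> homogeneous 2"
    for b and f g :: "complex^5 \<Rightarrow> complex"
    using that by (cases b) simp_all
  have "(\<lambda>v. upper_minor v i j) \<in> homogeneous 2" for i j
    unfolding upper_minor_def power2_eq_square by (intro cond diff quadric zero)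
  then show ?thesis
    unfolding kernel_minor_def by (intro diff)
qed

lemma openin_chart: "openin (zar (subspace_on projective_space (- D))) (chart i j)"
proof -
  have "chart i j = {y. kernel_minor (rep_proj y) i j \<noteq> 0} \<inter> - D"
    by (auto simp: chart_def)
  then show ?thesis
    using openin_proj_nonvanishing[OF homogeneous_kernel_minor, of i j]
    by (simp add: openin_subtopology_Int)
qed

lemma principal_bundle_hankel_map:
  "algebraic_principal_bundle PGL2 PGL2_variety postcomposition R3
     (subspace_on projective_space (- D)) hankel_map"
  unfolding algebraic_principal_bundle_def carrier_PGL2 mult_PGL2
proof (intro conjI ballI)
  show "algebraic_group PGL2 PGL2_variety"
    by (rule algebraic_group_PGL2)
  show "group_action PGL2 (points R3) postcomposition"
    using group_action_postcomposition by simp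
  show "morphism (product_space PGL2_variety R3) R3 (\<lambda>(g, x). postcomposition g x)"
    by (rule morphism_postcomposition)
  show "morphism R3 (subspace_on projective_space (- D)) hankel_map"
    by (rule morphism_hankel_map)
  fix y assume "y \<in> points (subspace_on projective_space (- D) :: 5 proj fspace)"
  then have "y \<notin> D" by simp
  then obtain i j where y: "y \<in> chart i j"
    by (rule chart_cover)
  let ?\<phi> = "\<lambda>(g, y). proj_mult g (plane_section i j y)"
  have fibres: "\<forall>g\<in>PGL2_points. \<forall>v\<in>chart i j. hankel_map (?\<phi> (g, v)) = v"
    by (simp add: hankel_map_proj_mult plane_section_in_R3_points hankel_map_plane_section)
  have equivariant: "\<forall>g\<in>PGL2_points. \<forall>h\<in>PGL2_points. \<forall>v\<in>chart i j.
      ?\<phi> (proj_mult h g, v) = postcomposition h (?\<phi> (g, v))"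
    by (simp add: postcomposition_def proj_mult_R3_closed plane_section_in_R3_points
        proj_mult_assoc_R3)
  show "\<exists>V \<phi>. openin (zar (subspace_on projective_space (- D))) V \<and> y \<in> V \<and>
      isomorphism (product_space PGL2_variety (subspace_on (subspace_on projective_space (- D)) V))
        (subspace_on R3 {x \<in> points R3. hankel_map x \<in> V}) \<phi> \<and>
      (\<forall>g\<in>PGL2_points. \<forall>v\<in>V. hankel_map (\<phi> (g, v)) = v) \<and>
      (\<forall>g\<in>PGL2_points. \<forall>h\<in>PGL2_points. \<forall>v\<in>V. \<phi> (proj_mult h g, v) = postcomposition h (\<phi> (g, v)))"
    by (rule exI[of _ "chart i j"], rule exI[of _ ?\<phi>], intro conjI)
      (rule openin_chart y local_trivialization fibres equivariant)+
qed

section \<open>Irreducibility of the Hankel hypersurface\<close>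

text \<open>
  The kernel condition for the Hankel matrix of \<open>v\<close>. Equivalently, the sequence of coordinates
  of \<open>v\<close> satisfies the linear recurrence with coefficients \<open>a\<close>, \<open>b\<close>, \<open>c\<close>.
\<close>

definition annihilates :: "complex \<Rightarrow> complex \<Rightarrow> complex \<Rightarrow> complex^5 \<Rightarrow> bool" where
  "annihilates a b c v \<longleftrightarrow> a * v $ 1 + b * v $ 2 + c * v $ 3 = 0 \<and>
     a * v $ 2 + b * v $ 3 + c * v $ 4 = 0 \<and> a * v $ 3 + b * v $ 4 + c * v $ 5 = 0"

text \<open>
  Cramer's rule: multiplying the kernel condition by the adjugate of the Hankel matrix gives
  \<open>D_form v\<close> times \<open>(a, b, c)\<close>.
\<close>

lemma D_form_zero_if_annihilated:
  assumes "(a, b, c) \<noteq> (0, 0, 0)" "annihilates a b c v"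
  shows "D_form v = 0"
proof -
  have "a * D_form v = 0" "b * D_form v = 0" "c * D_form v = 0"
    using assms(2) unfolding annihilates_def D_form_alt by algebra+
  then show ?thesis
    using assms(1) by auto
qed

lemma annihilator_if_D_form_zero:
  assumes "D_form v = 0"
  obtains a b c where "(a, b, c) \<noteq> (0, 0, 0)" "annihilates a b c v"
proof -
  define H :: "complex^3^3" where
    "H = (\<chi> i j. if i = 1 then (if j = 1 then v $ 1 else if j = 2 then v $ 2 else v $ 3)
            else if i = 2 then (if j = 1 then v $ 2 else if j = 2 then v $ 3 else v $ 4)
            else (if j = 1 then v $ 3 else if j = 2 then v $ 4 else v $ 5))"
  have "det H = D_form v"
    by (simp add: det_3 H_def D_form_alt) (simp add: algebra_simps power2_eq_square power3_eq_cube)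
  then have "\<not> invertible H"
    using assms by (simp add: invertible_det_nz)
  then have "\<nexists>B. B ** H = mat 1"
    by (simp add: invertible_left_inverse)
  then obtain x where x: "H *v x = 0" "x \<noteq> 0"
    unfolding matrix_left_invertible_ker by blast
  have "(H *v x) $ 1 = 0" "(H *v x) $ 2 = 0" "(H *v x) $ 3 = 0"
    unfolding x(1) by simp_all
  then have "annihilates (x $ 1) (x $ 2) (x $ 3) v"
    by (simp add: annihilates_def matrix_vector_mult_def sum_3 H_def mult.commute)
  moreover have "(x $ 1, x $ 2, x $ 3) \<noteq> (0, 0, 0)"
    using x(2) by (auto simp: vec_eq_iff forall_3)
  ultimately show thesis
    using that by blast
qed

text \<open>
  A polynomial parametrisation of the cone over \<open>D\<close>. The first three parameters are the
  recurrence \<open>a\<close>, \<open>b\<close>, \<open>c\<close>; its solutions form the kernel of a \<open>3 \<times> 5\<close>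
  matrix, and the coefficients of the other four parameters are the kernel vectors made of the signed
  \<open>3 \<times> 3\<close> minors of four of its five columns, namely \<open>1345\<close>, \<open>2345\<close>,
  \<open>1234\<close> and \<open>1235\<close>.
\<close>

definition annihilated_vector :: "complex^7 \<Rightarrow> complex^5" where
  "annihilated_vector w = (let a = w $ 1; b = w $ 2; c = w $ 3 in
     (\<chi> k. if k = 1 then w $ 4 * c^3 + w $ 6 * (2 * a * b * c - b^3) + w $ 7 * (a * c^2 - b^2 * c)
       else if k = 2 then w $ 5 * c^3 + w $ 6 * (a * b^2 - a^2 * c) + w $ 7 * (a * b * c)
       else if k = 3 then - w $ 4 * (a * c^2) - w $ 5 * (b * c^2) - w $ 6 * (a^2 * b) - w $ 7 * (a^2 * c)
       else if k = 4 then w $ 4 * (a * b * c) + w $ 5 * (b^2 * c - a * c^2) + w $ 6 * a^3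
       else w $ 4 * (a^2 * c - a * b^2) + w $ 5 * (2 * a * b * c - b^3) + w $ 7 * a^3))"

lemma annihilates_annihilated_vector:
  "annihilates (w $ 1) (w $ 2) (w $ 3) (annihilated_vector w)"
  unfolding annihilates_def annihilated_vector_def Let_def
  by (simp add: algebra_simps power2_eq_square power3_eq_cube)

lemma D_form_annihilated_vector: "D_form (annihilated_vector w) = 0"
proof (cases "(w $ 1, w $ 2, w $ 3) = (0, 0, 0)")
  case True
  then have "annihilated_vector w = 0"
    by (simp add: annihilated_vector_def vec_eq_iff)
  then show ?thesis
    by (simp add: D_form_alt)
next
  case False
  then show ?thesis
    using D_form_zero_if_annihilated annihilates_annihilated_vector by blast
qed

text \<open>
  If \<open>c \<noteq> 0\<close>, the recurrence can be run forwards from the first two coordinates; if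
  \<open>a \<noteq> 0\<close>, backwards from the last two; if only \<open>b \<noteq> 0\<close>, the three inner coordinates
  vanish and the outer two are free. Four kernel vectors suffice for all three cases.
\<close>

lemma annihilated_vector_surj:
  assumes "D_form v = 0"
  obtains w where "annihilated_vector w = v"
proof -
  obtain a b c where abc: "(a, b, c) \<noteq> (0, 0, 0)" and ann: "annihilates a b c v"
    using annihilator_if_D_form_zero[OF assms] .
  define w :: "complex \<Rightarrow> complex \<Rightarrow> complex \<Rightarrow> complex \<Rightarrow> complex^7" where
    "w p q r s = (\<chi> k. if k = 1 then a else if k = 2 then b else if k = 3 then c
        else if k = 4 then p else if k = 5 then q else if k = 6 then r else s)" for p q r s
  have w: "w p q r s $ 1 = a" "w p q r s $ 2 = b" "w p q r s $ 3 = c" "w p q r s $ 4 = p"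
    "w p q r s $ 5 = q" "w p q r s $ 6 = r" "w p q r s $ 7 = s" for p q r s
    by (simp_all add: w_def)
  have e: "a * v $ 1 + b * v $ 2 + c * v $ 3 = 0" "a * v $ 2 + b * v $ 3 + c * v $ 4 = 0"
    "a * v $ 3 + b * v $ 4 + c * v $ 5 = 0"
    using ann by (simp_all add: annihilates_def)
  consider "c \<noteq> 0" | "a \<noteq> 0" | "a = 0" "c = 0" "b \<noteq> 0"
    using abc by auto
  then show thesis
  proof cases
    case 1
    have "v $ 3 * c^3 = - v $ 1 * (a * c^2) - v $ 2 * (b * c^2)"
      "v $ 4 * c^3 = v $ 1 * (a * b * c) + v $ 2 * (b^2 * c - a * c^2)"
      "v $ 5 * c^3 = v $ 1 * (a^2 * c - a * b^2) + v $ 2 * (2 * a * b * c - b^3)"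
      using e by algebra+
    then show thesis
      using 1 by (intro that[of "w (v $ 1 / c^3) (v $ 2 / c^3) 0 0"])
        (simp add: annihilated_vector_def vec_eq_iff forall_5 w divide_simps)
  next
    case 2
    have "v $ 3 * a^3 = - v $ 4 * (a^2 * b) - v $ 5 * (a^2 * c)"
      "v $ 2 * a^3 = v $ 4 * (a * b^2 - a^2 * c) + v $ 5 * (a * b * c)"
      "v $ 1 * a^3 = v $ 4 * (2 * a * b * c - b^3) + v $ 5 * (a * c^2 - b^2 * c)"
      using e by algebra+
    then show thesis
      using 2 by (intro that[of "w 0 0 (v $ 4 / a^3) (v $ 5 / a^3)"])
        (simp add: annihilated_vector_def vec_eq_iff forall_5 w divide_simps)
  next
    case 3
    then have "v $ 2 = 0" "v $ 3 = 0" "v $ 4 = 0"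
      using e by simp_all
    then show thesis
      using 3 by (intro that[of "w 0 (- v $ 5 / b^3) (- v $ 1 / b^3) 0"])
        (simp add: annihilated_vector_def vec_eq_iff forall_5 w)
  qed
qed

lemma bipolynomial_annihilated_vector: "bipolynomial (\<lambda>w v. annihilated_vector w $ k)"
  unfolding annihilated_vector_def Let_def vec_lambda_beta
  by (intro bipolynomial_if bipolynomial_intros)

lemma bipolynomial_along_line:
  assumes "bipolynomial q"
  shows "\<exists>p. \<forall>t. q (u + t *s u') (v + t *s v') = poly p t"
  using assms
proof induction
  case (bipolynomial_fst i)
  show ?case by (rule exI[of _ "[:u $ i, u' $ i:]"]) simp
next
  case (bipolynomial_snd i)
  show ?case by (rule exI[of _ "[:v $ i, v' $ i:]"]) simp
next
  case (bipolynomial_const c)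
  show ?case by (rule exI[of _ "[:c:]"]) simp
next
  case (bipolynomial_add q r)
  obtain p1 p2 where "\<forall>t. q (u + t *s u') (v + t *s v') = poly p1 t" "\<forall>t. r (u + t *s u') (v + t *s v') = poly p2 t"
    using bipolynomial_add.IH by blast
  then show ?case by (intro exI[of _ "p1 + p2"]) simp
next
  case (bipolynomial_mult q r)
  obtain p1 p2 where "\<forall>t. q (u + t *s u') (v + t *s v') = poly p1 t" "\<forall>t. r (u + t *s u') (v + t *s v') = poly p2 t"
    using bipolynomial_mult.IH by blast
  then show ?case by (intro exI[of _ "p1 * p2"]) simp
qed

lemma poly_homogeneous_along_curve:
  assumes f: "f \<in> homogeneous d" and v: "\<And>k. \<exists>p. \<forall>t. v t $ k = poly p t"
  shows "\<exists>p. \<forall>t. f (v t) = poly p t"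
proof (rule homogeneous_closure[where R = "\<lambda>g. \<exists>p. \<forall>t. g t = poly p t", OF f _ _ _ v])
  show "\<exists>p. \<forall>t. c = poly p t" for c :: complex
    by (rule exI[of _ "[:c:]"]) simp
  show "\<exists>p. \<forall>t. g t + h t = poly p t" if "\<exists>p. \<forall>t. g t = poly p t" "\<exists>p. \<forall>t. h t = poly p t"
    for g h :: "complex \<Rightarrow> complex"
  proof -
    from that obtain p q where "\<forall>t. g t = poly p t" "\<forall>t. h t = poly q t" by blast
    then show ?thesis by (intro exI[of _ "p + q"]) simp
  qed
  show "\<exists>p. \<forall>t. g t * h t = poly p t" if "\<exists>p. \<forall>t. g t = poly p t" "\<exists>p. \<forall>t. h t = poly p t"
    for g h :: "complex \<Rightarrow> complex"
  proof -
    from that obtain p q where "\<forall>t. g t = poly p t" "\<forall>t. h t = poly q t" by blast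
    then show ?thesis by (intro exI[of _ "p * q"]) simp
  qed
qed

text \<open>
  The nonvanishing loci of forms are closed under finite intersections, as forms are closed under
  products, so that they are a basis and not merely a subbasis.
\<close>

lemma openin_proj_zar_basis:
  assumes "openin proj_zar U" "x \<in> U"
  obtains f d where "f \<in> homogeneous d" "f (rep_proj x) \<noteq> 0" "{z. f (rep_proj z) \<noteq> 0} \<subseteq> U"
proof -
  have "generate_topology_on {{x. f (rep_proj x) \<noteq> 0} | f d. f \<in> homogeneous d} U"
    using assms(1) by (simp add: proj_zar_def openin_topology_generated_by_iff)
  then have "x \<in> U \<longrightarrow> (\<exists>f d. f \<in> homogeneous d \<and> f (rep_proj x) \<noteq> 0 \<and> {z. f (rep_proj z) \<noteq> 0} \<subseteq> U)"
  proof induction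
    case Empty
    then show ?case by simp
  next
    case (Int V W)
    show ?case
    proof
      assume "x \<in> V \<inter> W"
      then obtain f d g e where "f \<in> homogeneous d" "f (rep_proj x) \<noteq> 0" "{z. f (rep_proj z) \<noteq> 0} \<subseteq> V"
        "g \<in> homogeneous e" "g (rep_proj x) \<noteq> 0" "{z. g (rep_proj z) \<noteq> 0} \<subseteq> W"
        using Int.IH by auto
      then show "\<exists>f d. f \<in> homogeneous d \<and> f (rep_proj x) \<noteq> 0 \<and> {z. f (rep_proj z) \<noteq> 0} \<subseteq> V \<inter> W"
        using homogeneous_mult[of f d g e]
        by (intro exI[of _ "\<lambda>v. f v * g v"] exI[of _ "d + e"]) auto
    qed
  next
    case (UN K)
    show ?case
    proof
      assume "x \<in> \<Union>K"
      then obtain k where k: "k \<in> K" "x \<in> k" by blast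
      then obtain f d where "f \<in> homogeneous d" "f (rep_proj x) \<noteq> 0" "{z. f (rep_proj z) \<noteq> 0} \<subseteq> k"
        using UN.IH[OF k(1)] by blast
      then show "\<exists>f d. f \<in> homogeneous d \<and> f (rep_proj x) \<noteq> 0 \<and> {z. f (rep_proj z) \<noteq> 0} \<subseteq> \<Union>K"
        using k(1) by (intro exI[of _ f] exI[of _ d]) auto
    qed
  next
    case (Basis S)
    then show ?case by blast
  qed
  then show thesis
    using that assms(2) by blast
qed

text \<open>
  Let two points of \<open>D\<close> lie outside the closed sets \<open>A\<close> and \<open>B\<close>, and separate them
  from these by forms \<open>f\<close> and \<open>g\<close>. The straight line between parameters of the two points
  maps to a polynomial curve in the cone over \<open>D\<close>, along which \<open>f\<close> and \<open>g\<close> become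
  nonzero polynomials in one variable; some point of the curve is a zero of neither.
\<close>

lemma irreducible_D: "irreducible_set proj_zar D"
  unfolding irreducible_set_def
proof (intro conjI allI impI)
  show "D \<subseteq> topspace proj_zar" by simp
  show "D \<noteq> {}"
  proof -
    let ?e = "axis 1 1 :: complex^5"
    have "?e \<noteq> 0" by simp
    then obtain c where "rep_proj (abs_proj ?e) = c *s ?e"
      by (rule rep_abs_proj)
    then have "abs_proj ?e \<in> D"
      by (simp add: D_def D_form_scale D_form_alt axis_def)
    then show ?thesis by blast
  qed
  fix A B assume A: "closedin proj_zar A" and B: "closedin proj_zar B" and cover: "D \<subseteq> A \<union> B"
  show "D \<subseteq> A \<or> D \<subseteq> B"
  proof (rule ccontr)
    assume "\<not> (D \<subseteq> A \<or> D \<subseteq> B)"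
    then obtain x y where x: "x \<in> D" "x \<in> - A" and y: "y \<in> D" "y \<in> - B"
      by blast
    have "openin proj_zar (- A)" "openin proj_zar (- B)"
      using A B by (simp_all add: closedin_def Compl_eq_Diff_UNIV)
    then obtain f d g e where f: "f \<in> homogeneous d" "f (rep_proj x) \<noteq> 0" "{z. f (rep_proj z) \<noteq> 0} \<subseteq> - A"
      and g: "g \<in> homogeneous e" "g (rep_proj y) \<noteq> 0" "{z. g (rep_proj z) \<noteq> 0} \<subseteq> - B"
      using openin_proj_zar_basis[OF _ x(2)] openin_proj_zar_basis[OF _ y(2)] by metis
    obtain w where w: "annihilated_vector w = rep_proj x"
      using x(1) by (auto simp: D_def elim: annihilated_vector_surj)
    obtain w' where w': "annihilated_vector w' = rep_proj y"
      using y(1) by (auto simp: D_def elim: annihilated_vector_surj)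
    define v where "v t = annihilated_vector (w + t *s (w' - w))" for t
    have v01: "v 0 = rep_proj x" "v 1 = rep_proj y"
      by (simp_all add: v_def w w')
    have v_poly: "\<exists>p. \<forall>t. v t $ k = poly p t" for k
      unfolding v_def by (rule bipolynomial_along_line[OF bipolynomial_annihilated_vector])
    obtain k where k: "rep_proj x $ k \<noteq> 0"
      using rep_proj_nonzero[of x] by (auto simp: vec_eq_iff simp del: rep_proj_nonzero)
    obtain p where p: "\<And>t. f (v t) = poly p t"
      using poly_homogeneous_along_curve[OF f(1) v_poly] by blast
    obtain q where q: "\<And>t. g (v t) = poly q t"
      using poly_homogeneous_along_curve[OF g(1) v_poly] by blast
    \<comment> \<open>The curve may pass through the origin, which defines no point of projective space; the
      polynomial \<open>r\<close> keeps the chosen parameter away from it.\<close>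
    obtain r where r: "\<And>t. v t $ k = poly r t"
      using v_poly by blast
    have "poly p 0 \<noteq> 0" "poly q 1 \<noteq> 0" "poly r 0 \<noteq> 0"
      using p[of 0] q[of 1] r[of 0] f(2) g(2) k v01 by simp_all
    then have "p \<noteq> 0" "q \<noteq> 0" "r \<noteq> 0"
      by auto
    then have "p * q * r \<noteq> 0" by simp
    then obtain t where "poly (p * q * r) t \<noteq> 0"
      by (metis poly_all_0_iff_0)
    then have "f (v t) \<noteq> 0" "g (v t) \<noteq> 0" "v t $ k \<noteq> 0"
      by (simp_all add: p q r)
    then have t: "f (v t) \<noteq> 0" "g (v t) \<noteq> 0" "v t \<noteq> 0"
      by auto
    obtain c where c: "c \<noteq> 0" "rep_proj (abs_proj (v t)) = c *s v t"
      using rep_abs_proj[OF t(3)] .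
    let ?z = "abs_proj (v t)"
    have "?z \<in> D"
      using c by (simp add: D_def D_form_scale v_def D_form_annihilated_vector)
    moreover have "f (rep_proj ?z) \<noteq> 0" "g (rep_proj ?z) \<noteq> 0"
      using c t by (simp_all add: homogeneous_scale[OF f(1)] homogeneous_scale[OF g(1)])
    ultimately show False
      using cover f(3) g(3) by blast
  qed
qed

section \<open>The principal bundle\<close>

theorem theorem8p4:
  "(\<exists>\<pi> :: (2 \<times> 4) proj \<Rightarrow> 5 proj.
      algebraic_principal_bundle PGL2 PGL2_variety postcomposition
        R3 (subspace_on projective_space (- D)) \<pi>)
   \<and> irreducible_set (proj_zar :: 5 proj topology) D"
  using principal_bundle_hankel_map irreducible_D by blast

end
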